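(* For any infinite minimal subshift $(X,\varphi)$ over a finite alphabet, the group $\mathsf{T}(\varphi)$ is simple, finitely generated, and left-orderable.
   Context: A group is left-orderable if it admits a total order invariant under left multiplication. A Stone system $(X,\varphi)$ is a non-empty totally disconnected compact Hausdorff space $X$ together with a self-homeomorphism $\varphi$ of $X$; it is minimal if every $\varphi$-orbit is dense, and infinite if $X$ is infinite. A subshift over a finite alphabet $A$ is a Stone system $(X,\varphi)$ where $X\subset A^{\mathbb Z}$ is a non-empty closed shift-invariant subset and $\varphi$ is the restriction of the shift. Suspension: $Y^\varphi=(X\times\mathbb R)/\mathbb Z$, the quotient by the $\mathbb Z$-action $n\cdot(x,t)=(\varphi^n(x),t-n)$; $[x,t]$ is the class of $(x,t)$, and the suspension flow is $\Phi^t([x,s])=[x,s+t]$. $\mathsf{H}_0(\varphi)$ is the group of homeomorphisms of $Y^\varphi$ that are isotopic to the identity; equivalently (Boyle–Carlsen–Eilers), the homeomorphisms $g$ of $Y^\varphi$ for which there is a continuous $\tau\colon Y^\varphi\to\mathbb R$ with $g(y)=\Phi^{\tau(y)}(y)$ for all $y$. Charts: for a clopen $C\subset X$ put $\tau_C=\min\{n\ge1:\exists x\in C,\ \varphi^n(x)\in C\}\in\mathbb N\cup\{\infty\}$. For an open interval $J\subset\mathbb R$ of length $|J|<\tau_C$, the map $\pi_{C,J}\colon C\times J\to Y^\varphi$, $(x,t)\mapsto[x,t]$, is injective; it is called a chart and its image is denoted $U_{C\times J}$ (a domain). A dyadic rational is a number $p/2^q$ with $p,q\in\mathbb Z$; an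 interval is dyadic if it is bounded with dyadic rational endpoints; a chart $\pi_{C,J}$ is dyadic if $J$ is. A piecewise linear (PL) homeomorphism between intervals is a homeomorphism that is piecewise affine with finitely many breakpoints; it is dyadic if both intervals are dyadic, the breakpoints are dyadic rationals, and each affine piece has the form $x\mapsto2^mx+b$ with $m\in\mathbb Z$, $b$ a dyadic rational. $\mathsf{T}(\varphi)$ is the group of all $g\in\mathsf{H}_0(\varphi)$ such that for every $y\in Y^\varphi$ there are a dyadic chart $\pi_{C,J}$ with $y\in U_{C\times J}$ and a dyadic PL homeomorphism $f\colon J\to f(J)\subset\mathbb R$ such that $g(U_{C\times J})=U_{C\times f(J)}$ and $\pi_{C,f(J)}^{-1}\circ g\circ\pi_{C,J}$ is the map $(x,t)\mapsto(x,f(t))$. *)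

theory Defs
  imports "HOL-Analysis.Analysis" "HOL-Algebra.Bij" "HOL-Algebra.Generated_Groups"
begin

section \<open>Groups\<close>

text \<open>The locale \<open>simple_group\<close> of HOL-Algebra requires \<open>order G > 1\<close>, and \<open>order G = 0\<close> when the
  carrier is infinite, so it only covers finite groups.\<close>

definition is_simple :: "('g, 'b) monoid_scheme \<Rightarrow> bool" where
  "is_simple G \<longleftrightarrow> group G \<and> carrier G \<noteq> {\<one>\<^bsub>G\<^esub>} \<and>
     (\<forall>N. N \<lhd> G \<longrightarrow> N = carrier G \<or> N = {\<one>\<^bsub>G\<^esub>})"

definition finitely_generated :: "('g, 'b) monoid_scheme \<Rightarrow> bool" where
  "finitely_generated G \<longleftrightarrow> group G \<and>
     (\<exists>E. finite E \<and> E \<subseteq> carrier G \<and> generate G E = carrier G)"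

definition left_orderable :: "('g, 'b) monoid_scheme \<Rightarrow> bool" where
  "left_orderable G \<longleftrightarrow> group G \<and>
     (\<exists>r. linear_order_on (carrier G) r \<and>
       (\<forall>a\<in>carrier G. \<forall>b\<in>carrier G. \<forall>c\<in>carrier G.
          (a, b) \<in> r \<longrightarrow> (c \<otimes>\<^bsub>G\<^esub> a, c \<otimes>\<^bsub>G\<^esub> b) \<in> r))"

section \<open>Stone systems and subshifts\<close>

definition stone_system :: "'x topology \<Rightarrow> ('x \<Rightarrow> 'x) \<Rightarrow> bool" where
  "stone_system X \<phi> \<longleftrightarrow> topspace X \<noteq> {} \<and> compact_space X \<and> Hausdorff_space X \<and>
     (\<forall>S. connectedin X S \<longrightarrow> (\<exists>x. S \<subseteq> {x})) \<and> homeomorphic_map X X \<phi>"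

text \<open>The integer power \<open>\<phi>\<^sup>n\<close> of a bijection \<open>\<phi>\<close> of \<open>S\<close>; it is meaningful on \<open>S\<close> only.\<close>

definition int_iter :: "'x set \<Rightarrow> ('x \<Rightarrow> 'x) \<Rightarrow> int \<Rightarrow> 'x \<Rightarrow> 'x" where
  "int_iter S \<phi> n = (if 0 \<le> n then \<phi> ^^ nat n else inv_into S \<phi> ^^ nat (- n))"

definition minimal_system :: "'x topology \<Rightarrow> ('x \<Rightarrow> 'x) \<Rightarrow> bool" where
  "minimal_system X \<phi> \<longleftrightarrow>
     (\<forall>x\<in>topspace X. X closure_of (range (\<lambda>n. int_iter (topspace X) \<phi> n x)) = topspace X)"

definition shift :: "(int \<Rightarrow> 'a) \<Rightarrow> int \<Rightarrow> 'a" where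
  "shift x = (\<lambda>i. x (i + 1))"

definition full_shift :: "'a set \<Rightarrow> (int \<Rightarrow> 'a) topology" where
  "full_shift A = product_topology (\<lambda>_. discrete_topology A) UNIV"

definition subshift :: "'a set \<Rightarrow> (int \<Rightarrow> 'a) topology \<Rightarrow> bool" where
  "subshift A X \<longleftrightarrow> (\<exists>S. S \<noteq> {} \<and> closedin (full_shift A) S \<and> shift ` S = S \<and>
     X = subtopology (full_shift A) S)"

lemma subshift_stone_system:
  assumes "finite A" "subshift A X" shows "stone_system X shift"
proof -
  obtain S where S: "S \<noteq> {}" "closedin (full_shift A) S" "shift ` S = S"
      and X: "X = subtopology (full_shift A) S"
    using assms(2) unfolding subshift_def by blast
  have top: "topspace X = S" using closedin_subset[OF S(2)] by (auto simp: X)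
  have "compact_space (full_shift A)"
    using assms(1) by (simp add: full_shift_def compact_space_product_topology compact_space_discrete_topology)
  then have "compact_space X"
    using S(2) closedin_compact_space compact_space_subtopology X by blast
  moreover have "Hausdorff_space X"
    unfolding X full_shift_def
    by (intro Hausdorff_space_subtopology) (simp add: Hausdorff_space_product_topology)
  moreover have coord: "continuous_map X (discrete_topology A) (\<lambda>x. x i)" for i
    unfolding X full_shift_def
    by (intro continuous_map_from_subtopology continuous_map_product_projection) simp
  have "\<exists>x. U \<subseteq> {x}" if U: "connectedin X U" for U
  proof -
    have "\<exists>a. (\<lambda>x. x i) ` U \<subseteq> {a}" for i
      using connectedin_continuous_map_image[OF coord U] by (auto simp: connectedin_discrete_topology)
    then obtain a where "\<And>i. (\<lambda>x. x i) ` U \<subseteq> {a i}" by metis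
    then have "U \<subseteq> {a}" by fastforce
    then show ?thesis by blast
  qed
  moreover have "homeomorphic_map X X shift"
  proof -
    have inj: "inj (shift :: (int \<Rightarrow> 'a) \<Rightarrow> _)"
    proof (rule injI)
      fix x y :: "int \<Rightarrow> 'a" assume "shift x = shift y"
      then have "x (i - 1 + 1) = y (i - 1 + 1)" for i unfolding shift_def by metis
      then show "x = y" by auto
    qed
    have "continuous_map X (full_shift A) shift"
      unfolding full_shift_def shift_def using coord by (simp add: continuous_map_componentwise_UNIV)
    then have "continuous_map X (subtopology (full_shift A) S) shift"
      using S(3) by (intro continuous_map_into_subtopology) (auto simp: top)
    then have "continuous_map X X shift" by (simp flip: X)
    then show ?thesis
      using continuous_imp_homeomorphic_map[of X X shift] \<open>compact_space X\<close> \<open>Hausdorff_space X\<close> S(3) inj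
      by (auto simp: top inj_on_subset)
  qed
  ultimately show ?thesis
    using S(1) unfolding stone_system_def by (auto simp: top)
qed

section \<open>The suspension\<close>

definition susp_action :: "'x topology \<Rightarrow> ('x \<Rightarrow> 'x) \<Rightarrow> int \<Rightarrow> 'x \<times> real \<Rightarrow> 'x \<times> real" where
  "susp_action X \<phi> n = (\<lambda>(x, t). (int_iter (topspace X) \<phi> n x, t - of_int n))"

text \<open>The class \<open>[x,t]\<close>, that is, the orbit of \<open>(x,t)\<close> under the action of the integers.\<close>

definition susp_class :: "'x topology \<Rightarrow> ('x \<Rightarrow> 'x) \<Rightarrow> 'x \<times> real \<Rightarrow> ('x \<times> real) set" where
  "susp_class X \<phi> p = range (\<lambda>n. susp_action X \<phi> n p)"

definition suspension :: "'x topology \<Rightarrow> ('x \<Rightarrow> 'x) \<Rightarrow> ('x \<times> real) set topology" where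
  "suspension X \<phi> = topology (\<lambda>U. U \<subseteq> susp_class X \<phi> ` (topspace X \<times> UNIV) \<and>
     openin (prod_topology X euclideanreal) {p \<in> topspace X \<times> UNIV. susp_class X \<phi> p \<in> U})"

lemma openin_suspension:
  "openin (suspension X \<phi>) U \<longleftrightarrow> U \<subseteq> susp_class X \<phi> ` (topspace X \<times> UNIV) \<and>
     openin (prod_topology X euclideanreal) {p \<in> topspace X \<times> UNIV. susp_class X \<phi> p \<in> U}"
proof -
  let ?P = "prod_topology X euclideanreal" and ?q = "susp_class X \<phi>"
  have "istopology (\<lambda>U. U \<subseteq> ?q ` (topspace X \<times> UNIV) \<and>
          openin ?P {p \<in> topspace X \<times> UNIV. ?q p \<in> U})"
    unfolding istopology_def
  proof (intro conjI allI impI)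
    fix S T :: "('a \<times> real) set set"
    assume S: "S \<subseteq> ?q ` (topspace X \<times> UNIV) \<and> openin ?P {p \<in> topspace X \<times> UNIV. ?q p \<in> S}"
      and T: "T \<subseteq> ?q ` (topspace X \<times> UNIV) \<and> openin ?P {p \<in> topspace X \<times> UNIV. ?q p \<in> T}"
    show "S \<inter> T \<subseteq> ?q ` (topspace X \<times> UNIV)" using S by blast
    have "{p \<in> topspace X \<times> UNIV. ?q p \<in> S \<inter> T} =
        {p \<in> topspace X \<times> UNIV. ?q p \<in> S} \<inter> {p \<in> topspace X \<times> UNIV. ?q p \<in> T}" by blast
    then show "openin ?P {p \<in> topspace X \<times> UNIV. ?q p \<in> S \<inter> T}"
      using S T by (simp only: openin_Int)
  next
    fix \<K> :: "('a \<times> real) set set set"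
    assume K: "\<forall>K\<in>\<K>. K \<subseteq> ?q ` (topspace X \<times> UNIV) \<and>
        openin ?P {p \<in> topspace X \<times> UNIV. ?q p \<in> K}"
    show "\<Union>\<K> \<subseteq> ?q ` (topspace X \<times> UNIV)" using K by blast
    have "{p \<in> topspace X \<times> UNIV. ?q p \<in> \<Union>\<K>} =
        (\<Union>K\<in>\<K>. {p \<in> topspace X \<times> UNIV. ?q p \<in> K})" by blast
    then show "openin ?P {p \<in> topspace X \<times> UNIV. ?q p \<in> \<Union>\<K>}"
      using K by (simp only:) (rule openin_Union, blast)
  qed
  from topology_inverse'[OF this] show ?thesis unfolding suspension_def by simp
qed

lemma topspace_suspension: "topspace (suspension X \<phi>) = susp_class X \<phi> ` (topspace X \<times> UNIV)"
proof
  show "topspace (suspension X \<phi>) \<subseteq> susp_class X \<phi> ` (topspace X \<times> UNIV)"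
    using openin_suspension[of X \<phi>] openin_topspace by blast
  have "{p \<in> topspace X \<times> (UNIV :: real set). susp_class X \<phi> p \<in> susp_class X \<phi> ` (topspace X \<times> UNIV)}
      = topspace (prod_topology X euclideanreal)" by auto
  then have "openin (suspension X \<phi>) (susp_class X \<phi> ` (topspace X \<times> UNIV))"
    unfolding openin_suspension by (simp only: openin_topspace order_refl simp_thms)
  then show "susp_class X \<phi> ` (topspace X \<times> UNIV) \<subseteq> topspace (suspension X \<phi>)"
    by (rule openin_subset)
qed

lemma quotient_map_susp_class:
  "quotient_map (prod_topology X euclideanreal) (suspension X \<phi>) (susp_class X \<phi>)"
  by (auto simp: quotient_map_def topspace_suspension openin_suspension)

text \<open>Homeomorphisms of the suspension that are isotopic to the identity. As in \<open>BijGroup\<close>, maps are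
  extensional so that each homeomorphism is represented by exactly one HOL function.\<close>

definition H0 :: "'x topology \<Rightarrow> ('x \<Rightarrow> 'x) \<Rightarrow> (('x \<times> real) set \<Rightarrow> ('x \<times> real) set) set" where
  "H0 X \<phi> = {g \<in> extensional (topspace (suspension X \<phi>)).
     homeomorphic_map (suspension X \<phi>) (suspension X \<phi>) g \<and>
     homotopic_with (homeomorphic_map (suspension X \<phi>) (suspension X \<phi>))
       (suspension X \<phi>) (suspension X \<phi>) (\<lambda>y. y) g}"

section \<open>Charts\<close>

definition return_time :: "('x \<Rightarrow> 'x) \<Rightarrow> 'x set \<Rightarrow> enat" where
  "return_time \<phi> C = (INF n\<in>{n. 1 \<le> n \<and> (\<exists>x\<in>C. (\<phi> ^^ n) x \<in> C)}. enat n)"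

text \<open>Since \<open>|J| < \<tau>\<^sub>C\<close>, the interval of a chart is bounded even if \<open>\<tau>\<^sub>C = \<infinity>\<close>.\<close>

definition is_chart :: "'x topology \<Rightarrow> ('x \<Rightarrow> 'x) \<Rightarrow> 'x set \<Rightarrow> real set \<Rightarrow> bool" where
  "is_chart X \<phi> C J \<longleftrightarrow> openin X C \<and> closedin X C \<and>
     (\<exists>a b. a < b \<and> J = {a<..<b} \<and> ereal (b - a) < ereal_of_enat (return_time \<phi> C))"

text \<open>The chart map itself is the restriction of \<open>susp_class X \<phi>\<close> to \<open>C \<times> J\<close>.\<close>

definition chart_domain :: "'x topology \<Rightarrow> ('x \<Rightarrow> 'x) \<Rightarrow> 'x set \<Rightarrow> real set \<Rightarrow> ('x \<times> real) set set" where
  "chart_domain X \<phi> C J = susp_class X \<phi> ` (C \<times> J)"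

section \<open>Dyadic piecewise linear homeomorphisms\<close>

definition dyadic_rationals :: "real set" where
  "dyadic_rationals = {of_int p / 2 powi q | p q :: int. True}"

definition dyadic_interval :: "real set \<Rightarrow> bool" where
  "dyadic_interval J \<longleftrightarrow> is_interval J \<and> bounded J \<and> J \<noteq> {} \<and>
     Inf J \<in> dyadic_rationals \<and> Sup J \<in> dyadic_rationals"

text \<open>\<open>B\<close> is a finite set containing all breakpoints, and \<open>f\<close> is affine on every interval avoiding \<open>B\<close>.\<close>

definition dyadic_PL_homeo :: "real set \<Rightarrow> real set \<Rightarrow> (real \<Rightarrow> real) \<Rightarrow> bool" where
  "dyadic_PL_homeo J K f \<longleftrightarrow> dyadic_interval J \<and> dyadic_interval K \<and>
     homeomorphic_map (top_of_set J) (top_of_set K) f \<and>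
     (\<exists>B. finite B \<and> B \<subseteq> dyadic_rationals \<and>
       (\<forall>I. is_interval I \<and> I \<subseteq> J - B \<longrightarrow>
          (\<exists>(m::int) b. b \<in> dyadic_rationals \<and> (\<forall>x\<in>I. f x = 2 powi m * x + b))))"

section \<open>The group\<close>

definition T_set :: "'x topology \<Rightarrow> ('x \<Rightarrow> 'x) \<Rightarrow> (('x \<times> real) set \<Rightarrow> ('x \<times> real) set) set" where
  "T_set X \<phi> = {g \<in> H0 X \<phi>. \<forall>y\<in>topspace (suspension X \<phi>). \<exists>C J f.
     is_chart X \<phi> C J \<and> dyadic_interval J \<and> y \<in> chart_domain X \<phi> C J \<and>
     dyadic_PL_homeo J (f ` J) f \<and> is_chart X \<phi> C (f ` J) \<and>
     g ` chart_domain X \<phi> C J = chart_domain X \<phi> C (f ` J) \<and>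
     (\<forall>x\<in>C. \<forall>t\<in>J.
        inv_into (C \<times> f ` J) (susp_class X \<phi>) (g (susp_class X \<phi> (x, t))) = (x, f t))}"

definition T_group ::
    "'x topology \<Rightarrow> ('x \<Rightarrow> 'x) \<Rightarrow> (('x \<times> real) set \<Rightarrow> ('x \<times> real) set) monoid" where
  "T_group X \<phi> = (BijGroup (topspace (suspension X \<phi>))) \<lparr>carrier := T_set X \<phi>\<rparr>"

end

theory Submission
  imports Defs
begin

text \<open>A minimal infinite subshift has no periodic points, so every orbit of the suspension flow is a line and
  the group \<open>T\<close> acts faithfully on one orbit, which is dense, by increasing homeomorphisms. Ordering these
  lexicographically along a well-order of the line gives a left order.

  Write \<open>F(C, J)\<close> for the copy of Thompson's group supported in the chart over \<open>C \<times> J\<close>. These copies generate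
  \<open>T\<close>: for \<open>g\<close> in \<open>T\<close> and a small clopen \<open>C\<close>, some \<open>h\<close> in a single \<open>F(C, J)\<close> agrees with \<open>g\<close> near
  \<open>C \<times> {0}\<close>, and \<open>h^-1 g\<close> then splits along the Kakutani-Rokhlin towers over \<open>C\<close>.

  Simplicity: a nontrivial element of a normal subgroup moves some chart off itself, so the subgroup contains
  all commutators from that chart. The pentagon relation shows that compactly supported elements of Thompson's
  group are products of commutators, and by minimality every point can be moved into the given chart along its
  orbit.

  Finite generation: start from \<open>F(P, (0, 2))\<close> for the cylinders \<open>P\<close> of one fixed length. Commutators of
  elements over \<open>D\<close> and over a translate of \<open>D'\<close> are elements over their intersection, because time
  intervals that differ by 1 overlap. In this way all longer cylinders, hence all clopen sets, are reached.\<close>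

section \<open>Dyadic piecewise linear homeomorphisms of the line\<close>

text \<open>The constraint behind most statements is that a copy of Thompson's group over a clopen
  \<open>D\<close> only makes sense for time intervals no longer than the return time of
  \<open>D\<close>. Longer intervals are needed all the time, to conjugate supports into each other.
  So an assertion about \<open>emb D f\<close> is first proved for clopen sets near one point, where
  return times are large, and then reassembled over disjoint pieces of \<open>D\<close>. Height 1 is
  the opposite extreme: a window of length 1 never meets its integer translates, whatever the base,
  which makes commutators over different bases computable. Height 2 is the smallest integer height
  at which a window overlaps its translate by 1. Supports lie compactly inside open intervals,
  because the slopes at the two ends are characters of the group of a closed interval, which is
  therefore not perfect. The algebra takes place in equivariant families of maps of the line, where
  continuity is a statement about finite windows of letters; the quotient topology enters only when
  these families are matched with the elements of \<open>T_set\<close>.\<close>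

text \<open>HOL-Algebra claims the syntax \<open>inv\<close> for group inverses.\<close>

abbreviation finv :: "('b \<Rightarrow> 'b) \<Rightarrow> 'b \<Rightarrow> 'b" where "finv f \<equiv> inv_into UNIV f"

section \<open>Arithmetic and density of dyadic rationals\<close>

lemma dyadic_iff: "x \<in> dyadic_rationals \<longleftrightarrow> (\<exists>(p::int) (n::nat). x = of_int p / 2 ^ n)"
proof
  assume "x \<in> dyadic_rationals"
  then obtain p q :: int where x: "x = of_int p / 2 powi q" unfolding dyadic_rationals_def by blast
  show "\<exists>(p::int) (n::nat). x = of_int p / 2 ^ n"
  proof (cases "q \<ge> 0")
    case True
    then show ?thesis using x by (auto simp: power_int_def)
  next
    case False
    then have "x = of_int (p * 2 ^ nat (-q)) / 2 ^ 0" using x by (simp add: power_int_def field_simps)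
    then show ?thesis by blast
  qed
next
  assume "\<exists>(p::int) (n::nat). x = of_int p / 2 ^ n"
  then obtain p :: int and n :: nat where "x = of_int p / 2 ^ n" by blast
  then have "x = of_int p / 2 powi (int n)" by simp
  then show "x \<in> dyadic_rationals" unfolding dyadic_rationals_def by blast
qed

lemma dyadic_add [intro]:
  assumes "x \<in> dyadic_rationals" "y \<in> dyadic_rationals" shows "x + y \<in> dyadic_rationals"
proof -
  obtain p n q m where "x = of_int p / 2 ^ n" "y = of_int q / 2 ^ m" using assms dyadic_iff by metis
  then have "x + y = of_int (p * 2 ^ m + q * 2 ^ n) / 2 ^ (n + m)"
    by (simp add: add_frac_eq power_add)
  then show ?thesis using dyadic_iff by blast
qed

lemma dyadic_mult [intro]:
  assumes "x \<in> dyadic_rationals" "y \<in> dyadic_rationals" shows "x * y \<in> dyadic_rationals"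
proof -
  obtain p n q m where "x = of_int p / 2 ^ n" "y = of_int q / 2 ^ m" using assms dyadic_iff by metis
  then have "x * y = of_int (p * q) / 2 ^ (n + m)"
    by (simp only: times_divide_times_eq power_add of_int_mult)
  then show ?thesis using dyadic_iff by blast
qed

lemma dyadic_of_int [simp, intro]: "of_int p \<in> dyadic_rationals"
  unfolding dyadic_iff by (rule exI[of _ p], rule exI[of _ 0]) simp

lemma dyadic_of_nat [simp, intro]: "of_nat p \<in> dyadic_rationals"
  using dyadic_of_int[of "int p"] by simp

lemma dyadic_numeral [simp, intro]: "numeral p \<in> dyadic_rationals"
  using dyadic_of_int[of "numeral p"] by simp

lemma dyadic_0 [simp, intro]: "0 \<in> dyadic_rationals" and dyadic_1 [simp, intro]: "1 \<in> dyadic_rationals"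
  using dyadic_of_int[of 0] dyadic_of_int[of 1] by simp_all

lemma dyadic_uminus [intro]: assumes "x \<in> dyadic_rationals" shows "- x \<in> dyadic_rationals"
  using dyadic_mult[OF dyadic_of_int[of "-1"] assms] by simp

lemma dyadic_diff [intro]:
  assumes "x \<in> dyadic_rationals" "y \<in> dyadic_rationals" shows "x - y \<in> dyadic_rationals"
  using dyadic_add[OF assms(1) dyadic_uminus[OF assms(2)]] by simp

lemma dyadic_powi [simp, intro]: "2 powi m \<in> dyadic_rationals"
proof -
  have "2 powi m = of_int 1 / (2::real) powi (- m)" by (simp add: power_int_minus field_simps)
  then show ?thesis unfolding dyadic_rationals_def by blast
qed

lemma dyadic_divide_2 [intro]: assumes "x \<in> dyadic_rationals" shows "x / 2 \<in> dyadic_rationals"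
  using dyadic_mult[OF assms dyadic_powi[of "-1"]] by (simp add: power_int_minus field_simps)

lemma dyadic_dense: assumes "a < b" obtains d where "d \<in> dyadic_rationals" "a < d" "d < b"
proof -
  obtain n :: nat where n: "1 / (b - a) < 2 ^ n" using real_arch_pow[of 2 "1/(b-a)"] by auto
  define p where "p = floor (a * 2 ^ n) + 1"
  have p1: "a * 2 ^ n < of_int p" unfolding p_def by linarith
  have p2: "of_int p \<le> a * 2 ^ n + 1" unfolding p_def by linarith
  have "1 < (b - a) * 2 ^ n" using n assms by (simp add: field_simps)
  then have p3: "of_int p < b * 2 ^ n" using p2 by (simp add: algebra_simps)
  have "of_int p / 2 ^ n \<in> dyadic_rationals" using dyadic_iff by blast
  moreover have "a < of_int p / 2 ^ n" using p1 by (simp add: field_simps)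
  moreover have "of_int p / 2 ^ n < b" using p3 by (simp add: field_simps)
  ultimately show thesis using that by blast
qed

section \<open>Maps of the line with dyadic affine germs\<close>

definition aff_on :: "(real \<Rightarrow> real) \<Rightarrow> real set \<Rightarrow> bool" where
  "aff_on f A \<longleftrightarrow> (\<exists>(m::int) b. b \<in> dyadic_rationals \<and> (\<forall>t\<in>A. f t = 2 powi m * t + b))"

text \<open>The local form makes closure under composition, inversion and gluing at dyadic points immediate,
  and it also covers homeomorphisms of the line with infinitely many breakpoints.\<close>

definition PLloc :: "(real \<Rightarrow> real) \<Rightarrow> bool" where
  "PLloc f \<longleftrightarrow> (\<forall>t. \<exists>e>0. aff_on f {t-e..t} \<and> aff_on f {t..t+e} \<and>
     (t \<in> dyadic_rationals \<or> aff_on f {t-e..t+e}))"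

text \<open>The local form already forces a strictly increasing continuous map, so surjectivity
  turns it into a homeomorphism of the line.\<close>

definition PL :: "(real \<Rightarrow> real) set" where
  "PL = {f. PLloc f \<and> surj f}"

lemma aff_on_subset: "aff_on f A \<Longrightarrow> B \<subseteq> A \<Longrightarrow> aff_on f B"
  unfolding aff_on_def by blast

lemma aff_on_cong: "aff_on f A \<Longrightarrow> (\<And>t. t \<in> A \<Longrightarrow> g t = f t) \<Longrightarrow> aff_on g A"
  unfolding aff_on_def by metis

lemma aff_on_comp:
  assumes "aff_on g A" "aff_on f B" "g ` A \<subseteq> B" shows "aff_on (f \<circ> g) A"
proof -
  obtain m b where g: "b \<in> dyadic_rationals" "\<forall>t\<in>A. g t = 2 powi m * t + b"
    using assms(1) unfolding aff_on_def by blast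
  obtain m' b' where f: "b' \<in> dyadic_rationals" "\<forall>t\<in>B. f t = 2 powi m' * t + b'"
    using assms(2) unfolding aff_on_def by blast
  have "\<forall>t\<in>A. (f \<circ> g) t = 2 powi (m' + m) * t + (2 powi m' * b + b')"
    using f(2) g(2) assms(3) by (auto simp: image_subset_iff power_int_add algebra_simps)
  moreover have "2 powi m' * b + b' \<in> dyadic_rationals" using f g by auto
  ultimately show ?thesis unfolding aff_on_def by blast
qed

lemma PLlocE:
  assumes "PLloc f"
  obtains e where "e > 0" "aff_on f {t-e..t}" "aff_on f {t..t+e}"
    "t \<in> dyadic_rationals \<or> aff_on f {t-e..t+e}"
  using assms unfolding PLloc_def by metis

text \<open>Slopes are powers of 2, hence positive on either side of each point, and Bolzano's
  interval induction makes this global.\<close>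

lemma PLloc_strict_mono: assumes "PLloc f" shows "strict_mono f"
proof (rule strict_monoI)
  fix x y :: real assume "x < y"
  have "x \<le> y" using \<open>x < y\<close> by simp
  \<comment> \<open>The implication is trivially true on degenerate intervals, which the induction
    also has to join.\<close>
  then have "x < y \<longrightarrow> f x < f y"
  proof (induction rule: Bolzano)
    case (trans a b c) then show ?case by (cases "a = b"; cases "b = c") auto
  next
    case (local t)
    obtain e where e: "e > 0" "aff_on f {t-e..t}" "aff_on f {t..t+e}" using PLlocE[OF assms] by metis
    have *: "f u < f v" if A: "aff_on f A" and "u \<in> A" "v \<in> A" "u < v" for A u v
    proof -
      obtain m b where "\<forall>t\<in>A. f t = 2 powi m * t + b" using A unfolding aff_on_def by blast
      then show ?thesis using that by simp
    qed
    have "f a < f b" if "a \<le> t" "t \<le> b" "b - a < e" "a < b" for a b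
    proof -
      have "a = t \<or> f a < f t" using *[OF e(2), of a t] that by fastforce
      moreover have "b = t \<or> f t < f b" using *[OF e(3), of t b] that by fastforce
      ultimately show ?thesis using that by force
    qed
    then show ?case using e(1) by blast
  qed
  then show "f x < f y" using \<open>x < y\<close> by simp
qed

text \<open>The sum of the two one-sided slopes serves as constant. Besides continuity, this gives
  an explicit radius on which a composition stays inside the affine pieces of the outer map.\<close>

lemma PLloc_lipschitz: assumes "PLloc f"
  obtains e L where "e > 0" "L > 0" "\<And>s. \<bar>s - t\<bar> \<le> e \<Longrightarrow> \<bar>f s - f t\<bar> \<le> L * \<bar>s - t\<bar>"
proof -
  obtain e where e: "e > 0" "aff_on f {t-e..t}" "aff_on f {t..t+e}" using PLlocE[OF assms] by metis
  obtain m b where m: "\<forall>t\<in>{t-e..t}. f t = 2 powi m * t + b" using e(2) unfolding aff_on_def by blast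
  obtain m' b' where m': "\<forall>t\<in>{t..t+e}. f t = 2 powi m' * t + b'" using e(3) unfolding aff_on_def by blast
  define L :: real where "L = 2 powi m + 2 powi m'"
  have pos: "(2::real) powi m > 0" "(2::real) powi m' > 0" by simp_all
  have "\<bar>f s - f t\<bar> \<le> L * \<bar>s - t\<bar>" if "\<bar>s - t\<bar> \<le> e" for s
  proof (cases "s \<le> t")
    case True
    then have "f s - f t = 2 powi m * (s - t)" using m that e(1) by (simp add: algebra_simps)
    then have "\<bar>f s - f t\<bar> = 2 powi m * \<bar>s - t\<bar>" using pos by (simp add: abs_mult)
    then show ?thesis unfolding L_def using pos by (simp add: distrib_right)
  next
    case False
    then have "f s - f t = 2 powi m' * (s - t)" using m' that e(1) by (simp add: algebra_simps)
    then have "\<bar>f s - f t\<bar> = 2 powi m' * \<bar>s - t\<bar>" using pos by (simp add: abs_mult)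
    then show ?thesis unfolding L_def using pos by (simp add: distrib_right)
  qed
  moreover have "L > 0" using pos unfolding L_def by linarith
  ultimately show thesis using that e(1) by blast
qed

lemma PLloc_isCont: assumes "PLloc f" shows "isCont f t"
proof -
  obtain e L where L: "e > 0" "L > 0" "\<And>s. \<bar>s - t\<bar> \<le> e \<Longrightarrow> \<bar>f s - f t\<bar> \<le> L * \<bar>s - t\<bar>"
    using PLloc_lipschitz[OF assms] by metis
  show ?thesis unfolding continuous_at_eps_delta
  proof (intro allI impI)
    fix r :: real assume "r > 0"
    show "\<exists>d>0. \<forall>x'. dist x' t < d \<longrightarrow> dist (f x') (f t) < r"
    proof (intro exI conjI allI impI)
      show "min e (r / (2 * L)) > 0" using L \<open>r > 0\<close> by simp
      fix x' assume "dist x' t < min e (r / (2 * L))"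
      then have "\<bar>x' - t\<bar> \<le> e" "\<bar>x' - t\<bar> < r / (2 * L)" by (auto simp: dist_real_def)
      have "L * \<bar>x' - t\<bar> \<le> L * (r / (2 * L))" using L \<open>\<bar>x' - t\<bar> < r / (2 * L)\<close> by (intro mult_left_mono) auto
      also have "\<dots> < r" using L(2) \<open>r > 0\<close> by simp
      finally have "L * \<bar>x' - t\<bar> < r" .
      then show "dist (f x') (f t) < r" using L(3) \<open>\<bar>x' - t\<bar> \<le> e\<close> by (force simp: dist_real_def)
    qed
  qed
qed

lemma PL_strict_mono: "f \<in> PL \<Longrightarrow> strict_mono f"
  unfolding PL_def using PLloc_strict_mono by blast

lemma PL_less_iff: "f \<in> PL \<Longrightarrow> f x < f y \<longleftrightarrow> x < y"
  using PL_strict_mono strict_mono_less by blast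

lemma PL_le_iff: "f \<in> PL \<Longrightarrow> f x \<le> f y \<longleftrightarrow> x \<le> y"
  using PL_strict_mono strict_mono_less_eq by blast

lemma PL_eq_iff: "f \<in> PL \<Longrightarrow> f x = f y \<longleftrightarrow> x = y"
  using PL_strict_mono strict_mono_eq by blast

lemma PL_surj: "f \<in> PL \<Longrightarrow> surj f"
  unfolding PL_def by blast

lemma PL_bij: "f \<in> PL \<Longrightarrow> bij f"
  by (simp add: bij_betw_def PL_surj strict_mono_imp_inj_on[OF PL_strict_mono])

lemma PL_inv_eq: assumes "f \<in> PL" shows "finv f (f t) = t" "f (finv f t) = t"
  using inv_f_f[OF bij_is_inj[OF PL_bij[OF assms]]] surj_f_inv_f[OF PL_surj[OF assms]] by blast+

lemma PL_comp_inv: "f \<in> PL \<Longrightarrow> finv f \<circ> f = id" "f \<in> PL \<Longrightarrow> f \<circ> finv f = id"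
  by (simp_all add: PL_inv_eq fun_eq_iff)

lemma aff_dyadic: "aff_on f A \<Longrightarrow> t \<in> A \<Longrightarrow> f t \<in> dyadic_rationals \<longleftrightarrow> t \<in> dyadic_rationals"
proof -
  assume "aff_on f A" and t: "t \<in> A"
  then obtain m b where m: "b \<in> dyadic_rationals" "\<forall>t\<in>A. f t = 2 powi m * t + b"
    unfolding aff_on_def by blast
  have ft: "f t = 2 powi m * t + b" using m(2) t by blast
  have eq: "t = 2 powi (-m) * (f t - b)" unfolding ft by (simp add: power_int_minus)
  show ?thesis
  proof
    assume "f t \<in> dyadic_rationals"
    then have "2 powi (-m) * (f t - b) \<in> dyadic_rationals" using m(1) by (intro dyadic_mult dyadic_diff dyadic_powi)
    then show "t \<in> dyadic_rationals" using eq by simp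
  next
    assume "t \<in> dyadic_rationals"
    then show "f t \<in> dyadic_rationals" unfolding ft using m(1) by (intro dyadic_mult dyadic_add dyadic_powi)
  qed
qed

text \<open>The clause of \<open>PLloc\<close> about non-dyadic points passes to compositions and
  inverses because these maps preserve the dyadic points as well as their complement.\<close>

lemma PLloc_dyadic: "PLloc f \<Longrightarrow> f t \<in> dyadic_rationals \<longleftrightarrow> t \<in> dyadic_rationals"
  by (rule PLlocE[of f t], assumption) (rule aff_dyadic[of f "{t-_..t}"], auto)

lemma PL_dyadic: "f \<in> PL \<Longrightarrow> f t \<in> dyadic_rationals \<longleftrightarrow> t \<in> dyadic_rationals"
  using PLloc_dyadic PL_def by blast

lemma PLloc_comp: assumes f: "PLloc f" and g: "PLloc g" shows "PLloc (f \<circ> g)"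
  unfolding PLloc_def
proof
  fix t
  obtain e1 where e1: "e1 > 0" "aff_on g {t-e1..t}" "aff_on g {t..t+e1}"
    "t \<in> dyadic_rationals \<or> aff_on g {t-e1..t+e1}" using PLlocE[OF g] by metis
  obtain e2 where e2: "e2 > 0" "aff_on f {g t-e2..g t}" "aff_on f {g t..g t+e2}"
    "g t \<in> dyadic_rationals \<or> aff_on f {g t-e2..g t+e2}" using PLlocE[OF f] by metis
  obtain e3 L where L: "e3 > 0" "L > 0" "\<And>s. \<bar>s - t\<bar> \<le> e3 \<Longrightarrow> \<bar>g s - g t\<bar> \<le> L * \<bar>s - t\<bar>"
    using PLloc_lipschitz[OF g] by metis
  \<comment> \<open>The bound \<open>e2 / L\<close> keeps the image under \<open>g\<close> inside
    the radius where \<open>f\<close> is affine on each side.\<close>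
  define e where "e = min e1 (min e3 (e2 / L))"
  have e: "e > 0" "e \<le> e1" "e \<le> e3" "e \<le> e2 / L" using e1 L e2 unfolding e_def by auto
  have near: "\<bar>g s - g t\<bar> \<le> e2" if "\<bar>s - t\<bar> \<le> e" for s
  proof -
    have "\<bar>g s - g t\<bar> \<le> L * \<bar>s - t\<bar>" using L(3) that e by simp
    also have "\<dots> \<le> L * (e2 / L)" using that e L by (intro mult_left_mono) auto
    finally show ?thesis using L by simp
  qed
  have mono: "s \<le> s' \<Longrightarrow> g s \<le> g s'" for s s' using PLloc_strict_mono[OF g] by (simp add: strict_mono_less_eq)
  have n1: "g ` {t-e..t} \<subseteq> {g t - e2..g t}"
  proof
    fix y assume "y \<in> g ` {t-e..t}"
    then obtain s where "s \<in> {t-e..t}" "y = g s" by blast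
    then show "y \<in> {g t - e2..g t}" using near[of s] mono[of s t] by (auto simp: abs_le_iff)
  qed
  have n2: "g ` {t..t+e} \<subseteq> {g t..g t+e2}"
  proof
    fix y assume "y \<in> g ` {t..t+e}"
    then obtain s where "s \<in> {t..t+e}" "y = g s" by blast
    then show "y \<in> {g t..g t+e2}" using near[of s] mono[of t s] by (auto simp: abs_le_iff)
  qed
  have n3: "g ` {t-e..t+e} \<subseteq> {g t-e2..g t+e2}"
  proof
    fix y assume "y \<in> g ` {t-e..t+e}"
    then obtain s where "s \<in> {t-e..t+e}" "y = g s" by blast
    then show "y \<in> {g t-e2..g t+e2}" using near[of s] by (auto simp: abs_le_iff)
  qed
  have "aff_on (f \<circ> g) {t-e..t}"
    using aff_on_comp[OF aff_on_subset[OF e1(2)] e2(2) n1] e by auto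
  moreover have "aff_on (f \<circ> g) {t..t+e}"
    using aff_on_comp[OF aff_on_subset[OF e1(3)] e2(3) n2] e by auto
  moreover have "aff_on (f \<circ> g) {t-e..t+e}" if "t \<notin> dyadic_rationals"
  proof -
    have "g t \<notin> dyadic_rationals" using PLloc_dyadic[OF g] that by simp
    then have a: "aff_on f {g t-e2..g t+e2}" using e2 by blast
    have "aff_on g {t-e1..t+e1}" using e1 that by blast
    then have "aff_on g {t-e..t+e}" by (rule aff_on_subset) (use e in auto)
    from aff_on_comp[OF this a n3] show ?thesis .
  qed
  ultimately show "\<exists>e>0. aff_on (f \<circ> g) {t-e..t} \<and> aff_on (f \<circ> g) {t..t+e} \<and>
     (t \<in> dyadic_rationals \<or> aff_on (f \<circ> g) {t-e..t+e})" using e(1) by blast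
qed

lemma PL_comp [intro]: "f \<in> PL \<Longrightarrow> g \<in> PL \<Longrightarrow> f \<circ> g \<in> PL"
  unfolding PL_def using PLloc_comp comp_surj by blast

lemma aff_on_inv:
  assumes "aff_on f A" "inj f" "B \<subseteq> f ` A" shows "aff_on (finv f) B"
proof -
  obtain m b where m: "b \<in> dyadic_rationals" "\<forall>t\<in>A. f t = 2 powi m * t + b"
    using assms(1) unfolding aff_on_def by blast
  have "finv f y = 2 powi (-m) * y + - (2 powi (-m) * b)" if yB: "y \<in> B" for y
  proof -
    obtain s where s: "s \<in> A" "y = f s" using assms(3) yB by blast
    then have inv: "finv f y = s" using assms(2) by simp
    have y: "y = 2 powi m * s + b" using m s by blast
    have "2 powi (-m) * y + - (2 powi (-m) * b) = s" unfolding y by (simp add: power_int_minus algebra_simps)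
    then show ?thesis using inv by simp
  qed
  moreover have "- (2 powi (-m) * b) \<in> dyadic_rationals" using m by blast
  ultimately show ?thesis unfolding aff_on_def by blast
qed

lemma PL_inv [intro]: assumes f: "f \<in> PL" shows "finv f \<in> PL"
proof -
  have pl: "PLloc f" using f PL_def by blast
  have im: "{f u..f v} \<subseteq> f ` {u..v}" for u v
  proof
    fix y assume "y \<in> {f u..f v}"
    then have "finv f y \<in> {u..v}" using PL_le_iff[OF f, of u "finv f y"] PL_le_iff[OF f, of "finv f y" v] PL_inv_eq[OF f]
      by simp
    then show "y \<in> f ` {u..v}" using imageI[of "finv f y" "{u..v}" f] PL_inv_eq(2)[OF f, of y] by simp
  qed
  have inj: "inj f" by (rule bij_is_inj[OF PL_bij[OF f]])
  have "PLloc (finv f)"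
    unfolding PLloc_def
  proof
    fix y
    define t where "t = finv f y"
    have ft: "f t = y" using PL_inv_eq[OF f] t_def by simp
    obtain e where e: "e > 0" "aff_on f {t-e..t}" "aff_on f {t..t+e}"
      "t \<in> dyadic_rationals \<or> aff_on f {t-e..t+e}" using PLlocE[OF pl] by metis
    \<comment> \<open>The distance from \<open>y\<close> to the nearer image of an end, so that the
      image of the neighbourhood of \<open>t\<close> covers the one of \<open>y\<close>.\<close>
    define d where "d = min (y - f (t-e)) (f (t+e) - y)"
    have "f (t-e) < y" "y < f (t+e)" using PL_less_iff[OF f, of "t-e" t] PL_less_iff[OF f, of t "t+e"] e(1) ft by auto
    then have d: "d > 0" "d \<le> y - f (t-e)" "d \<le> f (t+e) - y" unfolding d_def by auto
    have "{y-d..y} \<subseteq> f ` {t-e..t}" by (rule order_trans[OF _ im[of "t-e" t]]) (use d ft in auto)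
    then have 1: "aff_on (finv f) {y-d..y}" using aff_on_inv[OF e(2) inj] by blast
    have "{y..y+d} \<subseteq> f ` {t..t+e}" by (rule order_trans[OF _ im[of t "t+e"]]) (use d ft in auto)
    then have 2: "aff_on (finv f) {y..y+d}" using aff_on_inv[OF e(3) inj] by blast
    have 3: "aff_on (finv f) {y-d..y+d}" if "y \<notin> dyadic_rationals"
    proof -
      have "t \<notin> dyadic_rationals" using that PL_dyadic[OF f, of t] ft by auto
      then have "aff_on f {t-e..t+e}" using e by blast
      moreover have "{y-d..y+d} \<subseteq> f ` {t-e..t+e}" by (rule order_trans[OF _ im[of "t-e" "t+e"]]) (use d ft in auto)
      ultimately show ?thesis using aff_on_inv[OF _ inj] by blast
    qed
    show "\<exists>e>0. aff_on (finv f) {y-e..y} \<and> aff_on (finv f) {y..y+e} \<and>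
     (y \<in> dyadic_rationals \<or> aff_on (finv f) {y-e..y+e})" using 1 2 3 d(1) by blast
  qed
  moreover have "surj (finv f)" using inj by (simp add: inj_imp_surj_inv)
  ultimately show ?thesis unfolding PL_def by blast
qed

lemma PL_affine [intro]: assumes "b \<in> dyadic_rationals" shows "(\<lambda>t. 2 powi m * t + b) \<in> PL"
proof -
  have "aff_on (\<lambda>t. 2 powi m * t + b) A" for A unfolding aff_on_def using assms by blast
  then have "PLloc (\<lambda>t. 2 powi m * t + b)" unfolding PLloc_def by (intro allI exI[of _ 1]) simp
  moreover have "surj (\<lambda>t::real. 2 powi m * t + b)"
  proof (rule surjI)
    fix y :: real show "2 powi m * (2 powi (-m) * (y - b)) + b = y" by (simp add: power_int_minus field_simps)
  qed
  ultimately show ?thesis unfolding PL_def by blast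
qed

lemma PL_translate [intro]: assumes "b \<in> dyadic_rationals" shows "(\<lambda>t. t + b) \<in> PL"
  using PL_affine[OF assms, of 0] by simp

lemma PL_id [simp, intro]: "id \<in> PL" "(\<lambda>t. t) \<in> PL"
  using PL_translate[of 0] by (simp_all add: id_def)

text \<open>The junction \<open>c\<close> is the only place where a break can be added, and
  \<open>PLloc\<close> permits breaks at dyadic points.\<close>

lemma PL_glue:
  assumes f: "f \<in> PL" and g: "g \<in> PL" and c: "c \<in> dyadic_rationals" "f c = g c"
  shows "(\<lambda>t. if t \<le> c then f t else g t) \<in> PL" (is "?h \<in> PL")
proof -
  have pl: "PLloc f" "PLloc g" using f g PL_def by auto
  have "PLloc ?h" unfolding PLloc_def
  proof
    fix t
    consider "t < c" | "t = c" | "t > c" by linarith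
    then show "\<exists>e>0. aff_on ?h {t-e..t} \<and> aff_on ?h {t..t+e} \<and>
     (t \<in> dyadic_rationals \<or> aff_on ?h {t-e..t+e})"
    proof cases
      case 1
      obtain e where e: "e > 0" "aff_on f {t-e..t}" "aff_on f {t..t+e}"
        "t \<in> dyadic_rationals \<or> aff_on f {t-e..t+e}" using PLlocE[OF pl(1)] by metis
      define d where "d = min e (c - t)"
      have d: "d > 0" "d \<le> e" "d \<le> c - t" using 1 e d_def by auto
      have *: "aff_on ?h A" if "aff_on f B" "A \<subseteq> B" "A \<subseteq> {t-d..t+d}" for A B
        by (rule aff_on_cong[OF aff_on_subset[OF that(1,2)]]) (use that(3) d in auto)
      have "aff_on ?h {t-d..t}" by (rule *[OF e(2)]) (use d in auto)
      moreover have "aff_on ?h {t..t+d}" by (rule *[OF e(3)]) (use d in auto)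
      moreover have "aff_on ?h {t-d..t+d}" if "aff_on f {t-e..t+e}" by (rule *[OF that]) (use d in auto)
      ultimately show ?thesis using e(4) d(1) by blast
    next
      case 3
      obtain e where e: "e > 0" "aff_on g {t-e..t}" "aff_on g {t..t+e}"
        "t \<in> dyadic_rationals \<or> aff_on g {t-e..t+e}" using PLlocE[OF pl(2)] by metis
      \<comment> \<open>Halving keeps \<open>c\<close> itself out of the neighbourhood, since
        \<open>?h\<close> follows \<open>f\<close> there.\<close>
      define d where "d = min e ((t - c) / 2)"
      have d: "d > 0" "d \<le> e" "d < t - c" using 3 e d_def by (auto simp: min_def)
      have *: "aff_on ?h A" if "aff_on g B" "A \<subseteq> B" "A \<subseteq> {t-d..t+d}" for A B
        by (rule aff_on_cong[OF aff_on_subset[OF that(1,2)]]) (use that(3) d in auto)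
      have "aff_on ?h {t-d..t}" by (rule *[OF e(2)]) (use d in auto)
      moreover have "aff_on ?h {t..t+d}" by (rule *[OF e(3)]) (use d in auto)
      moreover have "aff_on ?h {t-d..t+d}" if "aff_on g {t-e..t+e}" by (rule *[OF that]) (use d in auto)
      ultimately show ?thesis using e(4) d(1) by blast
    next
      case 2
      obtain e where e: "e > 0" "aff_on f {t-e..t}" using PLlocE[OF pl(1)] by metis
      obtain e' where e': "e' > 0" "aff_on g {t..t+e'}" using PLlocE[OF pl(2)] by metis
      define d where "d = min e e'"
      have d: "d > 0" "d \<le> e" "d \<le> e'" using e e' d_def by auto
      have "aff_on f {t-d..t}" by (rule aff_on_subset[OF e(2)]) (use d in auto)
      then have 1: "aff_on ?h {t-d..t}" by (rule aff_on_cong) (use 2 in auto)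
      have "aff_on g {t..t+d}" by (rule aff_on_subset[OF e'(2)]) (use d in auto)
      then have "aff_on ?h {t..t+d}" by (rule aff_on_cong) (use 2 c in auto)
      then show ?thesis using 1 d(1) 2 c(1) by blast
    qed
  qed
  moreover have "surj ?h"
  proof (rule surjI)
    fix y show "?h (if y \<le> f c then finv f y else finv g y) = y"
    proof (cases "y \<le> f c")
      case True
      then have "finv f y \<le> c" using PL_inv_eq[OF f] PL_le_iff[OF f, of "finv f y" c] by simp
      then show ?thesis using True PL_inv_eq[OF f] by simp
    next
      case False
      then have "\<not> finv g y \<le> c" using PL_inv_eq[OF g] c PL_le_iff[OF g, of "finv g y" c] by simp
      then show ?thesis using False PL_inv_eq[OF g] by simp
    qed
  qed
  ultimately show ?thesis unfolding PL_def by blast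
qed

section \<open>Any two dyadic intervals are dyadically PL equivalent\<close>

definition dyadic_related :: "real \<Rightarrow> real \<Rightarrow> bool" where
  "dyadic_related l l' \<longleftrightarrow> (\<exists>h\<in>PL. h 0 = 0 \<and> h l = l')"

lemma dyadic_related_sym: assumes "dyadic_related l l'" shows "dyadic_related l' l"
proof -
  obtain h where h: "h \<in> PL" "h 0 = 0" "h l = l'" using assms dyadic_related_def by blast
  then have "finv h 0 = 0" "finv h l' = l" using PL_inv_eq(1)[OF h(1), of 0] PL_inv_eq(1)[OF h(1), of l] by auto
  then show ?thesis unfolding dyadic_related_def using PL_inv[OF h(1)] by blast
qed

lemma dyadic_related_trans:
  assumes "dyadic_related l l'" "dyadic_related l' l''" shows "dyadic_related l l''"
proof -
  obtain h where h: "h \<in> PL" "h 0 = 0" "h l = l'" using assms dyadic_related_def by blast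
  obtain k where k: "k \<in> PL" "k 0 = 0" "k l' = l''" using assms dyadic_related_def by blast
  have "k \<circ> h \<in> PL" "(k \<circ> h) 0 = 0" "(k \<circ> h) l = l''" using h k by auto
  then show ?thesis unfolding dyadic_related_def by blast
qed

lemma dyadic_related_scale: "dyadic_related l (2 powi m * l)"
  unfolding dyadic_related_def by (intro bexI[of _ "\<lambda>t. 2 powi m * t + 0"] PL_affine) auto

text \<open>The second map is translated and placed after the first. The junction \<open>l1\<close>
  becomes a breakpoint and the translations are by \<open>l1\<close> and \<open>l1'\<close>, hence
  the dyadicity conditions.\<close>

lemma dyadic_related_add:
  assumes "dyadic_related l1 l1'" "dyadic_related l2 l2'" "l1 \<in> dyadic_rationals" "l1' \<in> dyadic_rationals"
    "l1 \<ge> 0" "l2 > 0"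
  shows "dyadic_related (l1 + l2) (l1' + l2')"
proof -
  obtain h1 where h1: "h1 \<in> PL" "h1 0 = 0" "h1 l1 = l1'" using assms(1) dyadic_related_def by blast
  obtain h2 where h2: "h2 \<in> PL" "h2 0 = 0" "h2 l2 = l2'" using assms(2) dyadic_related_def by blast
  define k where "k = (\<lambda>t. t + l1') \<circ> h2 \<circ> (\<lambda>t. t + (- l1))"
  have k: "k \<in> PL" unfolding k_def using assms h2 by (intro PL_comp PL_translate dyadic_uminus)
  have "(\<lambda>t. if t \<le> l1 then h1 t else k t) \<in> PL"
    by (rule PL_glue[OF h1(1) k assms(3)]) (simp add: k_def h1 h2)
  moreover have "k (l1 + l2) = l1' + l2'" unfolding k_def using h2 by simp
  ultimately show ?thesis unfolding dyadic_related_def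
    by (intro bexI[of _ "\<lambda>t. if t \<le> l1 then h1 t else k t"]) (use assms h1 in auto)
qed

text \<open>The unit interval is cut in half; stretching one half to the length already reached and
  the other half to length 1 adds 1 to that length.\<close>

lemma dyadic_related_nat: "dyadic_related 1 (real (Suc n))"
proof (induction n)
  case 0
  show ?case using dyadic_related_scale[of 1 0] by simp
next
  case (Suc n)
  have half: "dyadic_related (1/2) 1" using dyadic_related_scale[of "1/2" 1] by simp
  have "dyadic_related (1/2) (real (Suc n))" using dyadic_related_trans[OF half Suc] .
  then have "dyadic_related (1/2 + 1/2) (real (Suc n) + 1)"
    using half by (rule dyadic_related_add) (auto intro: dyadic_add)
  then show ?case by (simp add: add.commute)
qed

lemma dyadic_related_pos: assumes "d \<in> dyadic_rationals" "d > 0" shows "dyadic_related 1 d"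
proof -
  obtain p :: int and n :: nat where d: "d = of_int p / 2 ^ n" using assms dyadic_iff by blast
  then have "p > 0" using assms(2) by (simp add: zero_less_divide_iff)
  then obtain q where q: "p = int (Suc q)" by (metis gr0_implies_Suc zero_less_imp_eq_int)
  have "2 powi (- int n) * real (Suc q) = d" using d q by (simp add: power_int_minus field_simps)
  then have "dyadic_related (real (Suc q)) d" using dyadic_related_scale[of "real (Suc q)" "- int n"] by simp
  then show ?thesis using dyadic_related_nat dyadic_related_trans by blast
qed

lemma PL_connect:
  assumes "u \<in> dyadic_rationals" "v \<in> dyadic_rationals" "u' \<in> dyadic_rationals" "v' \<in> dyadic_rationals"
    "u < v" "u' < v'"
  obtains h where "h \<in> PL" "h u = u'" "h v = v'"
proof -
  have "dyadic_related (v - u) (v' - u')"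
    using dyadic_related_trans[OF dyadic_related_sym[OF dyadic_related_pos[of "v - u"]]
      dyadic_related_pos[of "v' - u'"]] assms by (simp add: dyadic_diff)
  then obtain h where h: "h \<in> PL" "h 0 = 0" "h (v - u) = v' - u'" unfolding dyadic_related_def by blast
  define k where "k = (\<lambda>t. t + u') \<circ> h \<circ> (\<lambda>t. t + (- u))"
  have "k \<in> PL" unfolding k_def using assms h by (intro PL_comp PL_translate dyadic_uminus)
  moreover have "k u = u'" "k v = v'" unfolding k_def using h by auto
  ultimately show thesis using that by blast
qed

section \<open>Supports, conjugation and transitivity\<close>

definition Fsup :: "real \<Rightarrow> real \<Rightarrow> (real \<Rightarrow> real) set" where
  "Fsup a b = {f \<in> PL. \<forall>t. t \<le> a \<or> b \<le> t \<longrightarrow> f t = t}"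

text \<open>The ends \<open>a\<close>, \<open>b\<close> may be arbitrary reals. The dyadic
  \<open>u\<close>, \<open>v\<close> strictly between them leave room at both ends for the
  conjugating maps on which perfectness rests.\<close>

definition Fc :: "real \<Rightarrow> real \<Rightarrow> (real \<Rightarrow> real) set" where
  "Fc a b = {f. \<exists>u v. a < u \<and> u < v \<and> v < b \<and> u \<in> dyadic_rationals \<and> v \<in> dyadic_rationals \<and> f \<in> Fsup u v}"

lemma FcE:
  assumes "f \<in> Fc a b"
  obtains u v where "a < u" "u < v" "v < b" "u \<in> dyadic_rationals" "v \<in> dyadic_rationals" "f \<in> Fsup u v"
  using assms unfolding Fc_def by blast

lemma Fsup_PL: "f \<in> Fsup a b \<Longrightarrow> f \<in> PL" unfolding Fsup_def by blast

lemma Fsup_outside: "f \<in> Fsup a b \<Longrightarrow> t \<le> a \<or> b \<le> t \<Longrightarrow> f t = t" unfolding Fsup_def by blast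

lemma Fsup_mono: "f \<in> Fsup a b \<Longrightarrow> a' \<le> a \<Longrightarrow> b \<le> b' \<Longrightarrow> f \<in> Fsup a' b'" unfolding Fsup_def by force

lemma Fsup_subset_Fc: assumes "f \<in> Fsup u v" "a < u" "v < b" "a < b" shows "f \<in> Fc a b"
proof (cases "u < v")
  case True
  obtain u' where u': "u' \<in> dyadic_rationals" "a < u'" "u' < u" using dyadic_dense assms by metis
  obtain v' where v': "v' \<in> dyadic_rationals" "v < v'" "v' < b" using dyadic_dense assms by metis
  have "f \<in> Fsup u' v'" using assms u' v' by (intro Fsup_mono[OF assms(1)]) auto
  then show ?thesis unfolding Fc_def using u' v' True by (intro CollectI exI[of _ u'] exI[of _ v']) auto
next
  case False
  \<comment> \<open>With \<open>v\<close> at most \<open>u\<close>, every point lies in the region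
    where \<open>f\<close> is the identity.\<close>
  then have f: "f = id" using assms unfolding Fsup_def by fastforce
  obtain u' where u': "u' \<in> dyadic_rationals" "a < u'" "u' < b" using dyadic_dense assms by metis
  obtain v' where v': "v' \<in> dyadic_rationals" "u' < v'" "v' < b" using dyadic_dense u' by metis
  show ?thesis unfolding Fc_def f using u' v'
    by (intro CollectI exI[of _ u'] exI[of _ v']) (auto simp: Fsup_def)
qed

lemma Fc_PL: "f \<in> Fc a b \<Longrightarrow> f \<in> PL" using FcE Fsup_PL by metis

lemma Fc_outside: assumes "f \<in> Fc a b" "t \<le> a \<or> b \<le> t" shows "f t = t"
proof -
  obtain u v where "a < u" "v < b" "f \<in> Fsup u v" using FcE[OF assms(1)] .
  then show ?thesis using assms(2) Fsup_outside[of f u v t] by auto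
qed

lemma Fc_Fsup: "f \<in> Fc a b \<Longrightarrow> f \<in> Fsup a b" using Fc_PL Fc_outside unfolding Fsup_def by blast

lemma Fc_mono: assumes "f \<in> Fc a b" "a' \<le> a" "b \<le> b'" shows "f \<in> Fc a' b'"
proof -
  obtain u v where 1: "a < u" "u < v" "v < b" "u \<in> dyadic_rationals" "v \<in> dyadic_rationals" "f \<in> Fsup u v"
    using FcE[OF assms(1)] .
  show ?thesis by (rule Fsup_subset_Fc[OF 1(6)]) (use 1 assms in auto)
qed

lemma Fsup_comp: "f \<in> Fsup a b \<Longrightarrow> g \<in> Fsup a b \<Longrightarrow> f \<circ> g \<in> Fsup a b"
  unfolding Fsup_def by auto

lemma Fsup_inv: assumes "f \<in> Fsup a b" shows "finv f \<in> Fsup a b"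
proof -
  have f: "f \<in> PL" using Fsup_PL[OF assms] .
  have "finv f t = t" if "t \<le> a \<or> b \<le> t" for t
    using PL_inv_eq(1)[OF f, of t] Fsup_outside[OF assms that] by simp
  then show ?thesis unfolding Fsup_def using PL_inv[OF f] by blast
qed

lemma Fsup_id [simp]: "id \<in> Fsup a b" unfolding Fsup_def by auto

lemma Fc_id: "a < b \<Longrightarrow> id \<in> Fc a b"
  using Fsup_subset_Fc[of id "(a+b)/2" "(a+b)/2" a b] by simp

lemma Fc_comp: assumes "f \<in> Fc a b" "g \<in> Fc a b" shows "f \<circ> g \<in> Fc a b"
proof -
  obtain u v where 1: "a < u" "u < v" "v < b" "u \<in> dyadic_rationals" "v \<in> dyadic_rationals" "f \<in> Fsup u v"
    using FcE[OF assms(1)] .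
  obtain u' v' where 2: "a < u'" "u' < v'" "v' < b" "u' \<in> dyadic_rationals" "v' \<in> dyadic_rationals" "g \<in> Fsup u' v'"
    using FcE[OF assms(2)] .
  have "f \<circ> g \<in> Fsup (min u u') (max v v')"
    using Fsup_mono[OF 1(6)] Fsup_mono[OF 2(6)] by (intro Fsup_comp) auto
  then show ?thesis by (rule Fsup_subset_Fc) (use 1 2 in auto)
qed

lemma Fc_inv: assumes "f \<in> Fc a b" shows "finv f \<in> Fc a b"
proof -
  obtain u v where 1: "a < u" "u < v" "v < b" "f \<in> Fsup u v"
    using FcE[OF assms] .
  show ?thesis by (rule Fsup_subset_Fc[OF Fsup_inv[OF 1(4)]]) (use 1 in auto)
qed

lemma Fsup_inside: assumes "f \<in> Fsup a b" "a \<le> b" shows "a < f t \<longleftrightarrow> a < t" "f t < b \<longleftrightarrow> t < b" "a \<le> f t \<longleftrightarrow> a \<le> t" "f t \<le> b \<longleftrightarrow> t \<le> b"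
  using PL_less_iff[OF Fsup_PL[OF assms(1)], of a t] PL_less_iff[OF Fsup_PL[OF assms(1)], of t b]
   PL_le_iff[OF Fsup_PL[OF assms(1)], of a t] PL_le_iff[OF Fsup_PL[OF assms(1)], of t b]
   Fsup_outside[OF assms(1), of a] Fsup_outside[OF assms(1), of b]
  by simp_all

lemma Fc_inside: assumes "f \<in> Fc a b" shows "a < f t \<longleftrightarrow> a < t" "f t < b \<longleftrightarrow> t < b"
proof -
  have "a \<le> b" using FcE[OF assms] by (metis less_imp_le less_trans)
  then show "a < f t \<longleftrightarrow> a < t" "f t < b \<longleftrightarrow> t < b" using Fsup_inside[OF Fc_Fsup[OF assms]] by blast+
qed

lemma conj_Fsup: assumes "f \<in> Fsup a b" "h \<in> PL" shows "h \<circ> f \<circ> finv h \<in> Fsup (h a) (h b)"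
proof -
  have "h (f (finv h t)) = t" if "t \<le> h a \<or> h b \<le> t" for t
  proof -
    have "finv h t \<le> a \<or> b \<le> finv h t"
      using that PL_le_iff[OF assms(2), of "finv h t" a] PL_le_iff[OF assms(2), of b "finv h t"] PL_inv_eq[OF assms(2)]
      by simp
    then show ?thesis using Fsup_outside[OF assms(1)] PL_inv_eq[OF assms(2)] by simp
  qed
  moreover have "h \<circ> f \<circ> finv h \<in> PL"
    by (intro PL_comp PL_inv assms(2) Fsup_PL[OF assms(1)])
  ultimately show ?thesis unfolding Fsup_def by (simp add: o_def)
qed

lemma conj_Fc: assumes "f \<in> Fc a b" "h \<in> PL" shows "h \<circ> f \<circ> finv h \<in> Fc (h a) (h b)"
proof -
  obtain u v where 1: "a < u" "u < v" "v < b" "u \<in> dyadic_rationals" "v \<in> dyadic_rationals" "f \<in> Fsup u v"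
    using FcE[OF assms(1)] .
  have "h a < h u" "h v < h b" "h a < h b" using PL_less_iff[OF assms(2)] 1 by auto
  then show ?thesis by (rule Fsup_subset_Fc[OF conj_Fsup[OF 1(6) assms(2)]])
qed

text \<open>Dyadic intervals are interchangeable, so the gaps on both sides of \<open>[u,v]\<close>
  can be filled by connecting maps that return to the identity before \<open>a\<close> and
  \<open>b\<close> are reached.\<close>

lemma Fc_extend:
  assumes k: "k \<in> PL" and uv: "u \<in> dyadic_rationals" "v \<in> dyadic_rationals" "u \<le> v"
    and a: "a < u" "a < k u" and b: "v < b" "k v < b"
  obtains h where "h \<in> Fc a b" "\<And>t. u \<le> t \<Longrightarrow> t \<le> v \<Longrightarrow> h t = k t"
proof -
  \<comment> \<open>\<open>a1\<close> lies left of both \<open>u\<close> and \<open>k u\<close>, so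
    that a connecting map can take \<open>[a1,u]\<close> to \<open>[a1,k u]\<close>;
    \<open>b1\<close> plays the same role on the right.\<close>
  obtain a1 where a1: "a1 \<in> dyadic_rationals" "a < a1" "a1 < min u (k u)"
    using dyadic_dense[of a "min u (k u)"] a by auto
  obtain b1 where b1: "b1 \<in> dyadic_rationals" "max v (k v) < b1" "b1 < b"
    using dyadic_dense[of "max v (k v)" b] b by auto
  have ku: "k u \<in> dyadic_rationals" "k v \<in> dyadic_rationals" using PL_dyadic[OF k] uv by auto
  obtain h1 where h1: "h1 \<in> PL" "h1 a1 = a1" "h1 u = k u"
    using PL_connect[of a1 u a1 "k u"] a1 uv ku by auto
  obtain h2 where h2: "h2 \<in> PL" "h2 v = k v" "h2 b1 = b1"
    using PL_connect[of v b1 "k v" b1] b1 uv ku by auto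
  define g1 where "g1 = (\<lambda>t. if t \<le> b1 then h2 t else t)"
  have g1: "g1 \<in> PL" unfolding g1_def by (rule PL_glue) (use h2 b1 in auto)
  define g2 where "g2 = (\<lambda>t. if t \<le> v then k t else g1 t)"
  have g2: "g2 \<in> PL" unfolding g2_def by (rule PL_glue) (use h2 b1 g1 k uv in \<open>auto simp: g1_def\<close>)
  define g3 where "g3 = (\<lambda>t. if t \<le> u then h1 t else g2 t)"
  have g3: "g3 \<in> PL" unfolding g3_def by (rule PL_glue) (use h1 g2 uv in \<open>auto simp: g2_def\<close>)
  define g4 where "g4 = (\<lambda>t. if t \<le> a1 then t else g3 t)"
  have g4: "g4 \<in> PL" unfolding g4_def by (rule PL_glue) (use h1 g3 a1 in \<open>auto simp: g3_def\<close>)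
  \<comment> \<open>At \<open>b1\<close> the gluing still evaluates \<open>h2\<close>, which fixes
    that point; hence the separate case.\<close>
  have "g4 t = t" if "t \<le> a1 \<or> b1 \<le> t" for t
  proof (cases "t = b1")
    case True then show ?thesis using a1 b1 uv h2 unfolding g4_def g3_def g2_def g1_def by auto
  next
    case False then show ?thesis using that a1 b1 uv h2 unfolding g4_def g3_def g2_def g1_def by auto
  qed
  then have "g4 \<in> Fsup a1 b1" using g4 unfolding Fsup_def by blast
  then have "g4 \<in> Fc a b" by (rule Fsup_subset_Fc) (use a1 b1 uv in auto)
  moreover have "g4 t = k t" if "u \<le> t" "t \<le> v" for t
    using that a1 h1 unfolding g4_def g3_def g2_def by auto
  ultimately show thesis using that by blast
qed

lemma Fc_move:
  assumes "u \<in> dyadic_rationals" "v \<in> dyadic_rationals" "u' \<in> dyadic_rationals" "v' \<in> dyadic_rationals"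
    "u < v" "u' < v'" "a < u" "a < u'" "v < b" "v' < b"
  obtains h where "h \<in> Fc a b" "h u = u'" "h v = v'"
proof -
  obtain k where k: "k \<in> PL" "k u = u'" "k v = v'" using PL_connect assms by metis
  then obtain h where "h \<in> Fc a b" "\<And>t. u \<le> t \<Longrightarrow> t \<le> v \<Longrightarrow> h t = k t"
    using Fc_extend[of k u v a b] assms by (metis less_eq_real_def)
  then show thesis using that k assms by force
qed



section \<open>Thompson's group\<close>

text \<open>Subgroups are bare sets of maps because they arise as preimages: typically the
  \<open>f\<close> for which \<open>emb D f\<close> lies in a given group of lifts.\<close>

definition subgrp :: "(real \<Rightarrow> real) set \<Rightarrow> bool" where
  "subgrp K \<longleftrightarrow> K \<subseteq> PL \<and> id \<in> K \<and> (\<forall>f\<in>K. \<forall>g\<in>K. f \<circ> g \<in> K) \<and> (\<forall>f\<in>K. finv f \<in> K)"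

lemma subgrpD:
  assumes "subgrp K"
  shows "f \<in> K \<Longrightarrow> f \<in> PL" "id \<in> K" "f \<in> K \<Longrightarrow> g \<in> K \<Longrightarrow> f \<circ> g \<in> K" "f \<in> K \<Longrightarrow> finv f \<in> K"
  using assms unfolding subgrp_def by blast+

definition xi :: "real \<Rightarrow> real" where
  "xi r = (if r \<le> 0 \<or> 1 \<le> r then r else if r \<le> 1/4 then 2 * r else if r \<le> 1/2 then r + 1/4 else (r + 1) / 2)"

text \<open>\<open>xi\<close> is the standard generator of Thompson's group on the unit interval. On the subdivisions of an
  interval that are coded by binary trees, its copy \<open>rot u l\<close> acts as the tree rotation
  \<open>Nd (Nd a b) c \<mapsto> Nd a (Nd b c)\<close>.\<close>

definition rot :: "real \<Rightarrow> real \<Rightarrow> real \<Rightarrow> real" where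
  "rot u l t = u + l * xi ((t - u) / l)"

lemma dyadic_inverse_power [simp, intro]: "1 / 2 ^ n \<in> dyadic_rationals"
  unfolding dyadic_iff by (rule exI[of _ 1], rule exI[of _ n]) simp

lemma xi_PL: "xi \<in> PL"
proof -
  have h: "(1/2::real) \<in> dyadic_rationals" "(1/4::real) \<in> dyadic_rationals"
    using dyadic_inverse_power[of 1] dyadic_inverse_power[of 2] by simp_all
  have "(\<lambda>r. 2 powi (-1) * r + 1/2 :: real) \<in> PL" using h(1) by (rule PL_affine)
  moreover have "(\<lambda>r. 2 powi (-1) * r + 1/2 :: real) = (\<lambda>r. (r + 1) / 2)"
    by (simp add: fun_eq_iff power_int_minus field_simps)
  ultimately have a1: "(\<lambda>r::real. (r + 1) / 2) \<in> PL" by simp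
  have a2: "(\<lambda>r::real. r + 1/4) \<in> PL" using h(2) by (rule PL_translate)
  have a3: "(\<lambda>r::real. 2 * r) \<in> PL" using PL_affine[of 0 1] by simp
  define g1 :: "real \<Rightarrow> real" where "g1 = (\<lambda>r. if r \<le> 1 then (r + 1) / 2 else r)"
  have g1: "g1 \<in> PL" unfolding g1_def by (rule PL_glue[OF a1]) auto
  define g2 :: "real \<Rightarrow> real" where "g2 = (\<lambda>r. if r \<le> 1/2 then r + 1/4 else g1 r)"
  have g2: "g2 \<in> PL" unfolding g2_def by (rule PL_glue[OF a2 g1 h(1)]) (simp add: g1_def)
  define g3 :: "real \<Rightarrow> real" where "g3 = (\<lambda>r. if r \<le> 1/4 then 2 * r else g2 r)"
  have g3: "g3 \<in> PL" unfolding g3_def by (rule PL_glue[OF a3 g2 h(2)]) (simp add: g2_def)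
  define g4 :: "real \<Rightarrow> real" where "g4 = (\<lambda>r. if r \<le> 0 then r else g3 r)"
  have g4: "g4 \<in> PL" unfolding g4_def by (rule PL_glue[OF _ g3]) (auto simp: g3_def)
  have "xi = g4" unfolding g4_def g3_def g2_def g1_def xi_def by (auto simp: fun_eq_iff)
  then show ?thesis using g4 by simp
qed

lemma xi_range: "0 \<le> r \<Longrightarrow> r \<le> 1 \<Longrightarrow> 0 \<le> xi r \<and> xi r \<le> 1"
  unfolding xi_def by auto

text \<open>This is the associativity pentagon: both sides rebracket ((ab)c)d as a(b(cd)), on the
  left by two rotations at the root, on the right by rotations at the left child, the root and the
  right child. The cases are intervals on which all maps involved are affine.\<close>

lemma xi_pentagon: "xi (xi r) = 1/2 + xi (2 * xi (xi (2 * r) / 2) - 1) / 2"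
proof -
  consider "r \<le> 0" | "0 < r" "r \<le> 1/8" | "1/8 < r" "r \<le> 1/4" | "1/4 < r" "r \<le> 1/2" | "1/2 < r" "r < 1" | "1 \<le> r"
    by linarith
  then show ?thesis
  proof cases
    case 1 then show ?thesis by (simp add: xi_def field_simps)
  next
    case 2
    then have "xi (2 * r) = 4 * r" "xi r = 2 * r" "xi (2 * r) = 4 * r" "xi (4 * r / 2) = 4 * r" by (auto simp: xi_def)
    then show ?thesis using 2 by (simp add: xi_def field_simps)
  next
    case 3
    then have a: "xi (2 * r) = 2 * r + 1/4" "xi r = 2 * r" by (auto simp: xi_def)
    have b: "xi ((2 * r + 1/4) / 2) = r + 3/8" using 3 by (auto simp: xi_def field_simps)
    have c: "xi (2 * (r + 3/8) - 1) = 4 * r - 1/2" using 3 by (auto simp: xi_def)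
    show ?thesis unfolding a b c by (simp add: field_simps)
  next
    case 4
    then have a: "xi (2 * r) = (2 * r + 1) / 2" "xi r = r + 1/4" by (auto simp: xi_def)
    have b: "xi ((2 * r + 1) / 2 / 2) = r / 2 + 1/2" using 4 by (auto simp: xi_def field_simps)
    have c: "xi (2 * (r / 2 + 1/2) - 1) = r + 1/4" using 4 by (auto simp: xi_def)
    have d: "xi (r + 1/4) = r / 2 + 5/8" using 4 by (auto simp: xi_def)
    show ?thesis unfolding a b c d by (simp add: field_simps)
  next
    case 5
    then have a: "xi (2 * r) = 2 * r" "xi r = (r + 1) / 2" by (auto simp: xi_def)
    have b: "xi (2 * r / 2) = (r + 1) / 2" using 5 by (auto simp: xi_def)
    have c: "xi (2 * ((r + 1) / 2) - 1) = (r + 1) / 2" using 5 by (auto simp: xi_def)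
    have d: "xi ((r + 1) / 2) = (r + 3) / 4" using 5 by (auto simp: xi_def field_simps)
    show ?thesis unfolding a b c d by (simp add: field_simps)
  next
    case 6 then show ?thesis by (simp add: xi_def field_simps)
  qed
qed

lemma rot_scaled: "l \<noteq> 0 \<Longrightarrow> rot u l (u + l * r) = u + l * xi r"
  unfolding rot_def by simp

lemma rot_pentagon: assumes "l > 0" shows "rot u l \<circ> rot u l = rot (u + l/2) (l/2) \<circ> rot u l \<circ> rot u (l/2)"
proof
  fix t
  define r where "r = (t - u) / l"
  have t: "t = u + l * r" using assms by (simp add: r_def)
  have 1: "rot u (l/2) (u + l * s) = u + l * (xi (2 * s) / 2)" for s
  proof -
    have "(u + l * s - u) / (l/2) = 2 * s" using assms by (simp add: field_simps)
    then show ?thesis unfolding rot_def by simp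
  qed
  have 2: "rot (u + l/2) (l/2) (u + l * s) = u + l * (1/2 + xi (2 * s - 1) / 2)" for s
  proof -
    have "(u + l * s - (u + l/2)) / (l/2) = 2 * s - 1" using assms by (simp add: field_simps)
    then show ?thesis unfolding rot_def by (simp only:) (simp add: algebra_simps)
  qed
  have l: "l \<noteq> 0" using assms by simp
  show "(rot u l \<circ> rot u l) t = (rot (u + l/2) (l/2) \<circ> rot u l \<circ> rot u (l/2)) t"
    unfolding t comp_apply 1 rot_scaled[OF l] 2 xi_pentagon ..
qed

lemma rot_outside: "l > 0 \<Longrightarrow> t \<le> u \<or> u + l \<le> t \<Longrightarrow> rot u l t = t"
  unfolding rot_def xi_def by (auto simp: field_simps)

lemma rot_Fsup: assumes "u \<in> dyadic_rationals" shows "rot u (2 powi e) \<in> Fsup u (u + 2 powi e)"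
proof -
  define A :: "real \<Rightarrow> real" where "A = (\<lambda>t. 2 powi e * t + u)"
  have A: "A \<in> PL" unfolding A_def using assms by (rule PL_affine)
  have inv: "finv A t = (t - u) / 2 powi e" for t
  proof -
    have "A ((t - u) / 2 powi e) = t" unfolding A_def by simp
    then show ?thesis using PL_inv_eq(1)[OF A, of "(t - u) / 2 powi e"] by simp
  qed
  have "rot u (2 powi e) = A \<circ> xi \<circ> finv A" unfolding fun_eq_iff comp_apply inv by (simp add: rot_def A_def)
  moreover have "A \<circ> xi \<circ> finv A \<in> PL" by (intro PL_comp PL_inv A xi_PL)
  ultimately have "rot u (2 powi e) \<in> PL" by (simp only:)
  then show ?thesis unfolding Fsup_def by (auto simp: rot_outside)
qed

text \<open>Intervals are recorded by left end and length, as in the leaves of a tree. Nothing is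
  said about \<open>h\<close> outside \<open>[u,u+l]\<close>.\<close>

definition affm :: "(real \<Rightarrow> real) \<Rightarrow> real \<Rightarrow> real \<Rightarrow> real \<Rightarrow> real \<Rightarrow> bool" where
  "affm h u l u' l' \<longleftrightarrow> (\<forall>t. u \<le> t \<and> t \<le> u + l \<longrightarrow> h t = u' + (t - u) * (l' / l))"

lemma affmD: "affm h u l u' l' \<Longrightarrow> u \<le> t \<Longrightarrow> t \<le> u + l \<Longrightarrow> h t = u' + (t - u) * (l' / l)"
  unfolding affm_def by blast

lemma affm_ends: "affm h u l u' l' \<Longrightarrow> l > 0 \<Longrightarrow> h u = u'" "affm h u l u' l' \<Longrightarrow> l > 0 \<Longrightarrow> h (u + l) = u' + l'"
  unfolding affm_def by auto

lemma affm_comp: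
  assumes "affm g u l u' l'" "affm h u' l' u'' l''" "l > 0" "l' > 0"
  shows "affm (h \<circ> g) u l u'' l''"
  unfolding affm_def
proof (intro allI impI)
  fix t assume t: "u \<le> t \<and> t \<le> u + l"
  have g: "g t = u' + (t - u) * (l' / l)" using affmD[OF assms(1)] t by simp
  have "(t - u) * (l' / l) \<le> l * (l' / l)" using t assms by (intro mult_right_mono) auto
  then have 1: "g t \<le> u' + l'" unfolding g using assms by simp
  have 2: "u' \<le> g t" unfolding g using t assms by simp
  have "h (g t) = u'' + (g t - u') * (l'' / l')" using affmD[OF assms(2) 2 1] .
  also have "(g t - u') * (l'' / l') = (t - u) * (l'' / l)" unfolding g using assms by simp
  finally show "(h \<circ> g) t = u'' + (t - u) * (l'' / l)" by simp
qed

lemma affm_inv: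
  assumes "affm h u l u' l'" "h \<in> PL" "l > 0" "l' > 0"
  shows "affm (finv h) u' l' u l"
  unfolding affm_def
proof (intro allI impI)
  fix t assume t: "u' \<le> t \<and> t \<le> u' + l'"
  define s where "s = u + (t - u') * (l / l')"
  have "(t - u') * (l / l') \<le> l' * (l / l')" using t assms by (intro mult_right_mono) auto
  then have 1: "s \<le> u + l" unfolding s_def using assms by simp
  have 2: "u \<le> s" unfolding s_def using t assms by simp
  have "h s = u' + (s - u) * (l' / l)" using affmD[OF assms(1) 2 1] .
  also have "\<dots> = t" unfolding s_def using assms by simp
  finally have "finv h t = s" using PL_inv_eq(1)[OF assms(2), of s] by simp
  then show "finv h t = u + (t - u') * (l / l')" unfolding s_def .
qed

text \<open>On the interval, the affine change of coordinates intertwines the two rotations. Outside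
  of it both are the identity, and \<open>h\<close> is increasing, so it takes the outside to the
  outside.\<close>

lemma conj_rot:
  assumes h: "h \<in> PL" "affm h u l u' l'" and l: "l > 0" "l' > 0"
  shows "h \<circ> rot u l \<circ> finv h = rot u' l'"
proof -
  have key: "h (rot u l s) = rot u' l' (h s)" for s
  proof (cases "u \<le> s \<and> s \<le> u + l")
    case True
    define r where "r = (s - u) / l"
    have s: "s = u + l * r" using l by (simp add: r_def)
    have r: "0 \<le> r" "r \<le> 1" using True l by (auto simp: r_def field_simps)
    have xr: "0 \<le> xi r" "xi r \<le> 1" using xi_range[OF r] by auto
    have *: "h (u + l * q) = u' + l' * q" if q: "0 \<le> q" "q \<le> 1" for q
    proof -
      have "l * q \<le> l" using q l by simp
      then show ?thesis using affmD[OF h(2), of "u + l * q"] q l by simp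
    qed
    have "h (rot u l s) = u' + l' * xi r" unfolding s using *[OF xr] l by (simp add: rot_scaled)
    moreover have "rot u' l' (h s) = u' + l' * xi r" unfolding s *[OF r] using l by (simp add: rot_scaled)
    ultimately show ?thesis by simp
  next
    case False
    then consider "s < u" | "u + l < s" by linarith
    then show ?thesis
    proof cases
      case 1
      then have "h s < u'" using PL_less_iff[OF h(1), of s u] affm_ends(1)[OF h(2) l(1)] by simp
      then show ?thesis using 1 l by (simp add: rot_outside)
    next
      case 2
      then have "u' + l' < h s" using PL_less_iff[OF h(1), of "u + l" s] affm_ends(2)[OF h(2) l(1)] by simp
      then show ?thesis using 2 l by (simp add: rot_outside)
    qed
  qed
  show ?thesis
  proof
    fix t show "(h \<circ> rot u l \<circ> finv h) t = rot u' l' t"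
      using key[of "finv h t"] PL_inv_eq(2)[OF h(1), of t] by simp
  qed
qed

definition cmt :: "(real \<Rightarrow> real) \<Rightarrow> (real \<Rightarrow> real) \<Rightarrow> real \<Rightarrow> real" where
  "cmt p q = p \<circ> q \<circ> finv p \<circ> finv q"

lemma finv_comp: "f \<in> PL \<Longrightarrow> g \<in> PL \<Longrightarrow> finv (f \<circ> g) = finv g \<circ> finv f"
  by (rule o_inv_distrib[OF PL_bij PL_bij])

lemma finv_finv: "f \<in> PL \<Longrightarrow> finv (finv f) = f"
  by (rule inv_inv_eq[OF PL_bij])

text \<open>In the abelianization the relation reads x^2 = x^3. Explicitly, solving for the last
  factor gives x = g^-1 x^-1 h x^-1 h^-1 x x g; inserting x x^-1 after h turns this into the
  commutator of x^-1 h x with x^-1, conjugated by g^-1.\<close>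

lemma pentagon_commutator:
  assumes x: "x \<in> PL" and h: "h \<in> PL" and g: "g \<in> PL"
    and pent: "x \<circ> x = (h \<circ> x \<circ> finv h) \<circ> x \<circ> (g \<circ> x \<circ> finv g)"
  shows "x = cmt (finv g \<circ> (finv x \<circ> h \<circ> x) \<circ> g) (finv g \<circ> finv x \<circ> g)"
proof
  fix t
  note c = PL_inv_eq[OF x] PL_inv_eq[OF h] PL_inv_eq[OF g]
  have fp: "finv (finv g \<circ> (finv x \<circ> h \<circ> x) \<circ> g) = finv g \<circ> (finv x \<circ> finv h \<circ> x) \<circ> g"
    by (simp add: finv_comp finv_finv x h g PL_comp PL_inv o_assoc)
  have fq: "finv (finv g \<circ> finv x \<circ> g) = finv g \<circ> x \<circ> g"
    by (simp add: finv_comp finv_finv x h g PL_comp PL_inv o_assoc)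
  have "x (x (g t)) = h (x (finv h (x (g (x t)))))"
    using fun_cong[OF pent, of "g t"] by (simp add: c)
  then show "x t = cmt (finv g \<circ> (finv x \<circ> h \<circ> x) \<circ> g) (finv g \<circ> finv x \<circ> g) t"
    unfolding cmt_def fp fq by (simp add: c)
qed

lemma Fc_affm:
  assumes "u \<in> dyadic_rationals" "u' \<in> dyadic_rationals" "a < u" "a < u'"
    "u + 2 powi e < b" "u' + 2 powi e' < b"
  obtains h where "h \<in> Fc a b" "affm h u (2 powi e) u' (2 powi e')"
proof -
  define k :: "real \<Rightarrow> real" where "k = (\<lambda>t. 2 powi (e' - e) * t + (u' - 2 powi (e' - e) * u))"
  have k: "k \<in> PL" unfolding k_def by (rule PL_affine) (intro dyadic_diff dyadic_mult dyadic_powi assms)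
  have ku: "k t = u' + (t - u) * (2 powi e' / 2 powi e)" for t
    by (simp add: k_def power_int_diff algebra_simps diff_divide_distrib)
  have "k u = u'" "k (u + 2 powi e) = u' + 2 powi e'" unfolding ku by simp_all
  then obtain h where h: "h \<in> Fc a b" "\<And>t. u \<le> t \<Longrightarrow> t \<le> u + 2 powi e \<Longrightarrow> h t = k t"
    using Fc_extend[OF k assms(1), of "u + 2 powi e" a b] assms by (auto simp: dyadic_add)
  then have "affm h u (2 powi e) u' (2 powi e')" unfolding affm_def ku[symmetric] by blast
  then show thesis using that h(1) by blast
qed

text \<open>The pentagon relation says that a rotation is trivial in the abelianization, because all
  three intervals occurring in it are conjugate.\<close>

lemma rot_commutator:
  assumes u: "u \<in> dyadic_rationals" and ab: "a < u" "u + 2 powi e < b"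
  obtains p q where "p \<in> Fc a b" "q \<in> Fc a b" "rot u (2 powi e) = cmt p q"
proof -
  define l :: real where "l = 2 powi e"
  define x where "x = rot u l"
  have half: "l / 2 = 2 powi (e - 1)" unfolding l_def by (simp add: power_int_diff)
  have l: "l > 0" unfolding l_def by simp
  have "a < b" using ab l unfolding l_def by linarith
  then have x: "x \<in> Fc a b" unfolding x_def l_def by (rule Fsup_subset_Fc[OF rot_Fsup[OF u] ab])
  \<comment> \<open>The maps \<open>h\<close> and \<open>g\<close> obtained next shrink the interval
    onto its right and its left half, so both outer factors of the pentagon are conjugates of
    \<open>x\<close>.\<close>
  have "u + l / 2 \<in> dyadic_rationals" unfolding half by (intro dyadic_add u dyadic_powi)
  then obtain h where h: "h \<in> Fc a b" "affm h u l (u + l/2) (l/2)"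
    using Fc_affm[of u "u + l/2" a e b "e - 1"] u ab l unfolding half[symmetric] l_def[symmetric] by auto
  obtain g where g: "g \<in> Fc a b" "affm g u l u (l/2)"
    using Fc_affm[of u u a e b "e - 1"] u ab l unfolding half[symmetric] l_def[symmetric] by auto
  note xP = Fc_PL[OF x] and hP = Fc_PL[OF h(1)] and gP = Fc_PL[OF g(1)]
  have ch: "h \<circ> x \<circ> finv h = rot (u + l/2) (l/2)" unfolding x_def by (rule conj_rot[OF hP h(2) l]) (use l in simp)
  have cg: "g \<circ> x \<circ> finv g = rot u (l/2)" unfolding x_def by (rule conj_rot[OF gP g(2) l]) (use l in simp)
  have "x \<circ> x = (h \<circ> x \<circ> finv h) \<circ> x \<circ> (g \<circ> x \<circ> finv g)"
    unfolding ch cg using rot_pentagon[OF l] unfolding x_def .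
  from pentagon_commutator[OF xP hP gP this]
  have "x = cmt (finv g \<circ> (finv x \<circ> h \<circ> x) \<circ> g) (finv g \<circ> finv x \<circ> g)" .
  moreover have "finv g \<circ> (finv x \<circ> h \<circ> x) \<circ> g \<in> Fc a b" "finv g \<circ> finv x \<circ> g \<in> Fc a b"
    by (intro Fc_comp Fc_inv x h g)+
  ultimately show thesis using that unfolding x_def l_def by blast
qed

section \<open>Standard dyadic intervals and binary trees\<close>

lemma powi2_less_iff: "(2::real) powi d < 2 powi e \<longleftrightarrow> d < e"
proof
  show "d < e \<Longrightarrow> (2::real) powi d < 2 powi e" by (rule power_int_strict_increasing) simp_all
  show "(2::real) powi d < 2 powi e \<Longrightarrow> d < e"
    using power_int_increasing[of e d "2::real"] by (meson linorder_not_less one_le_numeral)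
qed

lemma powi2_le_iff: "(2::real) powi d \<le> 2 powi e \<longleftrightarrow> d \<le> e"
  using powi2_less_iff[of e d] by linarith

text \<open>The intervals from \<open>j * 2^e\<close> to \<open>(j+1) * 2^e\<close>. Their halves
  have the same form, and any two are nested or have disjoint interiors, which is what turns tilings
  by them into trees.\<close>

definition std :: "real \<Rightarrow> real \<Rightarrow> bool" where
  "std u l \<longleftrightarrow> (\<exists>(j::int) (e::int). l = 2 powi e \<and> u = of_int j * l)"

lemma std_pos: "std u l \<Longrightarrow> l > 0" unfolding std_def by auto

lemma std_halves: assumes "std u l" shows "std u (l/2)" "std (u + l/2) (l/2)"
proof -
  obtain j e :: int where e: "l = 2 powi e" "u = of_int j * l" using assms std_def by blast
  have "l / 2 = 2 powi (e - 1)" using e by (simp add: power_int_diff)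
  moreover have "u = of_int (2 * j) * (l / 2)" "u + l/2 = of_int (2 * j + 1) * (l / 2)"
    using e by (simp_all add: algebra_simps)
  ultimately show "std u (l/2)" "std (u + l/2) (l/2)" unfolding std_def by blast+
qed

lemma std_double: assumes "std u l" "std c (2 * l)" shows "std (2 * u + c) (2 * l)"
proof -
  obtain j e :: int where e: "l = 2 powi e" "u = of_int j * l" using assms std_def by blast
  obtain i f :: int where f: "c = of_int i * (2 * l)" using assms std_def by blast
  have "2 * l = 2 powi (e + 1)" using e by (simp add: power_int_add)
  moreover have "2 * u + c = of_int (j + i) * (2 * l)" using e f by (simp add: algebra_simps)
  ultimately show ?thesis unfolding std_def by blast
qed

lemma std_coarse_mult: assumes "std u (2 powi e)" "d \<le> e" shows "std u (2 powi d)"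
proof -
  obtain j f :: int where f: "u = of_int j * 2 powi e" using assms std_def by blast
  have "(2::real) powi e = 2 powi (e - d) * 2 powi d" by (simp add: power_int_diff)
  also have "(2::real) powi (e - d) = of_int (2 ^ nat (e - d))" using assms(2) by (simp add: power_int_def)
  finally have "u = of_int (j * 2 ^ nat (e - d)) * 2 powi d" using f by simp
  then show ?thesis unfolding std_def by blast
qed

lemma std_separated:
  assumes "std u l" "std c l" shows "u + l \<le> c \<or> c \<le> u"
proof -
  obtain j e :: int where e: "l = 2 powi e" "u = of_int j * l" using assms std_def by blast
  obtain i :: int where f: "c = of_int i * l" using assms std_def by blast
  have l: "l > 0" using e by simp
  have "j + 1 \<le> i \<or> i \<le> j" by linarith
  then show ?thesis
  proof
    assume "j + 1 \<le> i"
    then have "(of_int j + 1) * l \<le> of_int i * l" using l by (intro mult_right_mono) linarith+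
    then show ?thesis using e f by (simp add: algebra_simps)
  next
    assume "i \<le> j"
    then have "of_int i * l \<le> of_int j * l" using l by (intro mult_right_mono) linarith+
    then show ?thesis using e f by simp
  qed
qed

datatype tr = Lf | Nd tr tr

fun leaves :: "real \<Rightarrow> real \<Rightarrow> tr \<Rightarrow> (real \<times> real) list" where
  "leaves u l Lf = [(u, l)]"
| "leaves u l (Nd s t) = leaves u (l/2) s @ leaves (u + l/2) (l/2) t"

fun nodes :: "tr \<Rightarrow> nat" where
  "nodes Lf = 0"
| "nodes (Nd s t) = Suc (nodes s + nodes t)"

text \<open>The right comb is the normal form that rotations reach from every tree with the same
  number of nodes.\<close>

fun comb :: "nat \<Rightarrow> tr" where
  "comb 0 = Lf"
| "comb (Suc n) = Nd Lf (comb n)"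

fun full :: "nat \<Rightarrow> tr" where
  "full 0 = Lf"
| "full (Suc n) = Nd (full n) (full n)"

lemma length_leaves: "length (leaves u l t) = Suc (nodes t)"
  by (induction t arbitrary: u l) auto

lemma nodes_comb [simp]: "nodes (comb n) = n" by (induction n) auto

text \<open>When both lists are the leaves of trees, this is a tree pair diagram of an element of
  Thompson's group.\<close>

definition carries :: "(real \<Rightarrow> real) \<Rightarrow> (real \<times> real) list \<Rightarrow> (real \<times> real) list \<Rightarrow> bool" where
  "carries h xs ys \<longleftrightarrow> list_all2 (\<lambda>(u, l) (u', l'). affm h u l u' l') xs ys"

lemma carries_Cons: "carries h (p # xs) (q # ys) \<longleftrightarrow> affm h (fst p) (snd p) (fst q) (snd q) \<and> carries h xs ys"
  by (simp add: carries_def split_beta)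

lemma carries_Cons1: "carries h (p # xs) ys \<longleftrightarrow> (\<exists>q ys'. ys = q # ys' \<and> affm h (fst p) (snd p) (fst q) (snd q) \<and> carries h xs ys')"
  by (auto simp: carries_def split_beta list_all2_Cons1)

lemma carries_append: "carries h xs ys \<Longrightarrow> carries h xs' ys' \<Longrightarrow> carries h (xs @ xs') (ys @ ys')"
  unfolding carries_def by (rule list_all2_appendI)

lemma carries_affine: "affm h u l u' l' \<Longrightarrow> l > 0 \<Longrightarrow> carries h (leaves u l t) (leaves u' l' t)"
proof (induction t arbitrary: u l u' l')
  case Lf then show ?case by (simp add: carries_def)
next
  case (Nd s t)
  have "affm h u (l/2) u' (l'/2)" using Nd.prems unfolding affm_def by auto
  moreover have "affm h (u + l/2) (l/2) (u' + l'/2) (l'/2)"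
    unfolding affm_def
  proof (intro allI impI)
    fix r assume "u + l/2 \<le> r \<and> r \<le> u + l/2 + l/2"
    then have "h r = u' + (r - u) * (l' / l)" using Nd.prems unfolding affm_def by auto
    then show "h r = u' + l'/2 + (r - (u + l/2)) * (l'/2 / (l/2))" using Nd.prems by (simp add: field_simps)
  qed
  ultimately show ?case using Nd.IH Nd.prems(2) by (auto intro!: carries_append)
qed

lemma leaves_pos: "l > 0 \<Longrightarrow> \<forall>p\<in>set (leaves u l t). snd p > 0"
proof (induction t arbitrary: u l)
  case Lf then show ?case by simp
next
  case (Nd s t)
  then have "l / 2 > 0" by simp
  then show ?case using Nd.IH(1)[of "l/2" u] Nd.IH(2)[of "l/2" "u + l/2"] by auto
qed

lemma carries_comp:
  assumes "carries g xs ys" "carries h ys zs" "\<forall>p\<in>set xs. snd p > 0" "\<forall>p\<in>set ys. snd p > 0"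
  shows "carries (h \<circ> g) xs zs"
  using assms
proof (induction xs arbitrary: ys zs)
  case Nil then show ?case by (auto simp: carries_def)
next
  case (Cons p xs)
  obtain q ys' where ys: "ys = q # ys'" using Cons.prems(1) by (auto simp: carries_Cons1)
  obtain r zs' where zs: "zs = r # zs'" using Cons.prems(2) ys by (auto simp: carries_Cons1)
  have "affm (h \<circ> g) (fst p) (snd p) (fst r) (snd r)"
    by (rule affm_comp[of g _ _ "fst q" "snd q"]) (use Cons.prems in \<open>auto simp: ys zs carries_Cons\<close>)
  moreover have "carries (h \<circ> g) xs zs'"
    by (rule Cons.IH[of ys']) (use Cons.prems in \<open>auto simp: ys zs carries_Cons\<close>)
  ultimately show ?case unfolding zs carries_Cons by blast
qed

lemma carries_inv:
  assumes "carries h xs ys" "h \<in> PL" "\<forall>p\<in>set xs. snd p > 0" "\<forall>p\<in>set ys. snd p > 0"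
  shows "carries (finv h) ys xs"
  using assms
proof (induction xs arbitrary: ys)
  case Nil then show ?case by (auto simp: carries_def)
next
  case (Cons p xs)
  obtain q ys' where ys: "ys = q # ys'" using Cons.prems(1) by (auto simp: carries_Cons1)
  have "affm (finv h) (fst q) (snd q) (fst p) (snd p)"
    by (rule affm_inv) (use Cons.prems in \<open>auto simp: ys carries_Cons\<close>)
  moreover have "carries (finv h) ys' xs"
    by (rule Cons.IH) (use Cons.prems in \<open>auto simp: ys carries_Cons\<close>)
  ultimately show ?case unfolding ys carries_Cons by blast
qed

fun chain :: "(real \<times> real) list \<Rightarrow> real \<Rightarrow> real \<Rightarrow> bool" where
  "chain [] u w \<longleftrightarrow> u = w"
| "chain ((a, l) # xs) u w \<longleftrightarrow> a = u \<and> chain xs (u + l) w"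

lemma chain_append: "chain xs u v \<Longrightarrow> chain ys v w \<Longrightarrow> chain (xs @ ys) u w"
  by (induction xs u v rule: chain.induct) auto

lemma chain_leaves: "chain (leaves u l t) u (u + l)"
proof (induction t arbitrary: u l)
  case Lf then show ?case by simp
next
  case (Nd s t)
  have "u + l/2 + l/2 = u + l" by simp
  then have "chain (leaves (u + l/2) (l/2) t) (u + l/2) (u + l)" using Nd(2)[of "u + l/2" "l/2"] by (simp only:)
  then show ?case using Nd(1)[of u "l/2"] by (auto intro: chain_append)
qed

text \<open>On each tile both maps are the same affine map, and the tiles leave no gaps.\<close>

lemma carries_unique:
  assumes "chain xs u w" "carries f xs ys" "carries g xs ys" "\<forall>p\<in>set xs. snd p > 0" "u \<le> t" "t \<le> w" "xs \<noteq> []"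
  shows "f t = g t"
  using assms
proof (induction xs u w arbitrary: ys rule: chain.induct)
  case (1 u w) then show ?case by simp
next
  case (2 a l xs u w)
  obtain q ys' where ys: "ys = q # ys'" using 2(3) by (auto simp: carries_Cons1)
  have a: "affm f u l (fst q) (snd q)" "affm g u l (fst q) (snd q)"
    using 2(2,3,4) by (auto simp: ys carries_Cons)
  show ?case
  proof (cases "t \<le> u + l")
    case True then show ?thesis using affmD[OF a(1)] affmD[OF a(2)] 2(6) by simp
  next
    case False
    then have "xs \<noteq> []" using 2(2,7) by (cases xs) auto
    then show ?thesis using 2(1)[of ys'] 2(2-7) False by (auto simp: ys carries_Cons)
  qed
qed

text \<open>A grid point of mesh \<open>m\<close> is also a grid point of every finer dyadic mesh,
  so it cannot lie in the interior of a tile of length at most \<open>m\<close>; the tiling is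
  already cut there.\<close>

lemma chain_split:
  assumes "chain xs u w" "\<forall>(a,l)\<in>set xs. std a l \<and> l \<le> m" "std c m" "u \<le> c" "c \<le> w"
  shows "\<exists>ys zs. xs = ys @ zs \<and> chain ys u c \<and> chain zs c w"
  using assms
proof (induction xs u w rule: chain.induct)
  case (1 u w) then show ?case by auto
next
  case (2 a l xs u w)
  show ?case
  proof (cases "u = c")
    case True then show ?thesis using 2(2) by (intro exI[of _ "[]"] exI[of _ "(a, l) # xs"]) auto
  next
    case False
    have al: "std a l" "l \<le> m" "a = u" using 2(2,3) by auto
    obtain d :: int where d: "l = 2 powi d" using al std_def by blast
    obtain e :: int where e: "m = 2 powi e" using 2(4) std_def by blast
    have "d \<le> e" using al(2) unfolding d e powi2_le_iff .
    then have "std c l" using std_coarse_mult 2(4) unfolding d e by blast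
    then have "u + l \<le> c" using std_separated[OF al(1)] al(3) False 2(5) by force
    then have "\<exists>ys zs. xs = ys @ zs \<and> chain ys (u + l) c \<and> chain zs c w"
      using 2 by auto
    then obtain ys zs where "xs = ys @ zs" "chain ys (u + l) c" "chain zs c w" by blast
    then show ?thesis using al by (intro exI[of _ "(a,l) # ys"] exI[of _ zs]) auto
  qed
qed

lemma chain_le: "chain xs u w \<Longrightarrow> \<forall>p\<in>set xs. snd p > 0 \<Longrightarrow> u \<le> w"
  by (induction xs u w rule: chain.induct) auto

lemma chain_mem: "chain xs u w \<Longrightarrow> \<forall>p\<in>set xs. snd p > 0 \<Longrightarrow> (a, l) \<in> set xs \<Longrightarrow> u \<le> a \<and> a + l \<le> w"
proof (induction xs u w rule: chain.induct)
  case (1 u w) then show ?case by simp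
next
  case (2 b m xs u w)
  have "u + m \<le> w" by (rule chain_le[of xs]) (use 2 in auto)
  moreover have "0 < m" using 2 by auto
  ultimately show ?case using 2 by force
qed

text \<open>Either some tile is the whole interval, or every tile has at most half its length. In
  the second case the midpoint is a cut, and each half is tiled by fewer tiles.\<close>

lemma tiling_leaves:
  assumes "chain xs u (u + l)" "\<forall>(a,m)\<in>set xs. std a m" "std u l"
  shows "\<exists>t. xs = leaves u l t"
  using assms
proof (induction "length xs" arbitrary: xs u l rule: less_induct)
  case less
  have l: "l > 0" using std_pos less.prems(3) .
  have pos: "\<forall>p\<in>set xs. snd p > 0" using less.prems(2) std_pos by fastforce
  show ?case
  proof (cases "(u, l) \<in> set xs")
    case True
    obtain a m ys where xs: "xs = (a, m) # ys" using True by (cases xs) auto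
    have am: "a = u" "chain ys (u + m) (u + l)" using less.prems(1) xs by auto
    have m: "m > 0" using pos xs by auto
    have "(u, l) \<notin> set ys"
    proof
      assume "(u, l) \<in> set ys"
      then have "u + m \<le> u" using chain_mem[OF am(2), of u l] pos xs by auto
      then show False using m by simp
    qed
    then have ml: "m = l" using True xs by auto
    have "ys = []"
    proof (cases ys)
      case (Cons p zs)
      then have "fst p + snd p \<le> u + l" "u + m \<le> fst p" "snd p > 0"
        using chain_mem[OF am(2), of "fst p" "snd p"] pos xs by auto
      then show ?thesis using ml by simp
    qed simp
    then show ?thesis using xs am ml by (intro exI[of _ Lf]) simp
  next
    case False
    have small: "std a m \<and> m \<le> l/2" if am: "(a, m) \<in> set xs" for a m
    proof -
      have s: "std a m" using less.prems(2) am by auto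
      have r: "u \<le> a" "a + m \<le> u + l" using chain_mem[OF less.prems(1) pos am] by auto
      obtain d :: int where d: "m = 2 powi d" using s std_def by blast
      obtain e :: int where e: "l = 2 powi e" using less.prems(3) std_def by blast
      \<comment> \<open>Lengths are powers of 2, so a tile shorter than \<open>l\<close> has length
        at most \<open>l/2\<close>.\<close>
      have "m \<noteq> l" using r False am by auto
      then have "m < l" using r by simp
      then have "d < e" unfolding d e powi2_less_iff .
      then have "2 powi d \<le> (2::real) powi (e - 1)" by (intro power_int_increasing) auto
      then show ?thesis using s unfolding d e by (simp add: power_int_diff)
    qed
    have "\<exists>ys zs. xs = ys @ zs \<and> chain ys u (u + l/2) \<and> chain zs (u + l/2) (u + l)"
      by (rule chain_split[OF less.prems(1) _ std_halves(2)[OF less.prems(3)]]) (use small l in auto)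
    then obtain ys zs where yz: "xs = ys @ zs" "chain ys u (u + l/2)" "chain zs (u + l/2) (u + l)" by blast
    have "ys \<noteq> []" "zs \<noteq> []" using yz l by auto
    then have "length ys < length xs" "length zs < length xs" using yz by auto
    moreover have "u + l/2 + l/2 = u + l" by simp
    then have "chain zs (u + l/2) (u + l/2 + l/2)" using yz(3) by (simp only:)
    ultimately obtain s t where "ys = leaves u (l/2) s" "zs = leaves (u + l/2) (l/2) t"
      using less.hyps[of ys u "l/2"] less.hyps[of zs "u + l/2" "l/2"] yz less.prems std_halves by auto
    then show ?thesis using yz by (intro exI[of _ "Nd s t"]) simp
  qed
qed

definition rots_in :: "(real \<Rightarrow> real) set \<Rightarrow> real \<Rightarrow> real \<Rightarrow> bool" where
  "rots_in K u l \<longleftrightarrow> (\<forall>v m. std v m \<and> u \<le> v \<and> v + m \<le> u + l \<longrightarrow> rot v m \<in> K)"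

lemma rots_in_halves: assumes "rots_in K u l" "l > 0" shows "rots_in K u (l/2)" "rots_in K (u + l/2) (l/2)"
  using assms unfolding rots_in_def by auto

lemma rot_std_Fsup: assumes "std u l" shows "rot u l \<in> Fsup u (u + l)"
proof -
  obtain j e :: int where e: "l = 2 powi e" "u = of_int j * l" using assms std_def by blast
  have "u \<in> dyadic_rationals" unfolding e by (intro dyadic_mult dyadic_powi dyadic_of_int)
  then show ?thesis unfolding e(1) by (rule rot_Fsup)
qed

lemma affm_rot:
  assumes "l > 0"
  shows "affm (rot u l) u (l/4) u (l/2)" "affm (rot u l) (u + l/4) (l/4) (u + l/2) (l/4)"
    "affm (rot u l) (u + l/2) (l/2) (u + l/2 + l/4) (l/4)"
proof -
  have *: "affm (rot u l) (u + l * p) (l * d) (u + l * p') (l * d')"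
    if "\<And>r. p \<le> r \<Longrightarrow> r \<le> p + d \<Longrightarrow> xi r = p' + (r - p) * (d' / d)" for p d p' d'
    unfolding affm_def
  proof (intro allI impI)
    fix t assume t: "u + l * p \<le> t \<and> t \<le> u + l * p + l * d"
    define r where "r = (t - u) / l"
    have tr: "t = u + l * r" using assms by (simp add: r_def)
    have "l * p \<le> l * r" "l * r \<le> l * (p + d)" using t unfolding tr by (auto simp: distrib_left)
    then have "p \<le> r" "r \<le> p + d" using assms by auto
    then have x: "xi r = p' + (r - p) * (d' / d)" using that by blast
    have "l * d' / (l * d) = d' / d" "t - (u + l * p) = l * (r - p)" using assms tr by (auto simp: algebra_simps)
    moreover have "rot u l t = u + l * (p' + (r - p) * (d' / d))"
      unfolding tr using assms rot_scaled[of l u r] x by simp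
    ultimately show "rot u l t = u + l * p' + (t - (u + l * p)) * (l * d' / (l * d))"
      by (simp only: distrib_left add.assoc mult.assoc)
  qed
  show "affm (rot u l) u (l/4) u (l/2)"
    using *[of 0 "1/4" 0 "1/2"] by (auto simp: xi_def)
  show "affm (rot u l) (u + l/4) (l/4) (u + l/2) (l/4)"
    using *[of "1/4" "1/4" "1/2" "1/4"] by (auto simp: xi_def)
  have "affm (rot u l) (u + l * (1/2)) (l * (1/2)) (u + l * (3/4)) (l * (1/4))"
    by (rule *) (auto simp: xi_def field_simps)
  moreover have "u + l * (3/4) = u + l/2 + l/4" "l * (1/2) = l/2" "l * (1/4) = l/4" by simp_all
  ultimately show "affm (rot u l) (u + l/2) (l/2) (u + l/2 + l/4) (l/4)" by (simp only:)
qed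

lemma affm_id: assumes "\<And>t. u \<le> t \<Longrightarrow> t \<le> u + l \<Longrightarrow> h t = t" "l > 0" shows "affm h u l u l"
  using assms unfolding affm_def by auto

lemma carries_rot:
  assumes "l > 0"
  shows "carries (rot u l) (leaves u l (Nd (Nd a b) c)) (leaves u l (Nd a (Nd b c)))"
proof -
  note r = affm_rot[OF assms, of u]
  have q: "u + l/2/2 = u + l/4" "l/2/2 = l/4" by simp_all
  have "leaves u l (Nd (Nd a b) c) = leaves u (l/4) a @ leaves (u + l/4) (l/4) b @ leaves (u + l/2) (l/2) c"
    by (simp add: q)
  moreover have "leaves u l (Nd a (Nd b c)) = leaves u (l/2) a @ leaves (u + l/2) (l/4) b @ leaves (u + l/2 + l/4) (l/4) c"
    by (simp add: q)
  ultimately show ?thesis using carries_affine[OF r(1), of a] carries_affine[OF r(2), of b] carries_affine[OF r(3), of c] assms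
    by (simp add: carries_append)
qed

lemma carries_id: "\<forall>p\<in>set xs. snd p > 0 \<Longrightarrow> carries id xs xs"
  unfolding carries_def by (rule list_all2_refl) (auto simp: affm_def)

text \<open>One rotation at the root brings the first leaf of the left comb to the top and leaves
  the same problem, with a shorter left comb, in the right half.\<close>

lemma comb_join:
  assumes "subgrp K" "rots_in K u l" "std u l"
  shows "\<exists>h\<in>K. h \<in> Fsup u (u + l) \<and> carries h (leaves u l (Nd (comb p) (comb q))) (leaves u l (comb (Suc (p + q))))"
  using assms(2,3)
proof (induction p arbitrary: u l)
  case 0
  have "carries id (leaves u l (Nd Lf (comb q))) (leaves u l (Nd Lf (comb q)))"
    by (rule carries_id[OF leaves_pos[OF std_pos[OF 0(2)]]])
  then show ?case using subgrpD(2)[OF assms(1)]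
    by (intro bexI[of _ id] conjI Fsup_id) (simp_all only: comb.simps nodes.simps add_0)
next
  case (Suc p)
  have l: "l > 0" using std_pos Suc.prems(2) .
  obtain h where h: "h \<in> K" "h \<in> Fsup (u + l/2) (u + l/2 + l/2)"
    "carries h (leaves (u + l/2) (l/2) (Nd (comb p) (comb q))) (leaves (u + l/2) (l/2) (comb (Suc (p + q))))"
    using Suc.IH[of "u + l/2" "l/2"] rots_in_halves(2)[OF Suc.prems(1) l] std_halves(2)[OF Suc.prems(2)] by blast
  have r: "rot u l \<in> K" "rot u l \<in> Fsup u (u + l)"
    using Suc.prems(1,2) rot_std_Fsup unfolding rots_in_def by auto
  have "affm h u (l/2) u (l/2)" by (rule affm_id) (use Fsup_outside[OF h(2)] l in auto)
  then have "carries h (leaves u (l/2) Lf) (leaves u (l/2) Lf)" by (rule carries_affine) (use l in simp)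
  then have c: "carries h (leaves u l (Nd Lf (Nd (comb p) (comb q)))) (leaves u l (Nd Lf (comb (Suc (p + q)))))"
    using carries_append[OF _ h(3)] by (simp only: leaves.simps(2)[of u l])
  have "carries (h \<circ> rot u l) (leaves u l (Nd (Nd Lf (comb p)) (comb q))) (leaves u l (Nd Lf (comb (Suc (p + q)))))"
    by (rule carries_comp[OF carries_rot[OF l] c leaves_pos[OF l] leaves_pos[OF l]])
  moreover have "h \<in> Fsup u (u + l)" by (rule Fsup_mono[OF h(2)]) (use l in auto)
  ultimately show ?case using subgrpD(3)[OF assms(1) h(1) r(1)] Fsup_comp[of h u "u + l" "rot u l"] r(2)
    by (intro bexI[of _ "h \<circ> rot u l"]) (simp_all only: comb.simps add_Suc simp_thms)
qed

text \<open>Both subtrees are combed by maps supported in different halves, which do not disturb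
  each other; \<open>comb_join\<close> then merges the two combs.\<close>

lemma tree_to_comb:
  assumes "subgrp K" "rots_in K u l" "std u l"
  shows "\<exists>h\<in>K. h \<in> Fsup u (u + l) \<and> carries h (leaves u l t) (leaves u l (comb (nodes t)))"
  using assms(2,3)
proof (induction t arbitrary: u l)
  case Lf
  have "carries id (leaves u l Lf) (leaves u l Lf)"
    by (rule carries_id[OF leaves_pos[OF std_pos[OF Lf(2)]]])
  then show ?case using subgrpD(2)[OF assms(1)]
    by (intro bexI[of _ id] conjI Fsup_id) (simp_all only: comb.simps nodes.simps add_0)
next
  case (Nd s t)
  have l: "l > 0" using std_pos Nd.prems(2) .
  obtain h1 where h1: "h1 \<in> K" "h1 \<in> Fsup u (u + l/2)"
    "carries h1 (leaves u (l/2) s) (leaves u (l/2) (comb (nodes s)))"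
    using Nd.IH(1)[of u "l/2"] rots_in_halves(1)[OF Nd.prems(1) l] std_halves(1)[OF Nd.prems(2)] by blast
  obtain h2 where h2: "h2 \<in> K" "h2 \<in> Fsup (u + l/2) (u + l/2 + l/2)"
    "carries h2 (leaves (u + l/2) (l/2) t) (leaves (u + l/2) (l/2) (comb (nodes t)))"
    using Nd.IH(2)[of "u + l/2" "l/2"] rots_in_halves(2)[OF Nd.prems(1) l] std_halves(2)[OF Nd.prems(2)] by blast
  obtain h3 where h3: "h3 \<in> K" "h3 \<in> Fsup u (u + l)"
    "carries h3 (leaves u l (Nd (comb (nodes s)) (comb (nodes t)))) (leaves u l (comb (Suc (nodes s + nodes t))))"
    using comb_join[OF assms(1) Nd.prems] by blast
  have i2: "carries h2 (leaves u (l/2) s) (leaves u (l/2) s)"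
    by (rule carries_affine[OF affm_id]) (use Fsup_outside[OF h2(2)] l in auto)
  have i1: "carries h1 (leaves (u + l/2) (l/2) w) (leaves (u + l/2) (l/2) w)" for w
    by (rule carries_affine[OF affm_id]) (use Fsup_outside[OF h1(2)] l in auto)
  have c2: "carries h2 (leaves u l (Nd s t)) (leaves u l (Nd s (comb (nodes t))))"
    using carries_append[OF i2 h2(3)] by simp
  have c1: "carries h1 (leaves u l (Nd s (comb (nodes t)))) (leaves u l (Nd (comb (nodes s)) (comb (nodes t))))"
    using carries_append[OF h1(3) i1] by simp
  have "carries (h3 \<circ> (h1 \<circ> h2)) (leaves u l (Nd s t)) (leaves u l (comb (Suc (nodes s + nodes t))))"
    by (rule carries_comp[OF carries_comp[OF c2 c1] h3(3)]) (rule leaves_pos[OF l])+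
  moreover have "h3 \<circ> (h1 \<circ> h2) \<in> Fsup u (u + l)"
    by (intro Fsup_comp h3(2) Fsup_mono[OF h1(2)] Fsup_mono[OF h2(2)]) (use l in auto)
  moreover have "h3 \<circ> (h1 \<circ> h2) \<in> K" by (intro subgrpD(3)[OF assms(1)] h1(1) h2(1) h3(1))
  ultimately show ?case by (auto intro!: bexI[of _ "h3 \<circ> (h1 \<circ> h2)"])
qed

section \<open>From piecewise linear maps to products of rotations\<close>

lemma leaves_full: "(v, m) \<in> set (leaves u l (full n)) \<Longrightarrow> m = l / 2 ^ n \<and> (\<exists>k::nat. v = u + real k * (l / 2 ^ n))"
proof (induction n arbitrary: u l)
  case 0 then show ?case by (auto intro: exI[of _ 0])
next
  case (Suc n)
  have q: "l / 2 / 2 ^ n = l / 2 ^ Suc n" by simp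
  consider "(v, m) \<in> set (leaves u (l/2) (full n))" | "(v, m) \<in> set (leaves (u + l/2) (l/2) (full n))"
    using Suc.prems by auto
  then show ?case
  proof cases
    case 1 then show ?thesis using Suc.IH[OF 1] unfolding q by blast
  next
    case 2
    then obtain k :: nat where k: "v = u + l/2 + real k * (l / 2 ^ Suc n)" and m: "m = l / 2 ^ Suc n"
      using Suc.IH[OF 2] unfolding q by blast
    have "v = u + real (2 ^ n + k) * (l / 2 ^ Suc n)" 
    proof -
      have "real (2 ^ n) * (l / 2 ^ Suc n) = l / 2" by simp
      then show ?thesis unfolding k by (simp only: of_nat_add distrib_right add.assoc)
    qed
    then show ?thesis using m by blast
  qed
qed

text \<open>With the offset inside the bracket, the grid interval of index \<open>k\<close> visibly
  goes to the standard interval of index \<open>k + j\<close> and length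
  \<open>2 powi m / 2 ^ N\<close>.\<close>

lemma aff_on_uniform:
  assumes "aff_on f A"
  shows "\<exists>r. \<forall>N\<ge>r. \<exists>(m::int) (j::int). \<forall>t\<in>A. f t = 2 powi m * (t + of_int j / 2 ^ N)"
proof -
  obtain m b where m: "b \<in> dyadic_rationals" "\<forall>t\<in>A. f t = 2 powi m * t + b"
    using assms unfolding aff_on_def by blast
  have "2 powi (-m) * b \<in> dyadic_rationals" using m(1) by blast
  then obtain p :: int and r :: nat where p: "2 powi (-m) * b = of_int p / 2 ^ r" using dyadic_iff by blast
  have b: "b = 2 powi m * (of_int p / 2 ^ r)" unfolding p[symmetric] by (simp add: power_int_minus)
  have "\<exists>(m::int) (j::int). \<forall>t\<in>A. f t = 2 powi m * (t + of_int j / 2 ^ N)" if "N \<ge> r" for N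
  proof -
    have "(2::real) ^ N = 2 ^ (N - r) * 2 ^ r" using that by (simp flip: power_add)
    then have "of_int p / 2 ^ r = of_int (p * 2 ^ (N - r)) / (2::real) ^ N" by simp
    then have "\<forall>t\<in>A. f t = 2 powi m * (t + of_int (p * 2 ^ (N - r)) / 2 ^ N)"
      using m(2) b by (simp add: distrib_left)
    then show ?thesis by blast
  qed
  then show ?thesis by blast
qed

text \<open>Compactness by interval induction. The statement covers all grid intervals that meet
  \<open>[a,b]\<close>, including those sticking out, so that the statements for adjacent intervals
  combine.\<close>

lemma PL_uniform:
  assumes "f \<in> PL" "a \<le> b"
  shows "\<exists>N0. \<forall>N\<ge>N0. \<forall>k::int. real_of_int k / 2 ^ N \<le> b \<and> a \<le> (real_of_int k + 1) / 2 ^ N \<longrightarrow>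
     (\<exists>(m::int) (j::int). \<forall>t. of_int k / 2 ^ N \<le> t \<and> t \<le> (of_int k + 1) / 2 ^ N \<longrightarrow> f t = 2 powi m * (t + of_int j / 2 ^ N))"
    (is "?P a b")
  using assms(2)
proof (induction rule: Bolzano)
  case (trans a b c)
  obtain N1 N2 where N: "\<forall>N\<ge>N1. \<forall>k::int. of_int k / 2 ^ N \<le> b \<and> a \<le> (real_of_int k + 1) / 2 ^ N \<longrightarrow>
     (\<exists>(m::int) (j::int). \<forall>t. of_int k / 2 ^ N \<le> t \<and> t \<le> (of_int k + 1) / 2 ^ N \<longrightarrow> f t = 2 powi m * (t + of_int j / 2 ^ N))"
    "\<forall>N\<ge>N2. \<forall>k::int. of_int k / 2 ^ N \<le> c \<and> b \<le> (of_int k + 1) / 2 ^ N \<longrightarrow>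
     (\<exists>(m::int) (j::int). \<forall>t. of_int k / 2 ^ N \<le> t \<and> t \<le> (of_int k + 1) / 2 ^ N \<longrightarrow> f t = 2 powi m * (t + of_int j / 2 ^ N))"
    using trans(1,2) by blast
  show ?case
  proof (intro exI[of _ "max N1 N2"] allI impI)
    fix N and k :: int assume N': "max N1 N2 \<le> N" and k: "of_int k / 2 ^ N \<le> c \<and> a \<le> (of_int k + 1) / 2 ^ N"
    have "of_int k / 2 ^ N \<le> b \<or> b \<le> (of_int k + 1) / 2 ^ N" by (simp add: field_simps) linarith
    then show "\<exists>(m::int) (j::int). \<forall>t. of_int k / 2 ^ N \<le> t \<and> t \<le> (of_int k + 1) / 2 ^ N \<longrightarrow> f t = 2 powi m * (t + of_int j / 2 ^ N)"
    proof
      assume "of_int k / 2 ^ N \<le> b" then show ?thesis using N(1) N' k by simp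
    next
      assume "b \<le> (of_int k + 1) / 2 ^ N" then show ?thesis using N(2) N' k by simp
    qed
  qed
next
  case (local x)
  have "PLloc f" using assms(1) PL_def by blast
  then obtain e where e: "e > 0" "aff_on f {x-e..x}" "aff_on f {x..x+e}"
    "x \<in> dyadic_rationals \<or> aff_on f {x-e..x+e}" using PLlocE by metis
  obtain r1 where r1: "\<forall>N\<ge>r1. \<exists>(m::int) (j::int). \<forall>t\<in>{x-e..x}. f t = 2 powi m * (t + of_int j / 2 ^ N)"
    using aff_on_uniform[OF e(2)] by blast
  obtain r2 where r2: "\<forall>N\<ge>r2. \<exists>(m::int) (j::int). \<forall>t\<in>{x..x+e}. f t = 2 powi m * (t + of_int j / 2 ^ N)"
    using aff_on_uniform[OF e(3)] by blast
  obtain r3 where r3: "(\<exists>p::int. x = of_int p / 2 ^ r3) \<or>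
      (\<forall>N\<ge>r3. \<exists>(m::int) (j::int). \<forall>t\<in>{x-e..x+e}. f t = 2 powi m * (t + of_int j / 2 ^ N))"
    using e(4) aff_on_uniform[of f "{x-e..x+e}"] dyadic_iff[of x] by blast
  obtain r4 :: nat where r4: "2 / e < 2 ^ r4" using real_arch_pow[of 2 "2/e"] by auto
  \<comment> \<open>The mesh must admit the one-sided formulas (\<open>r1\<close>,
    \<open>r2\<close>), make \<open>x\<close> a grid point or admit the two-sided formula
    (\<open>r3\<close>), and be smaller than \<open>e/2\<close> (\<open>r4\<close>), so that grid
    intervals meeting \<open>[a,b]\<close> stay within \<open>e\<close> of \<open>x\<close>.\<close>
  define N0 where "N0 = max (max r1 r2) (max r3 r4)"
  have "?P a b" if ab: "a \<le> x" "x \<le> b" "b - a < e/2" for a b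
  proof (intro exI[of _ N0] allI impI)
    fix N and k :: int assume N: "N0 \<le> N" and k: "of_int k / 2 ^ N \<le> b \<and> a \<le> (of_int k + 1) / 2 ^ N"
    have Nr: "r1 \<le> N" "r2 \<le> N" "r3 \<le> N" using N by (auto simp: N0_def)
    have "(2::real) ^ r4 \<le> 2 ^ N" using N by (intro power_increasing) (auto simp: N0_def)
    then have "2 / e < 2 ^ N" using r4 by (rule less_le_trans[rotated])
    then have small: "1 / 2 ^ N < e / 2" using e(1) by (simp add: field_simps)
    have len: "(of_int k + 1) / 2 ^ N = of_int k / 2 ^ N + 1 / (2::real) ^ N" by (simp add: add_divide_distrib)
    have r: "x - e \<le> of_int k / 2 ^ N" "(of_int k + 1) / 2 ^ N \<le> x + e" using k ab small len by linarith+
    show "\<exists>(m::int) (j::int). \<forall>t. of_int k / 2 ^ N \<le> t \<and> t \<le> (of_int k + 1) / 2 ^ N \<longrightarrow> f t = 2 powi m * (t + of_int j / 2 ^ N)"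
      using r3
    proof
      assume "\<exists>p::int. x = of_int p / 2 ^ r3"
      then obtain p :: int where p: "x = of_int p / 2 ^ r3" by blast
      have "r3 \<le> N" using N by (simp add: N0_def)
      then have "(2::real) ^ N = 2 ^ (N - r3) * 2 ^ r3" by (simp flip: power_add)
      then have x: "x = of_int (p * 2 ^ (N - r3)) / 2 ^ N" using p by simp
      have "k + 1 \<le> p * 2 ^ (N - r3) \<or> p * 2 ^ (N - r3) \<le> k" by linarith
      then have "of_int (k + 1) \<le> (of_int (p * 2 ^ (N - r3)) :: real) \<or> (of_int (p * 2 ^ (N - r3)) :: real) \<le> of_int k"
        by (simp only: of_int_le_iff)
      then have "(of_int k + 1) / 2 ^ N \<le> x \<or> x \<le> of_int k / 2 ^ N" unfolding x by (elim disj_forward) (simp_all add: divide_right_mono)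
      then show ?thesis
      proof
        assume "(of_int k + 1) / 2 ^ N \<le> x"
        moreover obtain m j :: int where "\<forall>t\<in>{x-e..x}. f t = 2 powi m * (t + of_int j / 2 ^ N)"
          using r1[rule_format, OF Nr(1)] by blast
        ultimately show ?thesis using r by (intro exI[of _ m] exI[of _ j]) auto
      next
        assume "x \<le> of_int k / 2 ^ N"
        moreover obtain m j :: int where "\<forall>t\<in>{x..x+e}. f t = 2 powi m * (t + of_int j / 2 ^ N)"
          using r2[rule_format, OF Nr(2)] by blast
        ultimately show ?thesis using r by (intro exI[of _ m] exI[of _ j]) auto
      qed
    next
      assume "\<forall>N\<ge>r3. \<exists>(m::int) (j::int). \<forall>t\<in>{x-e..x+e}. f t = 2 powi m * (t + of_int j / 2 ^ N)"
      then obtain m j :: int where "\<forall>t\<in>{x-e..x+e}. f t = 2 powi m * (t + of_int j / 2 ^ N)"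
        using Nr(3) by blast
      then show ?thesis using r by (intro exI[of _ m] exI[of _ j]) auto
    qed
  qed
  then show ?case using e(1) by (intro exI[of _ "e/2"]) simp
qed

lemma chain_map: "chain xs u w \<Longrightarrow> chain (map (\<lambda>(v, m). (f v, f (v + m) - f v)) xs) (f u) (f w)"
  by (induction xs u w rule: chain.induct) auto

text \<open>A sufficiently fine full tree is carried by \<open>f\<close> to a tiling by standard
  intervals, hence to the leaves of another tree. Combing both trees leads to the same comb, and
  \<open>f\<close> is the quotient of the two combing maps.\<close>

lemma Fsup_generated:
  assumes K: "subgrp K" "rots_in K 0 2"
  shows "Fsup 0 2 \<subseteq> K"
proof
  fix f assume f: "f \<in> Fsup 0 2"
  have fP: "f \<in> PL" using Fsup_PL[OF f] .
  have f02: "f 0 = 0" "f 2 = 2" using Fsup_outside[OF f] by auto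
  obtain N where N: "\<forall>k::int. real_of_int k / 2 ^ N \<le> 2 \<and> 0 \<le> (real_of_int k + 1) / 2 ^ N \<longrightarrow>
     (\<exists>(m::int) (j::int). \<forall>t. of_int k / 2 ^ N \<le> t \<and> t \<le> (of_int k + 1) / 2 ^ N \<longrightarrow> f t = 2 powi m * (t + of_int j / 2 ^ N))"
    using PL_uniform[OF fP, of 0 2] by auto
  have s02: "std 0 2" unfolding std_def by (intro exI[of _ 0] exI[of _ 1]) simp
  \<comment> \<open>\<open>[0,2]\<close> halved \<open>Suc N\<close> times has mesh
    \<open>1 / 2 ^ N\<close>.\<close>
  define xs where "xs = leaves 0 2 (full (Suc N))"
  define ys where "ys = map (\<lambda>(v, m). (f v, f (v + m) - f v)) xs"
  have xpos: "\<forall>p\<in>set xs. snd p > 0" unfolding xs_def by (rule leaves_pos) simp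
  have chx: "chain xs 0 2" unfolding xs_def using chain_leaves[of 0 2 "full (Suc N)"] by (simp only: add_0)
  have piece: "affm f v m (f v) (f (v + m) - f v) \<and> std (f v) (f (v + m) - f v)" if vm: "(v, m) \<in> set xs" for v m
  proof -
    obtain k :: nat where k: "v = 0 + real k * (2 / 2 ^ Suc N)" and m: "m = 2 / 2 ^ Suc N"
      using leaves_full vm unfolding xs_def by blast
    have m': "m = 1 / 2 ^ N" using m by simp
    have v: "v = of_int (int k) / 2 ^ N" using k by simp
    have vm': "v + m = (of_int (int k) + 1) / 2 ^ N" unfolding v m' by (simp add: add_divide_distrib)
    have mp: "m > 0" unfolding m' by simp
    have "0 \<le> v" "v + m \<le> 2" using chain_mem[OF chx xpos vm] by auto
    then have "v \<le> 2" "0 \<le> v + m" using mp by linarith+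
    then obtain a j :: int where aj: "\<forall>t. v \<le> t \<and> t \<le> v + m \<longrightarrow> f t = 2 powi a * (t + of_int j / 2 ^ N)"
      using N[rule_format, of "int k"] unfolding v[symmetric] vm'[symmetric] by blast
    have fv: "f v = 2 powi a * (v + of_int j / 2 ^ N)" "f (v + m) = 2 powi a * (v + m + of_int j / 2 ^ N)"
      using aj mp by auto
    have d: "f (v + m) - f v = 2 powi a * m" unfolding fv by (simp add: algebra_simps)
    have "affm f v m (f v) (2 powi a * m)" unfolding affm_def
    proof (intro allI impI)
      fix t assume "v \<le> t \<and> t \<le> v + m"
      then have "f t = 2 powi a * (t + of_int j / 2 ^ N)" using aj by blast
      then show "f t = f v + (t - v) * (2 powi a * m / m)" unfolding fv using mp by (simp add: algebra_simps)
    qed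
    moreover have "2 powi a * m = 2 powi (a - int N)" unfolding m' by (simp add: power_int_diff)
    moreover have "f v = of_int (int k + j) * (2 powi a * m)"

    proof -
      have "2 powi a * (v + of_int j / 2 ^ N) = of_int (int k + j) * (2 powi a * m)"
        unfolding v m' by (simp add: field_simps)
      then show ?thesis using fv(1) by (simp only:)
    qed
    ultimately show ?thesis unfolding d std_def by blast
  qed
  have cf: "carries f xs ys"
    unfolding carries_def ys_def list_all2_map2 list_all2_same using piece by auto
  have "chain ys (f 0) (f 2)" unfolding ys_def by (rule chain_map[OF chx])
  then have chy: "chain ys 0 (0 + 2)" unfolding f02 by simp
  have stdy: "\<forall>(a, m)\<in>set ys. std a m" unfolding ys_def using piece by auto
  then have ypos: "\<forall>p\<in>set ys. snd p > 0" using std_pos by fastforce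
  obtain t where t: "ys = leaves 0 2 t" using tiling_leaves[OF chy stdy s02] by blast
  obtain h1 where h1: "h1 \<in> K" "h1 \<in> Fsup 0 (0 + 2)" "carries h1 xs (leaves 0 2 (comb (nodes (full (Suc N)))))"
    using tree_to_comb[OF K s02] unfolding xs_def by blast
  obtain h2 where h2: "h2 \<in> K" "h2 \<in> Fsup 0 (0 + 2)" "carries h2 ys (leaves 0 2 (comb (nodes t)))"
    using tree_to_comb[OF K s02] unfolding t by blast
  \<comment> \<open>Equal numbers of leaves mean equal numbers of nodes, so both trees have the same
    comb.\<close>
  have "length xs = length ys" unfolding ys_def by simp
  then have "nodes (full (Suc N)) = nodes t" unfolding t xs_def length_leaves by simp
  then have h1c: "carries h1 xs (leaves 0 2 (comb (nodes t)))" using h1(3) by simp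
  have lp: "\<forall>p\<in>set (leaves 0 2 (comb (nodes t))). snd p > 0" by (rule leaves_pos) simp
  have "carries (finv h2) (leaves 0 2 (comb (nodes t))) ys"
    by (rule carries_inv[OF h2(3) Fsup_PL[OF h2(2)] ypos lp])
  from carries_comp[OF h1c this xpos lp] have cg: "carries (finv h2 \<circ> h1) xs ys" .
  have gF: "finv h2 \<circ> h1 \<in> Fsup 0 2" using Fsup_comp[OF Fsup_inv[OF h2(2)] h1(2)] by simp
  have ne: "xs \<noteq> []" using length_leaves[of 0 2 "full (Suc N)"] unfolding xs_def by auto
  have "f = finv h2 \<circ> h1"
  proof
    fix s show "f s = (finv h2 \<circ> h1) s"
    proof (cases "0 \<le> s \<and> s \<le> 2")
      case True then show ?thesis using carries_unique[OF chx cf cg xpos _ _ ne] by blast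
    next
      case False then show ?thesis using Fsup_outside[OF f, of s] Fsup_outside[OF gF, of s] by linarith
    qed
  qed
  moreover have "finv h2 \<circ> h1 \<in> K" by (intro subgrpD(3)[OF K(1)] subgrpD(4)[OF K(1)] h1(1) h2(1))
  ultimately show "f \<in> K" by simp
qed

section \<open>Perfectness and a finite generating set\<close>

lemma Fc_perfect:
  assumes K: "subgrp K" and cm: "\<And>p q. p \<in> Fc a b \<Longrightarrow> q \<in> Fc a b \<Longrightarrow> cmt p q \<in> K"
  shows "Fc a b \<subseteq> K"
proof
  fix f assume "f \<in> Fc a b"
  then obtain u v where uv: "a < u" "u < v" "v < b" "u \<in> dyadic_rationals" "v \<in> dyadic_rationals" "f \<in> Fsup u v"
    by (rule FcE)
  \<comment> \<open>Tree codes need a standard interval, so the support is transported to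
    \<open>[0,2]\<close>, and \<open>K\<close> along with it.\<close>
  obtain h where h: "h \<in> PL" "h u = 0" "h v = 2" using PL_connect[of u v 0 2] uv by auto
  have hi: "finv h \<in> PL" using PL_inv[OF h(1)] .
  have ends: "h a < 0" "2 < h b" using PL_less_iff[OF h(1), of a u] PL_less_iff[OF h(1), of v b] uv h by auto
  define K' where "K' = {g \<in> PL. finv h \<circ> g \<circ> h \<in> K}"
  have comp: "finv h \<circ> (f \<circ> g) \<circ> h = (finv h \<circ> f \<circ> h) \<circ> (finv h \<circ> g \<circ> h)" for f g
    using PL_inv_eq[OF h(1)] by (simp add: fun_eq_iff)
  have inv: "finv (finv h \<circ> g \<circ> h) = finv h \<circ> finv g \<circ> h" if "g \<in> PL" for g
    using that h(1) by (simp add: finv_comp finv_finv PL_comp PL_inv o_assoc)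
  have "subgrp K'" unfolding subgrp_def
  proof (intro conjI ballI)
    show "K' \<subseteq> PL" unfolding K'_def by blast
    show "id \<in> K'" unfolding K'_def using subgrpD(2)[OF K] PL_comp_inv[OF h(1)] by simp
    show "f \<circ> g \<in> K'" if "f \<in> K'" "g \<in> K'" for f g
      using that subgrpD(3)[OF K, of "finv h \<circ> f \<circ> h" "finv h \<circ> g \<circ> h"]
      unfolding K'_def mem_Collect_eq comp by (simp add: PL_comp)
    show "finv f \<in> K'" if "f \<in> K'" for f
      using that subgrpD(4)[OF K, of "finv h \<circ> f \<circ> h"] inv[of f] unfolding K'_def by (auto simp: PL_inv)
  qed
  moreover have "rots_in K' 0 2" unfolding rots_in_def
  proof (intro allI impI, elim conjE)
    \<comment> \<open>\<open>[0,2]\<close> lies strictly inside \<open>(h a, h b)\<close>. This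
      gives \<open>rot_commutator\<close> room for its conjugators even when the rotation fills all
      of \<open>[0,2]\<close>.\<close>
    fix w m assume w: "std w m" "0 \<le> w" "w + m \<le> 0 + 2"
    obtain j e :: int where e: "m = 2 powi e" "w = of_int j * m" using w(1) std_def by blast
    have "w \<in> dyadic_rationals" unfolding e by (intro dyadic_mult dyadic_powi dyadic_of_int)
    moreover have "h a < w" "w + 2 powi e < h b" using w ends unfolding e(1)[symmetric] by auto
    ultimately obtain p q where pq: "p \<in> Fc (h a) (h b)" "q \<in> Fc (h a) (h b)" "rot w m = cmt p q"
      using rot_commutator[of w "h a" e "h b"] unfolding e(1)[symmetric] by metis
    have p: "finv h \<circ> p \<circ> h \<in> Fc a b" "finv h \<circ> q \<circ> h \<in> Fc a b"
      using conj_Fc[OF pq(1) hi] conj_Fc[OF pq(2) hi] PL_inv_eq[OF h(1)] finv_finv[OF h(1)] by simp_all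
    have "finv h \<circ> rot w m \<circ> h = cmt (finv h \<circ> p \<circ> h) (finv h \<circ> q \<circ> h)"
      unfolding pq(3) cmt_def comp inv[OF Fc_PL[OF pq(1)]] inv[OF Fc_PL[OF pq(2)]] ..
    then show "rot w m \<in> K'" unfolding K'_def using cm[OF p] Fsup_PL[OF rot_std_Fsup[OF w(1)]] by simp
  qed
  ultimately have "Fsup 0 2 \<subseteq> K'" by (rule Fsup_generated)
  moreover have "h \<circ> f \<circ> finv h \<in> Fsup 0 2" using conj_Fsup[OF uv(6) h(1)] h by simp
  ultimately have "finv h \<circ> (h \<circ> f \<circ> finv h) \<circ> h \<in> K" unfolding K'_def by blast
  moreover have "finv h \<circ> (h \<circ> f \<circ> finv h) \<circ> h = f" using PL_inv_eq[OF h(1)] by (simp add: fun_eq_iff)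
  ultimately show "f \<in> K" by simp
qed

lemma conj_rot_mem:
  assumes K: "subgrp K" and h: "h \<in> K" "affm h v m v' m'" "m > 0" "m' > 0" and r: "rot v' m' \<in> K"
  shows "rot v m \<in> K"
proof -
  have hP: "h \<in> PL" using subgrpD(1)[OF K h(1)] .
  have "rot v m = finv h \<circ> (h \<circ> rot v m \<circ> finv h) \<circ> h" using PL_inv_eq[OF hP] by (simp add: fun_eq_iff)
  also have "\<dots> = finv h \<circ> rot v' m' \<circ> h" using conj_rot[OF hP h(2-4)] by simp
  finally show ?thesis using subgrpD(3,4)[OF K] h(1) r by simp
qed

lemma affm_sub: assumes "affm h u l u' l'" "u \<le> v" "v + m \<le> u + l" "l > 0" "m > 0"
  shows "affm h v m (u' + (v - u) * (l'/l)) (m * (l'/l))"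
  using assms unfolding affm_def by (auto simp: algebra_simps diff_divide_distrib)

text \<open>The rotations at the top three levels of the binary subdivision of \<open>[0,2]\<close>;
  those at deeper levels turn out to be conjugate to them inside the group that these
  generate.\<close>

definition small_rots :: "(real \<Rightarrow> real) set" where
  "small_rots = (\<lambda>(d, k). rot (real k * (2 / 2 ^ d)) (2 / 2 ^ d)) ` (Sigma {..2} (\<lambda>d. {..<2 ^ d}))"

lemma finite_small_rots: "finite small_rots"
  unfolding small_rots_def by (intro finite_imageI finite_SigmaI) auto

text \<open>\<open>rot 0 2\<close> doubles intervals in \<open>[0,1/2]\<close> and translates
  \<open>[1/2,1]\<close> by \<open>1/2\<close>, and its inverse doubles those in
  \<open>[3/2,2]\<close>; \<open>rot 1 1\<close> doubles those in \<open>[1,5/4]\<close> and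
  translates \<open>[5/4,3/2]\<close> by \<open>1/4\<close>. A standard interval of length at most
  \<open>1/4\<close> lies in one of these zones, and a few moves double its length, so conjugation
  leads back to the top levels.\<close>

lemma small_rots_generate:
  assumes K: "subgrp K" and s: "small_rots \<subseteq> K"
  shows "rots_in K 0 2"
proof -
  have base: "rot v m \<in> K" if v: "std v m" "0 \<le> v" "v + m \<le> 2" and d: "m = 2 / 2 ^ d" "d \<le> 2" for v m d
  proof -
    obtain j e :: int where e: "m = 2 powi e" "v = of_int j * m" using v(1) std_def by blast
    have m: "m > 0" using std_pos[OF v(1)] .
    have "j \<ge> 0" using v(2) m e by (simp add: zero_le_mult_iff)
    have "2 ^ d * m = 2" unfolding d(1) by simp
    moreover have "(of_int j + 1) * m = v + m" unfolding e(2) by (simp add: distrib_right)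
    ultimately have "(of_int j + 1) * m \<le> 2 ^ d * m" using v(3) by linarith
    then have "of_int j + 1 \<le> (2::real) ^ d" using m by simp
    then have "j + 1 \<le> 2 ^ d" 
    proof -
      have "real_of_int (j + 1) \<le> real_of_int (2 ^ d)" using \<open>of_int j + 1 \<le> (2::real) ^ d\<close> by simp
      then show ?thesis by (simp only: of_int_le_iff)
    qed
    then have "nat j < 2 ^ d" using \<open>j \<ge> 0\<close> by (simp add: nat_less_iff)
    moreover have "v = real (nat j) * (2 / 2 ^ d)" using e d \<open>j \<ge> 0\<close> by simp
    ultimately have "rot v m \<in> small_rots" unfolding small_rots_def
      using d by (intro image_eqI[of _ _ "(d, nat j)"]) auto
    then show ?thesis using s by blast
  qed
  \<comment> \<open>The boundaries of the zones are multiples of \<open>1/4\<close>, hence grid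
    points for every mesh up to \<open>1/4\<close>, and no short standard interval straddles
    one.\<close>
  have s1: "std c (2 powi e)" if "e \<le> -2" "c = of_int i / 4" for c i and e :: int
    by (rule std_coarse_mult[OF _ that(1)]) (use that(2) in \<open>auto simp: std_def power_int_minus intro!: exI[of _ "-2::int"]\<close>)
  have x: "rot 0 2 \<in> K" by (rule base[of 0 2 0]) (auto simp: std_def intro!: exI[of _ 0] exI[of _ 1])
  have y: "rot 1 1 \<in> K" by (rule base[of 1 1 1]) (auto simp: std_def intro!: exI[of _ 1] exI[of _ 0])
  have step: "rot v m \<in> K" if v: "std v m" "0 \<le> v" "v + m \<le> 2" and m: "m \<le> 1/4"
    and IH: "\<And>v. std v (2 * m) \<Longrightarrow> 0 \<le> v \<Longrightarrow> v + 2 * m \<le> 2 \<Longrightarrow> rot v (2 * m) \<in> K" for v m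
  proof -
    have mp: "m > 0" using std_pos[OF v(1)] .
    obtain e :: int where e: "m = 2 powi e" using v(1) std_def by blast
    have "(2::real) powi e \<le> 2 powi (-2)" using m unfolding e by (simp add: power_int_minus)
    then have e2: "e \<le> -2" unfolding powi2_le_iff .
    have e3: "2 * m = 2 powi (e + 1)" unfolding e by (simp add: power_int_add)
    have sep: "v' + m \<le> of_int i / 4 \<or> of_int i / 4 \<le> v'" if "std v' m" for v' and i :: int
      by (rule std_separated[OF that]) (unfold e, rule s1[OF e2 refl])
    have one: "std (of_int i) (2 * m)" for i :: int
    proof -
      have "std (of_int i) (2 powi 0)" unfolding std_def by (intro exI[of _ i] exI[of _ 0]) simp
      then show ?thesis unfolding e3 by (rule std_coarse_mult) (use e2 in simp)
    qed
    have dbl: "std (2 * v' + of_int i) (2 * m)" if "std v' m" for v' and i :: int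
      by (rule std_double[OF that one])
    have tr: "std (v' + of_int i / 4) m" if vs: "std v' m" for v' and i :: int
    proof -
      obtain j :: int where j: "v' = of_int j * m" using vs std_def by blast
      have "std (of_int i / 4) m" unfolding e by (rule s1[OF e2 refl])
      then obtain j' :: int where j': "of_int i / 4 = of_int j' * m" unfolding std_def by blast
      have "v' + of_int i / 4 = of_int (j + j') * m" unfolding j' j by (simp add: distrib_right)
      then show ?thesis unfolding std_def using e by blast
    qed
    note X = affm_rot[of 2 0, simplified] and Y = affm_rot[of 1 1, simplified]
    have c5: "rot v m \<in> K" if v: "std v m" "3/2 \<le> v" "v + m \<le> 2" for v
    proof -
      have "affm (finv (rot 0 2)) (3/2) (1/2) 1 1"
        by (rule affm_inv) (use X(3) subgrpD(1)[OF K x] in auto)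
      from affm_sub[OF this, of v m] have "affm (finv (rot 0 2)) v m (2 * v + of_int (-2)) (2 * m)"
        using v mp by (simp add: algebra_simps)
      then show ?thesis
        by (rule conj_rot_mem[OF K subgrpD(4)[OF K x]]) (use mp v IH[OF dbl[OF v(1), of "-2"]] in auto)
    qed
    have c3: "rot v m \<in> K" if v: "std v m" "1 \<le> v" "v + m \<le> 5/4" for v
    proof -
      from affm_sub[OF Y(1), of v m] have "affm (rot 1 1) v m (2 * v + of_int (-1)) (2 * m)"
        using v mp by (simp add: algebra_simps)
      then show ?thesis
        by (rule conj_rot_mem[OF K y]) (use mp v IH[OF dbl[OF v(1), of "-1"]] in auto)
    qed
    have c4: "rot v m \<in> K" if v: "std v m" "5/4 \<le> v" "v + m \<le> 3/2" for v
    proof -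
      from affm_sub[OF Y(2), of v m] have "affm (rot 1 1) v m (v + of_int 1 / 4) m"
        using v mp by (simp add: algebra_simps)
      then show ?thesis
        by (rule conj_rot_mem[OF K y]) (use mp v c5[OF tr[OF v(1), of 1]] in auto)
    qed
    have c34: "rot v m \<in> K" if v: "std v m" "1 \<le> v" "v + m \<le> 3/2" for v
      using sep[OF v(1), of 5] c3[of v] c4[of v] v by auto
    have c2: "rot v m \<in> K" if v: "std v m" "1/2 \<le> v" "v + m \<le> 1" for v
    proof -
      from affm_sub[OF X(2), of v m] have "affm (rot 0 2) v m (v + of_int 2 / 4) m"
        using v mp by (simp add: algebra_simps)
      then show ?thesis
        by (rule conj_rot_mem[OF K x]) (use mp v c34[OF tr[OF v(1), of 2]] in auto)
    qed
    have c1: "rot v m \<in> K" if v: "std v m" "0 \<le> v" "v + m \<le> 1/2" for v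
    proof -
      from affm_sub[OF X(1), of v m] have "affm (rot 0 2) v m (2 * v + of_int 0) (2 * m)"
        using v mp by (simp add: algebra_simps)
      then show ?thesis
        by (rule conj_rot_mem[OF K x]) (use mp v IH[OF dbl[OF v(1), of 0]] in auto)
    qed
    show ?thesis using sep[OF v(1), of 2] sep[OF v(1), of 4] sep[OF v(1), of 6] c1[of v] c2[of v] c34[of v] c5[of v] v
      by auto
  qed
  have main: "std v (2 / 2 ^ d) \<Longrightarrow> 0 \<le> v \<Longrightarrow> v + 2 / 2 ^ d \<le> 2 \<Longrightarrow> rot v (2 / 2 ^ d) \<in> K" for v d
  proof (induction d arbitrary: v)
    case 0
    show ?case by (rule base[of v _ 0]) (use 0 in auto)
  next
    case (Suc d)
    show ?case
    proof (cases "Suc d \<le> 2")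
      case True then show ?thesis using base[of v _ "Suc d"] Suc.prems by blast
    next
      case False
      then have "(2::real) ^ 3 \<le> 2 ^ Suc d" by (intro power_increasing) auto
      then have q: "2 / 2 ^ Suc d \<le> (1/4::real)" by (simp add: field_simps)
      have d: "2 * (2 / 2 ^ Suc d) = (2 / 2 ^ d :: real)" by simp
      show ?thesis by (rule step[OF Suc.prems q]) (unfold d, rule Suc.IH)
    qed
  qed
  show ?thesis unfolding rots_in_def
  proof (intro allI impI, elim conjE)
    fix v m assume v: "std v m" "0 \<le> v" "v + m \<le> 0 + 2"
    obtain e :: int where e: "m = 2 powi e" using v(1) std_def by blast
    have "m \<le> 2" using v by simp
    then have "(2::real) powi e \<le> 2 powi 1" unfolding e by simp
    then have "e \<le> 1" unfolding powi2_le_iff .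
    then have "e = 1 - int (nat (1 - e))" by simp
    then have "m = 2 powi (1 - int (nat (1 - e)))" using e by simp
    also have "\<dots> = 2 / 2 ^ nat (1 - e)" 
    proof -
      have "(2::real) powi (1 - int n) = 2 / 2 ^ n" for n by (simp add: power_int_diff)
      then show ?thesis .
    qed
    finally have "m = 2 / 2 ^ nat (1 - e)" .
    then show "rot v m \<in> K" using main[of v "nat (1 - e)"] v by simp
  qed
qed

lemma small_rots_generate_Fsup: "subgrp K \<Longrightarrow> small_rots \<subseteq> K \<Longrightarrow> Fsup 0 2 \<subseteq> K"
  using Fsup_generated small_rots_generate by blast

lemma small_rots_Fsup: "small_rots \<subseteq> Fsup 0 2"
proof
  fix r assume "r \<in> small_rots"
  then obtain d k where dk: "k < 2 ^ d" "r = rot (real k * (2 / 2 ^ d)) (2 / 2 ^ d)"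
    unfolding small_rots_def by auto
  have "(2::real) / 2 ^ d = 2 powi (1 - int d)" by (simp add: power_int_diff)
  then have "std (real k * (2 / 2 ^ d)) (2 / 2 ^ d)" unfolding std_def
    by (intro exI[of _ "int k"] exI[of _ "1 - int d"]) simp
  then have "r \<in> Fsup (real k * (2 / 2 ^ d)) (real k * (2 / 2 ^ d) + 2 / 2 ^ d)"
    unfolding dk(2) by (rule rot_std_Fsup)
  note r = this
  have "real k + 1 \<le> 2 ^ d" using dk(1) by (metis Suc_leI of_nat_Suc of_nat_le_iff of_nat_numeral of_nat_power add.commute)
  then have "(real k + 1) * (2 / 2 ^ d) \<le> 2 ^ d * (2 / 2 ^ d)" by (intro mult_right_mono) auto
  moreover have "(real k + 1) * (2 / 2 ^ d) = real k * (2 / 2 ^ d) + 2 / 2 ^ d" by (simp only: distrib_right mult_1)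
  moreover have "(2::real) ^ d * (2 / 2 ^ d) = 2" by simp
  ultimately have "real k * (2 / 2 ^ d) + 2 / 2 ^ d \<le> 2" by linarith
  then show "r \<in> Fsup 0 2" by (intro Fsup_mono[OF r]) auto
qed



section \<open>Lifts to the line\<close>

definition sh :: "int \<Rightarrow> (int \<Rightarrow> 'a) \<Rightarrow> int \<Rightarrow> 'a" where
  "sh k x = (\<lambda>i. x (i + k))"

definition agree :: "nat \<Rightarrow> (int \<Rightarrow> 'a) \<Rightarrow> (int \<Rightarrow> 'a) \<Rightarrow> bool" where
  "agree n x y \<longleftrightarrow> (\<forall>i. \<bar>i\<bar> \<le> int n \<longrightarrow> x i = y i)"

lemma sh_0 [simp]: "sh 0 x = x" by (simp add: sh_def)

lemma sh_sh [simp]: "sh j (sh k x) = sh (j + k) x" by (simp add: sh_def fun_eq_iff ac_simps)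

lemma sh_image_iff: "y \<in> sh k ` D \<longleftrightarrow> sh (- k) y \<in> D"
proof
  assume "y \<in> sh k ` D" then show "sh (- k) y \<in> D" by auto
next
  assume "sh (- k) y \<in> D" then have "sh k (sh (- k) y) \<in> sh k ` D" by blast
  then show "y \<in> sh k ` D" by simp
qed

lemma agree_refl [simp]: "agree n x x" by (simp add: agree_def)

lemma agree_sym: "agree n x y \<Longrightarrow> agree n y x" by (simp add: agree_def)

lemma agree_trans: "agree n x y \<Longrightarrow> agree n y z \<Longrightarrow> agree n x z" by (simp add: agree_def)

lemma agree_mono: "agree n x y \<Longrightarrow> m \<le> n \<Longrightarrow> agree m x y" by (simp add: agree_def)

lemma agree_sh: "agree (n + nat \<bar>k\<bar>) x y \<Longrightarrow> agree n (sh k x) (sh k y)"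
  by (auto simp: agree_def sh_def)

lemma PLloc_local:
  assumes "\<And>t. \<exists>h\<in>PL. \<exists>d>0. \<forall>s. \<bar>s - t\<bar> < d \<longrightarrow> f s = h s"
  shows "PLloc f"
  unfolding PLloc_def
proof
  fix t
  obtain h d where h: "h \<in> PL" "d > 0" "\<forall>s. \<bar>s - t\<bar> < d \<longrightarrow> f s = h s" using assms by blast
  have "PLloc h" using h(1) PL_def by blast
  then obtain e where e: "e > 0" "aff_on h {t-e..t}" "aff_on h {t..t+e}"
    "t \<in> dyadic_rationals \<or> aff_on h {t-e..t+e}" using PLlocE by metis
  define r where "r = min e (d / 2)"
  have r: "r > 0" "r \<le> e" "r < d" using e h by (auto simp: r_def min_def)
  have *: "aff_on f A" if "aff_on h B" "A \<subseteq> B" "A \<subseteq> {t-r..t+r}" for A B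
  proof (rule aff_on_cong[OF aff_on_subset[OF that(1,2)]])
    fix s assume "s \<in> A"
    then have "\<bar>s - t\<bar> \<le> r" using that(3) by (auto simp: abs_le_iff)
    then show "f s = h s" using h(3) r by auto
  qed
  have "aff_on f {t-r..t}" by (rule *[OF e(2)]) (use r in auto)
  moreover have "aff_on f {t..t+r}" by (rule *[OF e(3)]) (use r in auto)
  moreover have "aff_on f {t-r..t+r}" if "aff_on h {t-e..t+e}" by (rule *[OF that]) (use r in auto)
  ultimately show "\<exists>e>0. aff_on f {t-e..t} \<and> aff_on f {t..t+e} \<and> (t \<in> dyadic_rationals \<or> aff_on f {t-e..t+e})"
    using e(4) r(1) by blast
qed

text \<open>Conjugation by an integer translation, matching the identification of
  \<open>(x, t)\<close> with \<open>(sh j x, t - j)\<close> in the suspension.\<close>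

definition shiftf :: "int \<Rightarrow> (real \<Rightarrow> real) \<Rightarrow> real \<Rightarrow> real" where
  "shiftf j f = (\<lambda>t. f (t + of_int j) - of_int j)"

lemma finv_translate: "finv (\<lambda>t::real. t + c) = (\<lambda>t. t - c)"
  by (rule inv_equality) auto

lemma shiftf_Fc: assumes "f \<in> Fc a b" shows "shiftf j f \<in> Fc (a - of_int j) (b - of_int j)"
proof -
  define T :: "real \<Rightarrow> real" where "T = (\<lambda>t. t + - of_int j)"
  have T: "T \<in> PL" unfolding T_def by (intro PL_translate dyadic_uminus dyadic_of_int)
  have "finv T = (\<lambda>t. t - - of_int j)" unfolding T_def by (rule finv_translate)
  then have "T \<circ> f \<circ> finv T = shiftf j f" unfolding shiftf_def T_def by (simp add: fun_eq_iff)
  then show ?thesis using conj_Fc[OF assms T] by (simp add: T_def)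
qed

lemma shiftf_shiftf [simp]: "shiftf j (shiftf (- j) f) = f" "shiftf (- j) (shiftf j f) = f"
  by (simp_all add: shiftf_def fun_eq_iff)

text \<open>Consecutive windows overlap in length 1, so conjugation by an element supported in the
  last window pulls the right end of a support back into the interval covered before.\<close>

lemma Fc_generated_by_unit_steps:
  assumes K: "subgrp K"
  shows "(\<And>i. i \<le> m \<Longrightarrow> Fc (p + real i) (p + real i + 2) \<subseteq> K) \<Longrightarrow> Fc p (p + 2 + real m) \<subseteq> K"
proof (induction m)
  case 0 then show ?case using 0[of 0] by simp
next
  case (Suc m)
  have IH: "Fc p (p + 2 + real m) \<subseteq> K" using Suc by simp
  show ?case
  proof
    fix f assume "f \<in> Fc p (p + 2 + real (Suc m))"
    then obtain u v where uv: "p < u" "u < v" "v < p + 2 + real (Suc m)" "u \<in> dyadic_rationals"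
      "v \<in> dyadic_rationals" "f \<in> Fsup u v" by (rule FcE)
    show "f \<in> K"
    proof (cases "v < p + 2 + real m")
      case True
      then have "f \<in> Fc p (p + 2 + real m)" by (intro Fsup_subset_Fc[OF uv(6)]) (use uv in auto)
      then show ?thesis using IH by blast
    next
      case False
      \<comment> \<open>Left end of the last window \<open>(c, c + 2)\<close>; the interval of the
        induction hypothesis ends at \<open>c + 1\<close>.\<close>
      define c where "c = p + real (Suc m)"
      obtain w where w: "w \<in> dyadic_rationals" "c < w" "w < c + 1/2" using dyadic_dense[of c "c + 1/2"] by auto
      obtain v' where v': "v' \<in> dyadic_rationals" "w < v'" "v' < c + 1" using dyadic_dense[of w "c + 1"] w by auto
      have cv: "c + 1 \<le> v" "v < c + 2" using False uv by (auto simp: c_def)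
      obtain g where g: "g \<in> Fc c (c + 2)" "g w = w" "g v = v'"
        by (rule Fc_move[of w v w v' c "c + 2"]) (use w v' uv cv in auto)
      have gK: "g \<in> K" using Suc.prems[of "Suc m"] g(1) by (auto simp: c_def)
      have gP: "g \<in> PL" using Fc_PL[OF g(1)] .
      have "g \<in> Fc p (c + 2)" by (rule Fc_mono[OF g(1)]) (auto simp: c_def)
      then have "p < g u" using Fc_inside(1)[of g p "c + 2" u] uv(1) by simp
      moreover have "g v < p + 2 + real m" using g(3) v' by (simp add: c_def)
      ultimately have "g \<circ> f \<circ> finv g \<in> Fc p (p + 2 + real m)"
        by (intro Fsup_subset_Fc[OF conj_Fsup[OF uv(6) gP]]) auto
      then have "g \<circ> f \<circ> finv g \<in> K" using IH by blast
      then have "finv g \<circ> (g \<circ> f \<circ> finv g) \<circ> g \<in> K"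
        using subgrpD(3)[OF K subgrpD(3)[OF K subgrpD(4)[OF K gK]] gK] by blast
      moreover have "finv g \<circ> (g \<circ> f \<circ> finv g) \<circ> g = f" using PL_inv_eq[OF gP] by (simp add: fun_eq_iff)
      ultimately show ?thesis by (simp only:)
    qed
  qed
qed

section \<open>Families of line maps and copies of Thompson's group over a base\<close>

definition mulF :: "('x \<Rightarrow> real \<Rightarrow> real) \<Rightarrow> ('x \<Rightarrow> real \<Rightarrow> real) \<Rightarrow> 'x \<Rightarrow> real \<Rightarrow> real" where
  "mulF F G = (\<lambda>x. F x \<circ> G x)"

definition invF :: "('x \<Rightarrow> real \<Rightarrow> real) \<Rightarrow> 'x \<Rightarrow> real \<Rightarrow> real" where
  "invF F = (\<lambda>x. finv (F x))"

lemma mulF_apply: "mulF F G x t = F x (G x t)"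
  by (simp add: mulF_def)

lemma mulF_assoc: "mulF (mulF F G) H = mulF F (mulF G H)"
  by (simp add: mulF_def o_assoc)

text \<open>Its negation \<open>free D L\<close> says that the return time of \<open>D\<close> is at
  least \<open>L\<close>, so that open charts over \<open>D\<close> of height up to \<open>L\<close>
  are injective.\<close>

definition has_returns_before :: "(int \<Rightarrow> 'a) set \<Rightarrow> real \<Rightarrow> bool" where
  "has_returns_before D L \<longleftrightarrow> (\<exists>x\<in>D. \<exists>q::int. 1 \<le> q \<and> of_int q < L \<and> sh q x \<in> D)"

abbreviation free :: "(int \<Rightarrow> 'a) set \<Rightarrow> real \<Rightarrow> bool" where
  "free D L \<equiv> \<not> has_returns_before D L"

lemma freeD:
  assumes a: "free D L" "sh k x \<in> D" "sh k' x \<in> D" "\<bar>of_int k - of_int k'\<bar> < L"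
  shows "k = k'"
proof (rule ccontr)
  assume ne: "k \<noteq> k'"
  have *: False if h: "sh i x \<in> D" "sh j x \<in> D" "i < j" "of_int j - of_int i < L" for i j
  proof -
    have "sh (j - i) (sh i x) \<in> D" "1 \<le> j - i" "of_int (j - i) < L" using h by auto
    then show False using a(1) h(1) unfolding has_returns_before_def by blast
  qed
  show False using ne *[of k k'] *[of k' k] a(2-4) by (cases "k < k'") auto
qed

lemma free_mono: "free D L \<Longrightarrow> D' \<subseteq> D \<Longrightarrow> L' \<le> L \<Longrightarrow> free D' L'"
  unfolding has_returns_before_def by fastforce

lemma free_1: "L \<le> 1 \<Longrightarrow> free D L"
  unfolding has_returns_before_def by auto

lemma free_sh: assumes "free D L" shows "free (sh k ` D) L"
  unfolding has_returns_before_def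
proof (intro notI, elim bexE exE conjE)
  fix y :: "int \<Rightarrow> 'a" and q :: int assume a: "y \<in> sh k ` D" "1 \<le> q" "of_int q < L" "sh q y \<in> sh k ` D"
  then have "sh (- k) y \<in> D" "sh q (sh (- k) y) \<in> D" by (simp_all add: sh_image_iff add.commute)
  then show False using assms a(2,3) unfolding has_returns_before_def by blast
qed

text \<open>The local homeomorphism \<open>(x,t) \<mapsto> (x, f t)\<close> of the chart over \<open>D\<close>, lifted to the line.
  If \<open>f\<close> is supported in an interval shorter than the return time of \<open>D\<close>, the choice of \<open>k\<close> is unique.\<close>

definition emb :: "(int \<Rightarrow> 'a) set \<Rightarrow> (real \<Rightarrow> real) \<Rightarrow> (int \<Rightarrow> 'a) \<Rightarrow> real \<Rightarrow> real" where
  "emb D f x t = (if \<exists>k. sh k x \<in> D \<and> f (t - of_int k) \<noteq> t - of_int k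
     then (let k = (SOME k. sh k x \<in> D \<and> f (t - of_int k) \<noteq> t - of_int k) in of_int k + f (t - of_int k)) else t)"

text \<open>The definition of \<open>emb\<close> does not mention the interval of the chart. This
  rule and \<open>emb_in\<close> together recover the description by any interval
  \<open>(a,b)\<close> that contains the support and is no longer than the return time.\<close>

lemma emb_out:
  assumes "f \<in> Fc a b" "\<And>k. sh k x \<in> D \<Longrightarrow> a < t - of_int k \<Longrightarrow> t - of_int k < b \<Longrightarrow> False"
  shows "emb D f x t = t"
proof -
  have "\<not> (\<exists>k. sh k x \<in> D \<and> f (t - of_int k) \<noteq> t - of_int k)"
    using assms(2) Fc_outside[OF assms(1)] by (meson linorder_not_less)
  then show ?thesis unfolding emb_def by (simp only: if_False)
qed

lemma emb_in:
  assumes f: "f \<in> Fc a b" and fr: "free D (b - a)" and k: "sh k x \<in> D" "a < t - of_int k" "t - of_int k < b"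
  shows "emb D f x t = of_int k + f (t - of_int k)"
proof -
  \<comment> \<open>A visit at which \<open>f\<close> moves the point would compete with
    \<open>k\<close>; freeness leaves only \<open>k\<close> itself, so the choice operator has to
    return it.\<close>
  have u: "k' = k" if "sh k' x \<in> D" "f (t - of_int k') \<noteq> t - of_int k'" for k'
  proof -
    have "a < t - of_int k'" "t - of_int k' < b" using Fc_outside[OF f] that(2) by (meson linorder_not_less)+
    then have "\<bar>of_int k' - of_int k\<bar> < b - a" using k by linarith
    then show ?thesis using freeD[OF fr that(1) k(1)] by blast
  qed
  show ?thesis
  proof (cases "\<exists>k'. sh k' x \<in> D \<and> f (t - of_int k') \<noteq> t - of_int k'")
    case True
    then have "sh k x \<in> D \<and> f (t - of_int k) \<noteq> t - of_int k" using u by blast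
    then have "(SOME k. sh k x \<in> D \<and> f (t - of_int k) \<noteq> t - of_int k) = k" using u by (intro some_equality) auto
    then show ?thesis using True unfolding emb_def by (simp only: if_True Let_def)
  next
    case False
    then have "f (t - of_int k) = t - of_int k" using k by blast
    moreover have "emb D f x t = t" using False unfolding emb_def by (simp only: if_False)
    ultimately show ?thesis by simp
  qed
qed

lemma emb_mult:
  assumes f: "f \<in> Fc a b" and g: "g \<in> Fc a b" and fr: "free D (b - a)"
  shows "emb D (f \<circ> g) = mulF (emb D f) (emb D g)"
proof (intro ext)
  fix x t
  note fg = Fc_comp[OF f g]
  show "emb D (f \<circ> g) x t = mulF (emb D f) (emb D g) x t"
  proof (cases "\<exists>k. sh k x \<in> D \<and> a < t - of_int k \<and> t - of_int k < b")
    case True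
    then obtain k where k: "sh k x \<in> D" "a < t - of_int k" "t - of_int k < b" by blast
    have g1: "emb D g x t = of_int k + g (t - of_int k)" by (rule emb_in[OF g fr k])
    have "emb D f x (of_int k + g (t - of_int k)) = of_int k + f (of_int k + g (t - of_int k) - of_int k)"
      by (rule emb_in[OF f fr k(1)]) (use Fc_inside[OF g] k in auto)
    then show ?thesis unfolding emb_in[OF fg fr k] mulF_def comp_apply g1 by simp
  next
    case False
    have "emb D r x t = t" if "r \<in> Fc a b" for r by (rule emb_out[OF that]) (use False in blast)
    then show ?thesis using f g fg by (simp only: mulF_apply)
  qed
qed

lemma emb_id: "emb D id = (\<lambda>x. id)"
  by (simp add: emb_def fun_eq_iff)

lemma emb_finv_comp:
  assumes "f \<in> Fc a b" "free D (b - a)"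
  shows "emb D f x \<circ> emb D (finv f) x = id" "emb D (finv f) x \<circ> emb D f x = id"
proof -
  have "emb D (f \<circ> finv f) = mulF (emb D f) (emb D (finv f))"
    by (rule emb_mult[OF assms(1) Fc_inv[OF assms(1)] assms(2)])
  then have "mulF (emb D f) (emb D (finv f)) = (\<lambda>x. id)" by (simp only: PL_comp_inv(2)[OF Fc_PL[OF assms(1)]] emb_id)
  then show "emb D f x \<circ> emb D (finv f) x = id" unfolding mulF_def by meson
  have "emb D (finv f \<circ> f) = mulF (emb D (finv f)) (emb D f)"
    by (rule emb_mult[OF Fc_inv[OF assms(1)] assms(1) assms(2)])
  then have "mulF (emb D (finv f)) (emb D f) = (\<lambda>x. id)" by (simp only: PL_comp_inv(1)[OF Fc_PL[OF assms(1)]] emb_id)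
  then show "emb D (finv f) x \<circ> emb D f x = id" unfolding mulF_def by meson
qed

lemma emb_inv:
  assumes "f \<in> Fc a b" "free D (b - a)"
  shows "emb D (finv f) = invF (emb D f)"
proof
  fix x show "emb D (finv f) x = invF (emb D f) x" unfolding invF_def
    by (rule inv_unique_comp[OF emb_finv_comp[OF assms], symmetric])
qed

text \<open>Freeness of the whole union ensures that columns over \<open>D\<close> never overlap
  columns over \<open>D'\<close>.\<close>

lemma emb_union:
  assumes f: "f \<in> Fc a b" and fr: "free (D \<union> D') (b - a)" and dj: "D \<inter> D' = {}"
  shows "emb (D \<union> D') f = mulF (emb D f) (emb D' f)"
proof (intro ext)
  fix x t
  have fr1: "free D (b - a)" and fr2: "free D' (b - a)" using free_mono[OF fr] by auto
  show "emb (D \<union> D') f x t = mulF (emb D f) (emb D' f) x t"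
  proof (cases "\<exists>k. sh k x \<in> D \<union> D' \<and> a < t - of_int k \<and> t - of_int k < b")
    case True
    then obtain k where k: "sh k x \<in> D \<union> D'" "a < t - of_int k" "t - of_int k < b" by blast
    have u: "k' = k" if "sh k' x \<in> D \<union> D'" "a < s - of_int k'" "s - of_int k' < b" "a < s - of_int k" "s - of_int k < b" for k' s
      by (rule freeD[OF fr that(1) k(1)]) (use that in linarith)
    define s where "s = of_int k + f (t - of_int k)"
    have s: "a < s - of_int k" "s - of_int k < b" using k Fc_inside[OF f] by (auto simp: s_def)
    have e: "emb (D \<union> D') f x t = s" using emb_in[OF f fr k] by (simp add: s_def)
    show ?thesis
    proof (cases "sh k x \<in> D")
      case True
      then have "sh k x \<notin> D'" using dj by blast
      then have "emb D' f x t = t" by (intro emb_out[OF f]) (use u k in blast)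
      then show ?thesis unfolding e mulF_def using emb_in[OF f fr1 True k(2,3)] by (simp add: s_def)
    next
      case False
      then have D': "sh k x \<in> D'" using k by blast
      have "emb D f x s = s" by (intro emb_out[OF f]) (use u s False in blast)
      then show ?thesis unfolding e mulF_def using emb_in[OF f fr2 D' k(2,3)] by (simp add: s_def)
    qed
  next
    case False
    have "emb D f x t = t" "emb D' f x t = t" "emb (D \<union> D') f x t = t"
      by (intro emb_out[OF f]; use False in blast)+
    then show ?thesis by (simp add: mulF_def)
  qed
qed

text \<open>Since \<open>[x,t] = [sh j x, t - j]\<close>, a chart over \<open>D\<close> is also a
  chart over the image of \<open>D\<close> under \<open>sh j\<close>, with translated times.\<close>

lemma emb_shift:
  assumes f: "f \<in> Fc a b" and fr: "free D (b - a)"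
  shows "emb (sh j ` D) (shiftf j f) = emb D f"
proof (intro ext)
  fix x t
  note sf = shiftf_Fc[OF f, of j]
  have fr': "free (sh j ` D) (b - of_int j - (a - of_int j))" using free_sh[OF fr] by simp
  show "emb (sh j ` D) (shiftf j f) x t = emb D f x t"
  proof (cases "\<exists>k. sh k x \<in> D \<and> a < t - of_int k \<and> t - of_int k < b")
    case True
    then obtain k where k: "sh k x \<in> D" "a < t - of_int k" "t - of_int k < b" by blast
    have "emb (sh j ` D) (shiftf j f) x t = of_int (j + k) + shiftf j f (t - of_int (j + k))"
      by (rule emb_in[OF sf fr']) (use k in \<open>auto simp: sh_image_iff\<close>)
    then show ?thesis unfolding emb_in[OF f fr k] shiftf_def by simp
  next
    case False
    have "emb (sh j ` D) (shiftf j f) x t = t"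
    proof (rule emb_out[OF sf])
      fix k assume "sh k x \<in> sh j ` D" "a - of_int j < t - of_int k" "t - of_int k < b - of_int j"
      then have "sh (k - j) x \<in> D" "a < t - of_int (k - j)" "t - of_int (k - j) < b"
        by (auto simp: sh_image_iff)
      then show False using False by blast
    qed
    moreover have "emb D f x t = t" by (rule emb_out[OF f]) (use False in blast)
    ultimately show ?thesis by simp
  qed
qed

text \<open>In the columns over \<open>D'\<close> both sides act by \<open>g \<circ> c\<close>; in
  the remaining columns over \<open>D\<close> both act by \<open>g\<close>.\<close>

lemma emb_conj:
  assumes g: "g \<in> Fc a b" and c: "c \<in> Fc a b" and fr: "free D (b - a)" and sub: "D' \<subseteq> D"
  shows "mulF (emb D g) (emb D' c) = mulF (emb D' (g \<circ> c \<circ> finv g)) (emb D g)"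
proof (intro ext)
  fix x t
  have gc: "g \<circ> c \<circ> finv g \<in> Fc a b" by (intro Fc_comp Fc_inv g c)
  have fr': "free D' (b - a)" using free_mono[OF fr sub] by simp
  show "mulF (emb D g) (emb D' c) x t = mulF (emb D' (g \<circ> c \<circ> finv g)) (emb D g) x t"
  proof (cases "\<exists>k. sh k x \<in> D \<and> a < t - of_int k \<and> t - of_int k < b")
    case True
    then obtain k where k: "sh k x \<in> D" "a < t - of_int k" "t - of_int k < b" by blast
    have u: "k' = k" if "sh k' x \<in> D" "a < s - of_int k'" "s - of_int k' < b" "a < s - of_int k" "s - of_int k < b" for k' s
      by (rule freeD[OF fr that(1) k(1)]) (use that in linarith)
    have G: "emb D g x (of_int k + s) = of_int k + g s" if "a < s" "s < b" for s
      using emb_in[OF g fr k(1), of "of_int k + s"] that by simp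
    define s where "s = t - of_int k"
    have t: "t = of_int k + s" and s: "a < s" "s < b" using k by (auto simp: s_def)
    have gs: "a < g s" "g s < b" using Fc_inside[OF g] s by auto
    show ?thesis
    proof (cases "sh k x \<in> D'")
      case True
      have "emb D' c x t = of_int k + c s" using emb_in[OF c fr' True k(2,3)] by (simp add: s_def)
      moreover have "a < c s" "c s < b" using Fc_inside[OF c] s by auto
      moreover have "emb D' (g \<circ> c \<circ> finv g) x (of_int k + g s) = of_int k + (g \<circ> c \<circ> finv g) (g s)"
        using emb_in[OF gc fr' True, of "of_int k + g s"] gs by simp
      ultimately show ?thesis unfolding mulF_def comp_apply t using G s PL_inv_eq[OF Fc_PL[OF g]] by simp
    next
      case False
      have "emb D' c x t = t" by (rule emb_out[OF c]) (use u sub False k in blast)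
      moreover have "emb D' (g \<circ> c \<circ> finv g) x (of_int k + g s) = of_int k + g s"
      proof (rule emb_out[OF gc])
        fix k' assume k': "sh k' x \<in> D'" "a < of_int k + g s - of_int k'" "of_int k + g s - of_int k' < b"
        then have "k' = k" by (intro u[OF _ k'(2,3)]) (use sub gs in auto)
        then show False using False k' by blast
      qed
      ultimately show ?thesis unfolding mulF_def comp_apply using G[OF s] by (simp add: t)
    qed
  next
    case False
    have "emb X r x t = t" if "r \<in> Fc a b" "X \<subseteq> D" for r X
      by (rule emb_out[OF that(1)]) (use False that(2) in blast)
    then show ?thesis using g c gc sub by (simp only: mulF_apply order_refl)
  qed
qed

text \<open>A chart of height at most 1 never overlaps its translates, so no freeness is needed here.
  Commutators turn intersections of bases into group elements.\<close>

lemma emb_commutator: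
  assumes p: "p \<in> Fc c (c + 1)" and q: "q \<in> Fc c (c + 1)"
  shows "mulF (mulF (mulF (emb D p) (emb D' q)) (emb D (finv p))) (emb D' (finv q)) = emb (D \<inter> D') (cmt p q)"
proof (intro ext)
  fix x t
  have fr: "free X (c + 1 - c)" for X :: "(int \<Rightarrow> 'a) set" by (rule free_1) simp
  note pi = Fc_inv[OF p] and qi = Fc_inv[OF q]
  have cm: "cmt p q \<in> Fc c (c + 1)" unfolding cmt_def by (intro Fc_comp Fc_inv p q)
  show "mulF (mulF (mulF (emb D p) (emb D' q)) (emb D (finv p))) (emb D' (finv q)) x t = emb (D \<inter> D') (cmt p q) x t"
  proof (cases "\<exists>k. c < t - of_int k \<and> t - of_int k < c + 1")
    case True
    then obtain k where k: "c < t - of_int k" "t - of_int k < c + 1" by blast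
    define s where "s = t - of_int k"
    have t: "t = of_int k + s" and s: "c < s" "s < c + 1" using k by (auto simp: s_def)
    \<comment> \<open>In the window from \<open>c + k\<close> to \<open>c + k + 1\<close> each
      factor acts through its map or not at all, depending on whether \<open>sh k x\<close> lies in
      its base. If one of the two bases is missed, the commutator collapses to the identity.\<close>
    have E: "emb X r x (of_int k + w) = of_int k + (if sh k x \<in> X then r w else w)"
      if r: "r \<in> Fc c (c + 1)" and w: "c < w" "w < c + 1" for X r w
    proof (cases "sh k x \<in> X")
      case True
      then show ?thesis using emb_in[OF r fr True, of "of_int k + w"] w by simp
    next
      case False
      have "emb X r x (of_int k + w) = of_int k + w"
      proof (rule emb_out[OF r])
        fix k' assume k': "sh k' x \<in> X" "c < of_int k + w - of_int k'" "of_int k + w - of_int k' < c + 1"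
        then have "of_int k' < (of_int (k + 1) :: real)" "of_int k < (of_int (k' + 1) :: real)" using w by simp_all
        then have "k' = k" unfolding of_int_less_iff by linarith
        then show False using False k' by blast
      qed
      then show ?thesis using False by simp
    qed
    have ins: "c < r w \<and> r w < c + 1" if "r \<in> Fc c (c + 1)" "c < w" "w < c + 1" for r w
      using Fc_inside[OF that(1)] that by blast
    have i1: "c < finv q s \<and> finv q s < c + 1" by (rule ins[OF qi s])
    have i2: "c < finv p w \<and> finv p w < c + 1" if "c < w \<and> w < c + 1" for w by (rule ins[OF pi]) (use that in auto)
    have i3: "c < q w \<and> q w < c + 1" if "c < w \<and> w < c + 1" for w by (rule ins[OF q]) (use that in auto)
    note inv = PL_inv_eq[OF Fc_PL[OF p]] PL_inv_eq[OF Fc_PL[OF q]]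
    show ?thesis
      unfolding t E[OF cm s] mulF_def comp_apply
      using s i1 i2 i3 by (simp add: E[OF p] E[OF q] E[OF pi] E[OF qi] cmt_def inv)
  next
    case False
    have "emb X r x t = t" if "r \<in> Fc c (c + 1)" for r and X :: "(int \<Rightarrow> 'a) set"
      by (rule emb_out[OF that]) (use False in blast)
    then show ?thesis using p q pi qi cm by (simp only: mulF_apply)
  qed
qed

lemma emb_equivariant:
  assumes f: "f \<in> Fc a b" and fr: "free D (b - a)"
  shows "emb D f (sh k x) t = emb D f x (t + of_int k) - of_int k"
proof (cases "\<exists>j. sh j (sh k x) \<in> D \<and> a < t - of_int j \<and> t - of_int j < b")
  case True
  then obtain j where j: "sh j (sh k x) \<in> D" "a < t - of_int j" "t - of_int j < b" by blast
  have "emb D f x (t + of_int k) = of_int (j + k) + f (t + of_int k - of_int (j + k))"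
    by (rule emb_in[OF f fr]) (use j in auto)
  then show ?thesis unfolding emb_in[OF f fr j] by simp
next
  case False
  have "emb D f x (t + of_int k) = t + of_int k"
  proof (rule emb_out[OF f])
    fix j assume j: "sh j x \<in> D" "a < t + of_int k - of_int j" "t + of_int k - of_int j < b"
    then have "sh (j - k) (sh k x) \<in> D" "a < t - of_int (j - k)" "t - of_int (j - k) < b" by auto
    then show False using False by blast
  qed
  moreover have "emb D f (sh k x) t = t" by (rule emb_out[OF f]) (use False in blast)
  ultimately show ?thesis by simp
qed

lemma emb_displacement:
  assumes f: "f \<in> Fc a b" and fr: "free D (b - a)" and ab: "a < b"
  shows "\<bar>emb D f x t - t\<bar> \<le> b - a"
proof (cases "\<exists>j. sh j x \<in> D \<and> a < t - of_int j \<and> t - of_int j < b")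
  case True
  then obtain j where j: "sh j x \<in> D" "a < t - of_int j" "t - of_int j < b" by blast
  have "a < f (t - of_int j)" "f (t - of_int j) < b" using Fc_inside[OF f] j by auto
  then show ?thesis unfolding emb_in[OF f fr j] using j by linarith
next
  case False
  have "emb D f x t = t" by (rule emb_out[OF f]) (use False in blast)
  then show ?thesis using ab by simp
qed

text \<open>The support of \<open>f\<close> stays away from the ends of \<open>(a,b)\<close>, so a
  point outside all columns has a neighbourhood on which the map is the identity.\<close>

lemma emb_PL:
  assumes f: "f \<in> Fc a b" and fr: "free D (b - a)"
  shows "emb D f x \<in> PL"
proof -
  obtain u v where uv: "a < u" "u < v" "v < b" "f \<in> Fsup u v" using FcE[OF f] by metis
  have fuv: "emb D f x s = s" if "\<And>k. sh k x \<in> D \<Longrightarrow> u < s - of_int k \<Longrightarrow> s - of_int k < v \<Longrightarrow> False" for s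
  proof (cases "\<exists>k. sh k x \<in> D \<and> a < s - of_int k \<and> s - of_int k < b")
    case True
    then obtain k where k: "sh k x \<in> D" "a < s - of_int k" "s - of_int k < b" by blast
    have "\<not> (u < s - of_int k \<and> s - of_int k < v)" using that[OF k(1)] by blast
    then have "f (s - of_int k) = s - of_int k" by (intro Fsup_outside[OF uv(4)]) linarith
    then show ?thesis using emb_in[OF f fr k] by simp
  next
    case False show ?thesis by (rule emb_out[OF f]) (use False in blast)
  qed
  have "PLloc (emb D f x)"
  proof (rule PLloc_local)
    fix t
    show "\<exists>h\<in>PL. \<exists>d>0. \<forall>s. \<bar>s - t\<bar> < d \<longrightarrow> emb D f x s = h s"
    proof (cases "\<exists>k. sh k x \<in> D \<and> a < t - of_int k \<and> t - of_int k < b")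
      case True
      then obtain k where k: "sh k x \<in> D" "a < t - of_int k" "t - of_int k < b" by blast
      define h where "h = (\<lambda>t. t + of_int k) \<circ> f \<circ> (\<lambda>t. t + (- of_int k))"
      have "h \<in> PL" unfolding h_def by (intro PL_comp PL_translate dyadic_uminus dyadic_of_int Fc_PL[OF f])
      moreover have "emb D f x s = h s" if "\<bar>s - t\<bar> < min (t - of_int k - a) (b - (t - of_int k))" for s
      proof -
        have "emb D f x s = of_int k + f (s - of_int k)" by (rule emb_in[OF f fr k(1)]) (use that in linarith)+
        then show ?thesis by (simp add: h_def)
      qed
      moreover have "min (t - of_int k - a) (b - (t - of_int k)) > 0" using k by simp
      ultimately show ?thesis by blast
    next
      case False
      define d where "d = min (u - a) (b - v)"
      have "emb D f x s = s" if s: "\<bar>s - t\<bar> < d" for s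
      proof (rule fuv)
        fix k assume k: "sh k x \<in> D" "u < s - of_int k" "s - of_int k < v"
        then have "a < t - of_int k" "t - of_int k < b" using s by (auto simp: d_def)
        then show False using False k by blast
      qed
      moreover have "d > 0" using uv by (simp add: d_def)
      ultimately show ?thesis using PL_id(2) by (intro bexI[of _ "\<lambda>t. t"] exI[of _ d]) auto
    qed
  qed
  moreover have "surj (emb D f x)"
  proof (rule surjI)
    fix t show "emb D f x (emb D (finv f) x t) = t" using fun_cong[OF emb_finv_comp(1)[OF f fr, of x], of t] by simp
  qed
  ultimately show ?thesis unfolding PL_def by blast
qed

text \<open>The topology of the subshift reduced to finite windows: \<open>compactness\<close> is
  the finite subcover property for cylinders of arbitrary radius \<open>nn x\<close> around the
  points, and \<open>dense_orbits\<close> is minimality.\<close>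

locale minimal_shift =
  fixes S :: "(int \<Rightarrow> 'a) set"
  assumes nonempty: "S \<noteq> {}"
    and sh_closed: "x \<in> S \<Longrightarrow> sh k x \<in> S"
    and compactness: "\<exists>F. finite F \<and> F \<subseteq> S \<and> (\<forall>y\<in>S. \<exists>x\<in>F. agree (nn x) x y)"
    and aperiodic: "x \<in> S \<Longrightarrow> sh k x = x \<Longrightarrow> k = 0"
    and dense_orbits: "x \<in> S \<Longrightarrow> y \<in> S \<Longrightarrow> \<exists>k. agree n y (sh k x)"
begin

definition cyl :: "nat \<Rightarrow> (int \<Rightarrow> 'a) \<Rightarrow> (int \<Rightarrow> 'a) set" where
  "cyl n x = {y \<in> S. agree n x y}"

text \<open>One window decides membership for all points at once; on a compact \<open>S\<close> this
  amounts to being clopen in the topological sense.\<close>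

definition clopen :: "(int \<Rightarrow> 'a) set \<Rightarrow> bool" where
  "clopen D \<longleftrightarrow> D \<subseteq> S \<and> (\<exists>n. \<forall>x\<in>S. \<forall>y\<in>S. agree n x y \<longrightarrow> (x \<in> D \<longleftrightarrow> y \<in> D))"

lemma clopenE:
  assumes "clopen D"
  obtains n where "D \<subseteq> S" "\<And>x y. x \<in> S \<Longrightarrow> y \<in> S \<Longrightarrow> agree n x y \<Longrightarrow> x \<in> D \<longleftrightarrow> y \<in> D"
  using assms unfolding clopen_def by blast

lemma clopen_subset: "clopen D \<Longrightarrow> D \<subseteq> S" unfolding clopen_def by blast

lemma sh_iff: "sh k x \<in> S \<longleftrightarrow> x \<in> S"
  using sh_closed[of x k] sh_closed[of "sh k x" "- k"] by auto

lemma cyl_self: "x \<in> S \<Longrightarrow> x \<in> cyl n x" by (simp add: cyl_def)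

lemma cyl_subset: "cyl n x \<subseteq> S" by (auto simp: cyl_def)

lemma cyl_mono: "m \<le> n \<Longrightarrow> cyl n x \<subseteq> cyl m x" unfolding cyl_def using agree_mono by blast

lemma cyl_eq: "y \<in> cyl n x \<Longrightarrow> cyl n y = cyl n x"
  unfolding cyl_def using agree_trans agree_sym by blast

lemma clopen_cyl: "clopen (cyl n x)"
  unfolding clopen_def cyl_def using agree_trans agree_sym by (intro conjI exI[of _ n]) blast+

lemma clopen_empty: "clopen {}" unfolding clopen_def by blast

lemma clopen_Un: assumes "clopen A" "clopen B" shows "clopen (A \<union> B)"
proof -
  obtain n where n: "A \<subseteq> S" "\<And>x y. x \<in> S \<Longrightarrow> y \<in> S \<Longrightarrow> agree n x y \<Longrightarrow> x \<in> A \<longleftrightarrow> y \<in> A" using clopenE[OF assms(1)] by metis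
  obtain m where m: "B \<subseteq> S" "\<And>x y. x \<in> S \<Longrightarrow> y \<in> S \<Longrightarrow> agree m x y \<Longrightarrow> x \<in> B \<longleftrightarrow> y \<in> B" using clopenE[OF assms(2)] by metis
  have "x \<in> A \<union> B \<longleftrightarrow> y \<in> A \<union> B" if "x \<in> S" "y \<in> S" "agree (max n m) x y" for x y
    using n(2)[of x y] m(2)[of x y] that agree_mono[OF that(3), of n] agree_mono[OF that(3), of m] by simp
  then show ?thesis unfolding clopen_def using n(1) m(1) by blast
qed

lemma clopen_Int: assumes "clopen A" "clopen B" shows "clopen (A \<inter> B)"
proof -
  obtain n where n: "A \<subseteq> S" "\<And>x y. x \<in> S \<Longrightarrow> y \<in> S \<Longrightarrow> agree n x y \<Longrightarrow> x \<in> A \<longleftrightarrow> y \<in> A" using clopenE[OF assms(1)] by metis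
  obtain m where m: "B \<subseteq> S" "\<And>x y. x \<in> S \<Longrightarrow> y \<in> S \<Longrightarrow> agree m x y \<Longrightarrow> x \<in> B \<longleftrightarrow> y \<in> B" using clopenE[OF assms(2)] by metis
  have "x \<in> A \<inter> B \<longleftrightarrow> y \<in> A \<inter> B" if "x \<in> S" "y \<in> S" "agree (max n m) x y" for x y
    using n(2)[of x y] m(2)[of x y] that agree_mono[OF that(3), of n] agree_mono[OF that(3), of m] by simp
  then show ?thesis unfolding clopen_def using n(1) m(1) by blast
qed

lemma clopen_sh: assumes "clopen D" shows "clopen (sh k ` D)"
proof -
  obtain n where n: "D \<subseteq> S" "\<And>x y. x \<in> S \<Longrightarrow> y \<in> S \<Longrightarrow> agree n x y \<Longrightarrow> x \<in> D \<longleftrightarrow> y \<in> D" using clopenE[OF assms] by metis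
  have "x \<in> sh k ` D \<longleftrightarrow> y \<in> sh k ` D" if "x \<in> S" "y \<in> S" "agree (n + nat \<bar>k\<bar>) x y" for x y
    unfolding sh_image_iff using n(2)[of "sh (- k) x" "sh (- k) y"] agree_sh[of n "- k" x y] that sh_iff by simp
  moreover have "sh k ` D \<subseteq> S" using n(1) sh_iff by blast
  ultimately show ?thesis unfolding clopen_def by blast
qed

lemma finite_cylinders: "finite {cyl n x | x. x \<in> S}"
proof -
  obtain F where F: "finite F" "F \<subseteq> S" "\<forall>y\<in>S. \<exists>x\<in>F. agree n x y" using compactness[of "\<lambda>_. n"] by blast
  have "{cyl n x | x. x \<in> S} \<subseteq> cyl n ` F"
  proof
    fix C assume "C \<in> {cyl n x | x. x \<in> S}"
    then obtain y where y: "y \<in> S" "C = cyl n y" by blast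
    then obtain x where x: "x \<in> F" "agree n x y" using F by blast
    then have "y \<in> cyl n x" using y by (simp add: cyl_def)
    then show "C \<in> cyl n ` F" using x y cyl_eq by blast
  qed
  then show ?thesis using F(1) finite_subset by blast
qed

text \<open>A window that decides membership splits the set into finitely many disjoint cylinders,
  and it may be enlarged beyond any prescribed radius \<open>n1\<close>.\<close>

lemma clopen_cylinder_induct:
  assumes D: "clopen D" and empty: "P {}"
    and cyl: "\<And>n y. n \<ge> n1 \<Longrightarrow> y \<in> D \<Longrightarrow> cyl n y \<subseteq> D \<Longrightarrow> P (cyl n y)"
    and un: "\<And>A B. clopen A \<Longrightarrow> clopen B \<Longrightarrow> A \<union> B \<subseteq> D \<Longrightarrow> A \<inter> B = {} \<Longrightarrow> P A \<Longrightarrow> P B \<Longrightarrow> P (A \<union> B)"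
  shows "P D"
proof -
  obtain m where m: "D \<subseteq> S" "\<And>x y. x \<in> S \<Longrightarrow> y \<in> S \<Longrightarrow> agree m x y \<Longrightarrow> x \<in> D \<longleftrightarrow> y \<in> D" using clopenE[OF D] by metis
  define n where "n = max n1 m"
  define C where "C = cyl n ` D"
  have sub: "cyl n y \<subseteq> D" if "y \<in> D" for y
  proof
    fix z assume "z \<in> cyl n y"
    then have "z \<in> S" "agree m y z" using agree_mono[of n y z m] by (auto simp: cyl_def n_def)
    then show "z \<in> D" using m that by blast
  qed
  have "C \<subseteq> {cyl n x | x. x \<in> S}" unfolding C_def using m(1) by blast
  then have fin: "finite C" using finite_cylinders finite_subset by blast
  have "A \<subseteq> C \<Longrightarrow> clopen (\<Union>A) \<and> P (\<Union>A)" if "finite A" for A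
    using that
  proof (induction A rule: finite_induct)
    case empty then show ?case using assms(2) clopen_empty by simp
  next
    case (insert c A)
    then obtain y where y: "y \<in> D" "c = cyl n y" unfolding C_def by blast
    have IH: "clopen (\<Union>A)" "P (\<Union>A)" using insert by auto
    have "c \<inter> c' = {}" if c': "c' \<in> A" for c'
    proof -
      obtain y' where y': "c' = cyl n y'" using insert.prems c' unfolding C_def by blast
      have "c \<noteq> c'" using insert.hyps c' by blast
      have "z \<in> c \<Longrightarrow> z \<in> c' \<Longrightarrow> c = c'" for z unfolding y(2) y' using cyl_eq[of z n y] cyl_eq[of z n y'] by simp
      then show ?thesis using \<open>c \<noteq> c'\<close> by blast
    qed
    then have dj: "c \<inter> \<Union>A = {}" by blast
    have "c \<union> \<Union>A \<subseteq> D" using insert.prems sub unfolding C_def by blast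
    moreover have "P c" unfolding y(2) using cyl[of n y] y(1) sub by (simp add: n_def)
    moreover have "clopen c" unfolding y(2) by (rule clopen_cyl)
    ultimately have "P (c \<union> \<Union>A)" "clopen (c \<union> \<Union>A)"
      using un[of c "\<Union>A"] IH dj clopen_Un[of c "\<Union>A"] by simp_all
    then show ?case by simp
  qed
  then have "P (\<Union>C)" using fin by blast
  moreover have "\<Union>C = D" unfolding C_def using sub cyl_self m(1) by blast
  ultimately show ?thesis by simp
qed

text \<open>The local-to-global principle of the development: by compactness one radius is small
  enough near all points, so the set is a finite disjoint union of cylinders to which
  \<open>small\<close> applies.\<close>

lemma clopen_induct:
  assumes D: "clopen D" and empty: "P {}"
    and small: "\<And>x. x \<in> D \<Longrightarrow> \<exists>n. \<forall>D'. clopen D' \<and> D' \<subseteq> D \<and> D' \<subseteq> cyl n x \<longrightarrow> P D'"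
    and un: "\<And>A B. clopen A \<Longrightarrow> clopen B \<Longrightarrow> A \<union> B \<subseteq> D \<Longrightarrow> A \<inter> B = {} \<Longrightarrow> P A \<Longrightarrow> P B \<Longrightarrow> P (A \<union> B)"
  shows "P D"
proof -
  obtain m where m: "D \<subseteq> S" "\<And>x y. x \<in> S \<Longrightarrow> y \<in> S \<Longrightarrow> agree m x y \<Longrightarrow> x \<in> D \<longleftrightarrow> y \<in> D" using clopenE[OF D] by metis
  obtain nn where nn: "\<And>x. x \<in> D \<Longrightarrow> \<forall>D'. clopen D' \<and> D' \<subseteq> D \<and> D' \<subseteq> cyl (nn x) x \<longrightarrow> P D'"
    using small by metis
  obtain F where F: "finite F" "F \<subseteq> S" "\<forall>y\<in>S. \<exists>x\<in>F. agree (max m (nn x)) x y"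
    using compactness[of "\<lambda>x. max m (nn x)"] by blast
  obtain n1 where n1: "\<forall>x\<in>F. nn x \<le> n1" using F(1) by (meson Max_ge finite_imageI image_eqI)
  show ?thesis
  proof (rule clopen_cylinder_induct[OF D empty _ un, of n1])
    fix n y assume n: "n \<ge> n1" and y: "y \<in> D" "cyl n y \<subseteq> D"
    obtain x where x: "x \<in> F" "agree (max m (nn x)) x y" using F(3) y m(1) by blast
    have "agree m x y" "agree (nn x) x y" using agree_mono[OF x(2)] by auto
    then have xD: "x \<in> D" using m(2)[of x y] x(1) F(2) y m(1) by blast
    have "cyl n y \<subseteq> cyl (nn x) x"
    proof
      fix z assume z: "z \<in> cyl n y"
      then have "agree (nn x) y z" using agree_mono[of n y z "nn x"] n1 x n by (auto simp: cyl_def)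
      then show "z \<in> cyl (nn x) x" using z agree_trans[OF \<open>agree (nn x) x y\<close>] by (auto simp: cyl_def)
    qed
    then show "P (cyl n y)" using nn[OF xD] clopen_cyl y(2) by blast
  qed
qed

text \<open>For each possible return time \<open>q\<close> some coordinate separates
  \<open>x\<close> from its shift by \<open>q\<close>. A window that sees these finitely many
  coordinates excludes every return before \<open>L\<close>.\<close>

lemma free_small:
  assumes "x \<in> S"
  shows "\<exists>n. free (cyl n x) L"
proof -
  define N where "N = nat \<lceil>L\<rceil>"
  have "\<exists>i. \<forall>q. 1 \<le> q \<longrightarrow> x (i q + q) \<noteq> x (i q)"
  proof -
    have "\<exists>i. x (i + q) \<noteq> x i" if "1 \<le> q" for q
    proof (rule ccontr)
      assume "\<nexists>i. x (i + q) \<noteq> x i"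
      then have "sh q x = x" by (simp add: sh_def fun_eq_iff)
      then show False using aperiodic[OF assms] that by force
    qed
    then show ?thesis by metis
  qed
  then obtain i :: "int \<Rightarrow> int" where i: "\<And>q. 1 \<le> q \<Longrightarrow> x (i q + q) \<noteq> x (i q)" by blast
  \<comment> \<open>The summand \<open>N\<close> makes room for the shifted coordinates
    \<open>i q + q\<close>.\<close>
  define n where "n = (\<Sum>q\<in>{1..int N}. nat \<bar>i q\<bar>) + N"
  have "free (cyl n x) L" unfolding has_returns_before_def
  proof (intro notI, elim bexE exE conjE)
    fix y and q :: int assume y: "y \<in> cyl n x" "sh q y \<in> cyl n x" and q: "1 \<le> q" "of_int q < L"
    have qN: "q \<in> {1..int N}" using q unfolding N_def by (auto simp: le_nat_iff) linarith
    then have "nat \<bar>i q\<bar> \<le> (\<Sum>q\<in>{1..int N}. nat \<bar>i q\<bar>)" by (intro member_le_sum) auto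
    then have "nat \<bar>i q\<bar> + N \<le> n" unfolding n_def by simp
    then have b: "\<bar>i q\<bar> \<le> int n" "\<bar>i q + q\<bar> \<le> int n" using qN by auto
    have "x (i q) = y (i q + q)" using y(2) b(1) by (simp add: cyl_def agree_def sh_def)
    moreover have "x (i q + q) = y (i q + q)" using y(1) b(2) by (simp add: cyl_def agree_def)
    ultimately show False using i[of q] q(1) by simp
  qed
  then show ?thesis by blast
qed

lemma free_cyl_mono: "free (cyl n x) L \<Longrightarrow> n \<le> m \<Longrightarrow> free (cyl m x) L"
  using free_mono cyl_mono by blast

lemma free_uniform: "\<exists>n. \<forall>x\<in>S. free (cyl n x) L"
proof -
  obtain nn where nn: "\<forall>x\<in>S. free (cyl (nn x) x) L"
    using bchoice[of S "\<lambda>x n. free (cyl n x) L"] free_small by blast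
  obtain F where F: "finite F" "F \<subseteq> S" "\<forall>y\<in>S. \<exists>x\<in>F. agree (nn x) x y" using compactness[of nn] by blast
  obtain n where n: "\<forall>x\<in>F. nn x \<le> n" using F(1) by (meson Max_ge finite_imageI image_eqI)
  have "free (cyl n y) L" if y: "y \<in> S" for y
  proof -
    obtain x where x: "x \<in> F" "agree (nn x) x y" using F y by blast
    then have "y \<in> cyl (nn x) x" using y by (simp add: cyl_def)
    then have "cyl (nn x) y = cyl (nn x) x" by (rule cyl_eq)
    then have "free (cyl (nn x) y) L" using nn x F by auto
    then show ?thesis using free_cyl_mono n x by blast
  qed
  then show ?thesis by blast
qed

text \<open>Minimality gives every point a hitting time that is valid on a whole cylinder around it,
  and finitely many of these cylinders cover \<open>S\<close>.\<close>

lemma recurrence: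
  assumes "clopen C" "C \<noteq> {}"
  obtains K :: nat where "\<And>x. x \<in> S \<Longrightarrow> \<exists>k. \<bar>k\<bar> \<le> int K \<and> sh k x \<in> C"
proof -
  obtain m where m: "C \<subseteq> S" "\<And>x y. x \<in> S \<Longrightarrow> y \<in> S \<Longrightarrow> agree m x y \<Longrightarrow> x \<in> C \<longleftrightarrow> y \<in> C" using clopenE[OF assms(1)] by metis
  obtain c where c: "c \<in> C" using assms(2) by blast
  have "\<exists>k. sh k x \<in> C" if x: "x \<in> S" for x
  proof -
    obtain k where "agree m c (sh k x)" using dense_orbits[OF x, of c m] c m(1) by blast
    then show ?thesis using m(2)[of c "sh k x"] c m(1) x sh_iff by blast
  qed
  then obtain kk where kk: "\<And>x. x \<in> S \<Longrightarrow> sh (kk x) x \<in> C" by metis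
  obtain F where F: "finite F" "F \<subseteq> S" "\<forall>y\<in>S. \<exists>x\<in>F. agree (m + nat \<bar>kk x\<bar>) x y"
    using compactness[of "\<lambda>x. m + nat \<bar>kk x\<bar>"] by blast
  obtain K where K: "\<forall>x\<in>F. nat \<bar>kk x\<bar> \<le> K" using F(1) by (meson Max_ge finite_imageI image_eqI)
  have "\<exists>k. \<bar>k\<bar> \<le> int K \<and> sh k y \<in> C" if y: "y \<in> S" for y
  proof -
    obtain x where x: "x \<in> F" "agree (m + nat \<bar>kk x\<bar>) x y" using F y by blast
    have xS: "x \<in> S" using x F by blast
    have "sh (kk x) y \<in> C" using m(2)[OF _ _ agree_sh[OF x(2)]] kk[OF xS] xS y sh_iff by blast
    moreover have "\<bar>kk x\<bar> \<le> int K" using K x(1) by (simp add: nat_le_iff)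
    ultimately show ?thesis by blast
  qed
  then show thesis using that by blast
qed

lemma hits_clopen: assumes "clopen C" "C \<noteq> {}" "x \<in> S" obtains k where "sh k x \<in> C"
  using recurrence[OF assms(1,2)] assms(3) by metis

text \<open>The orbits of the suspension flow are lines, since there are no periodic points. So an element of
  the group lifts uniquely to a family of homeomorphisms of the line, indexed by the points of the
  subshift, that is equivariant and locally constant uniformly on bounded sets of times.\<close>

definition lifts :: "(real \<Rightarrow> real) set \<Rightarrow> ((int \<Rightarrow> 'a) \<Rightarrow> real \<Rightarrow> real) set" where
  "lifts Q = {F. (\<forall>x. x \<notin> S \<longrightarrow> F x = id) \<and> (\<forall>x\<in>S. F x \<in> Q) \<and>
     (\<forall>x\<in>S. \<forall>k t. F (sh k x) t = F x (t + of_int k) - of_int k) \<and>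
     (\<forall>M::nat. \<exists>n. \<forall>x\<in>S. \<forall>y\<in>S. agree n x y \<longrightarrow> (\<forall>t. \<bar>t\<bar> \<le> M \<longrightarrow> F x t = F y t)) \<and>
     (\<exists>L::nat. \<forall>x\<in>S. \<forall>t. \<bar>F x t - t\<bar> \<le> L)}"

lemma liftsD:
  assumes "F \<in> lifts Q"
  shows "x \<notin> S \<Longrightarrow> F x = id" "x \<in> S \<Longrightarrow> F x \<in> Q"
    "x \<in> S \<Longrightarrow> F (sh k x) t = F x (t + of_int k) - of_int k"
    "\<exists>n. \<forall>x\<in>S. \<forall>y\<in>S. agree n x y \<longrightarrow> (\<forall>t. \<bar>t\<bar> \<le> real M \<longrightarrow> F x t = F y t)"
    "\<exists>L::nat. \<forall>x\<in>S. \<forall>t. \<bar>F x t - t\<bar> \<le> L"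
  using assms unfolding lifts_def by blast+

lemma lifts_equivariant: "F \<in> lifts Q \<Longrightarrow> x \<in> S \<Longrightarrow> F x t = of_int k + F (sh k x) (t - of_int k)"
  using liftsD(3)[of F Q x k "t - of_int k"] by simp

lemma lifts_one: "id \<in> Q \<Longrightarrow> (\<lambda>x. id) \<in> lifts Q"
  unfolding lifts_def by (auto intro: exI[of _ 0])

lemma lifts_mult:
  assumes Q: "\<And>f g. f \<in> Q \<Longrightarrow> g \<in> Q \<Longrightarrow> f \<circ> g \<in> Q" and F: "F \<in> lifts Q" and G: "G \<in> lifts Q"
  shows "mulF F G \<in> lifts Q"
proof -
  obtain K where K: "\<forall>x\<in>S. \<forall>t. \<bar>F x t - t\<bar> \<le> real K" using liftsD(5)[OF F] by blast
  obtain L where L: "\<forall>x\<in>S. \<forall>t. \<bar>G x t - t\<bar> \<le> real L" using liftsD(5)[OF G] by blast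
  show ?thesis unfolding lifts_def mulF_def
  proof (intro CollectI conjI allI ballI impI)
    show "F x \<circ> G x = id" if "x \<notin> S" for x using that liftsD(1)[OF F] liftsD(1)[OF G] by simp
    show "F x \<circ> G x \<in> Q" if "x \<in> S" for x using that Q liftsD(2)[OF F] liftsD(2)[OF G] by simp
    show "(F (sh k x) \<circ> G (sh k x)) t = (F x \<circ> G x) (t + of_int k) - of_int k" if "x \<in> S" for x k t
      using that by (simp add: liftsD(3)[OF F] liftsD(3)[OF G])
    show "\<exists>L::nat. \<forall>x\<in>S. \<forall>t. \<bar>(F x \<circ> G x) t - t\<bar> \<le> real L"
    proof (intro exI[of _ "K + L"] ballI allI)
      fix x t assume "x \<in> S"
      then have "\<bar>F x (G x t) - G x t\<bar> \<le> real K" "\<bar>G x t - t\<bar> \<le> real L" using K L by auto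
      then show "\<bar>(F x \<circ> G x) t - t\<bar> \<le> real (K + L)" unfolding comp_apply of_nat_add by linarith
    qed
    fix M :: nat
    obtain n where n: "\<forall>x\<in>S. \<forall>y\<in>S. agree n x y \<longrightarrow> (\<forall>t. \<bar>t\<bar> \<le> real M \<longrightarrow> G x t = G y t)"
      using liftsD(4)[OF G] by blast
    \<comment> \<open>\<open>G\<close> displaces times by at most \<open>L\<close>, so the window
      for \<open>F\<close> has to serve times up to \<open>M + L\<close>.\<close>
    obtain m where m: "\<forall>x\<in>S. \<forall>y\<in>S. agree m x y \<longrightarrow> (\<forall>t. \<bar>t\<bar> \<le> real (M + L) \<longrightarrow> F x t = F y t)"
      using liftsD(4)[OF F, of "M + L"] by (elim exE)
    show "\<exists>n. \<forall>x\<in>S. \<forall>y\<in>S. agree n x y \<longrightarrow> (\<forall>t. \<bar>t\<bar> \<le> real M \<longrightarrow> (F x \<circ> G x) t = (F y \<circ> G y) t)"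
    proof (intro exI[of _ "max n m"] ballI impI allI)
      fix x y t assume xy: "x \<in> S" "y \<in> S" "agree (max n m) x y" "\<bar>t\<bar> \<le> real M"
      have "G x t = G y t" using n[rule_format, OF xy(1,2) agree_mono[OF xy(3)] xy(4)] by simp
      moreover have "\<bar>G x t - t\<bar> \<le> real L" using L xy by blast
      then have "\<bar>G x t\<bar> \<le> real (M + L)" using xy(4) unfolding of_nat_add by linarith
      then have "F x (G x t) = F y (G x t)" by (intro m[rule_format, OF xy(1,2) agree_mono[OF xy(3)]]) auto
      ultimately show "(F x \<circ> G x) t = (F y \<circ> G y) t" by simp
    qed
  qed
qed

lemma lifts_inv:
  assumes Q: "\<And>f. f \<in> Q \<Longrightarrow> finv f \<in> Q" "\<And>f. f \<in> Q \<Longrightarrow> bij f" and F: "F \<in> lifts Q"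
  shows "invF F \<in> lifts Q"
proof -
  obtain L where L: "\<forall>x\<in>S. \<forall>t. \<bar>F x t - t\<bar> \<le> real L" using liftsD(5)[OF F] by blast
  have inv: "F x (finv (F x) t) = t" "finv (F x) (F x t) = t" if "x \<in> S" for x t
    using Q(2)[OF liftsD(2)[OF F that]] by (auto simp: bij_is_inj surj_f_inv_f bij_is_surj)
  have disp: "\<bar>finv (F x) t - t\<bar> \<le> real L" if "x \<in> S" for x t
    using bspec[OF L that, rule_format, of "finv (F x) t"] inv[OF that] by (simp add: abs_minus_commute)
  show ?thesis unfolding lifts_def invF_def
  proof (intro CollectI conjI allI ballI impI)
    show "finv (F x) = id" if "x \<notin> S" for x using that liftsD(1)[OF F] by simp
    show "finv (F x) \<in> Q" if "x \<in> S" for x using that Q liftsD(2)[OF F] by simp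
    show "finv (F (sh k x)) t = finv (F x) (t + of_int k) - of_int k" if "x \<in> S" for x k t
    proof -
      have "F (sh k x) (finv (F x) (t + of_int k) - of_int k) = t"
        using that by (simp add: liftsD(3)[OF F] inv)
      moreover have "sh k x \<in> S" using that sh_iff by blast
      ultimately show ?thesis using inv(2) by metis
    qed
    show "\<exists>L::nat. \<forall>x\<in>S. \<forall>t. \<bar>finv (F x) t - t\<bar> \<le> real L" using disp by blast
    fix M :: nat
    obtain m where m: "\<forall>x\<in>S. \<forall>y\<in>S. agree m x y \<longrightarrow> (\<forall>t. \<bar>t\<bar> \<le> real (M + L) \<longrightarrow> F x t = F y t)"
      using liftsD(4)[OF F, of "M + L"] by (elim exE)
    show "\<exists>n. \<forall>x\<in>S. \<forall>y\<in>S. agree n x y \<longrightarrow> (\<forall>t. \<bar>t\<bar> \<le> real M \<longrightarrow> finv (F x) t = finv (F y) t)"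
    proof (intro exI[of _ m] ballI impI allI)
      fix x y t assume xy: "x \<in> S" "y \<in> S" "agree m x y" "\<bar>t\<bar> \<le> real M"
      define s where "s = finv (F x) t"
      have "\<bar>s - t\<bar> \<le> real L" using disp xy s_def by blast
      then have "\<bar>s\<bar> \<le> real (M + L)" using xy(4) unfolding of_nat_add by linarith
      then have "F y s = F x s" by (intro m[rule_format, OF xy(1,2,3), symmetric])
      also have "\<dots> = t" using inv xy s_def by simp
      finally have "finv (F y) t = s" using inv(2)[OF xy(2), of s] by simp
      then show "finv (F x) t = finv (F y) t" by (simp add: s_def)
    qed
  qed
qed

text \<open>The set of allowed maps is \<open>PL\<close> here; the same families with values in all
  increasing homeomorphisms of the line return later, because the isotopy to the identity leaves
  \<open>PL\<close>.\<close>

abbreviation TL :: "((int \<Rightarrow> 'a) \<Rightarrow> real \<Rightarrow> real) set" where "TL \<equiv> lifts PL"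

lemma TL_mult: "F \<in> TL \<Longrightarrow> G \<in> TL \<Longrightarrow> mulF F G \<in> TL" by (rule lifts_mult[OF PL_comp])

lemma TL_inv: "F \<in> TL \<Longrightarrow> invF F \<in> TL" by (rule lifts_inv[OF PL_inv PL_bij])

lemma TL_one: "(\<lambda>x. id) \<in> TL" by (rule lifts_one) simp

lemma TL_PL: "F \<in> TL \<Longrightarrow> F x \<in> PL" using liftsD(1,2)[of F PL x] by (cases "x \<in> S") auto

lemma TL_inv_mult: "F \<in> TL \<Longrightarrow> mulF (invF F) F = (\<lambda>x. id)" "F \<in> TL \<Longrightarrow> mulF F (invF F) = (\<lambda>x. id)"
  unfolding mulF_def invF_def using PL_comp_inv[OF TL_PL] by auto

lemma emb_TL:
  assumes D: "clopen D" and f: "f \<in> Fc a b" and fr: "free D (b - a)"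
  shows "emb D f \<in> TL"
proof -
  have ab: "a < b" using FcE[OF f] by (metis less_trans)
  have DS: "D \<subseteq> S" using clopen_subset[OF D] .
  obtain m where m: "\<And>x y. x \<in> S \<Longrightarrow> y \<in> S \<Longrightarrow> agree m x y \<Longrightarrow> x \<in> D \<longleftrightarrow> y \<in> D" using clopenE[OF D] by metis
  show ?thesis unfolding lifts_def
  proof (intro CollectI conjI allI ballI impI)
    show "emb D f x = id" if "x \<notin> S" for x
    proof
      fix t show "emb D f x t = id t" using emb_out[OF f, of x D t] that DS sh_iff by auto
    qed
    show "emb D f x \<in> PL" if "x \<in> S" for x by (rule emb_PL[OF f fr])
    show "emb D f (sh k x) t = emb D f x (t + of_int k) - of_int k" if "x \<in> S" for x k t
      by (rule emb_equivariant[OF f fr])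
    have "\<forall>x\<in>S. \<forall>t. \<bar>emb D f x t - t\<bar> \<le> real (nat \<lceil>b - a\<rceil>)"
      using emb_displacement[OF f fr ab] ab by (meson order_trans real_nat_ceiling_ge)
    then show "\<exists>L::nat. \<forall>x\<in>S. \<forall>t. \<bar>emb D f x t - t\<bar> \<le> real L" by blast
    fix M :: nat
    \<comment> \<open>Bounds the visits \<open>k\<close> that can bring a time of modulus at most
      \<open>M\<close> into \<open>(a,b)\<close>.\<close>
    define k0 where "k0 = nat \<lceil>real M + \<bar>a\<bar> + \<bar>b\<bar>\<rceil>"
    have half: "emb D f x t = emb D f y t"
      if xy: "x \<in> S" "y \<in> S" "agree (m + k0) x y" "\<bar>t\<bar> \<le> real M" for x y t
    proof -
      have eq: "sh k x \<in> D \<longleftrightarrow> sh k y \<in> D" if k: "a < t - of_int k" "t - of_int k < b" for k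
      proof -
        have "\<bar>of_int k\<bar> \<le> real M + \<bar>a\<bar> + \<bar>b\<bar>" using k xy(4) by linarith
        then have "\<bar>k\<bar> \<le> int k0" unfolding k0_def by linarith
        then have "agree (m + nat \<bar>k\<bar>) x y" by (intro agree_mono[OF xy(3)]) simp
        then show ?thesis using m[OF _ _ agree_sh] xy(1,2) sh_iff by blast
      qed
      show ?thesis
      proof (cases "\<exists>k. sh k x \<in> D \<and> a < t - of_int k \<and> t - of_int k < b")
        case True
        then obtain k where k: "sh k x \<in> D" "a < t - of_int k" "t - of_int k < b" by blast
        then show ?thesis using emb_in[OF f fr k] emb_in[OF f fr, of k y t] eq by simp
      next
        case False
        have "emb D f x t = t" by (rule emb_out[OF f]) (use False in blast)
        moreover have "emb D f y t = t" by (rule emb_out[OF f]) (use False eq in blast)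
        ultimately show ?thesis by simp
      qed
    qed
    then show "\<exists>n. \<forall>x\<in>S. \<forall>y\<in>S. agree n x y \<longrightarrow> (\<forall>t. \<bar>t\<bar> \<le> real M \<longrightarrow> emb D f x t = emb D f y t)" by blast
  qed
qed

definition tsub :: "((int \<Rightarrow> 'a) \<Rightarrow> real \<Rightarrow> real) set \<Rightarrow> bool" where
  "tsub G \<longleftrightarrow> G \<subseteq> TL \<and> (\<lambda>x. id) \<in> G \<and> (\<forall>A\<in>G. \<forall>B\<in>G. mulF A B \<in> G) \<and> (\<forall>A\<in>G. invF A \<in> G)"

lemma tsubD:
  assumes "tsub G"
  shows "A \<in> G \<Longrightarrow> A \<in> TL" "(\<lambda>x. id) \<in> G" "A \<in> G \<Longrightarrow> B \<in> G \<Longrightarrow> mulF A B \<in> G" "A \<in> G \<Longrightarrow> invF A \<in> G"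
  using assms unfolding tsub_def by blast+

text \<open>For a fixed base this turns results on subgroups of \<open>PL\<close>, in particular
  perfectness and generation by rotations, into results on a group \<open>G\<close> of
  lifts.\<close>

lemma tsub_subgrp:
  assumes G: "tsub G" and fr: "free D (b - a)" and ab: "a < b"
  shows "subgrp {f \<in> Fc a b. emb D f \<in> G}"
  unfolding subgrp_def
proof (intro conjI ballI)
  show "{f \<in> Fc a b. emb D f \<in> G} \<subseteq> PL" using Fc_PL by blast
  have "emb D id \<in> G" by (subst emb_id) (rule tsubD(2)[OF G])
  then show "id \<in> {f \<in> Fc a b. emb D f \<in> G}" using Fc_id[OF ab] by blast
  show "f \<circ> g \<in> {f \<in> Fc a b. emb D f \<in> G}" if "f \<in> {f \<in> Fc a b. emb D f \<in> G}" "g \<in> {f \<in> Fc a b. emb D f \<in> G}" for f g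
    using that Fc_comp[of f a b g] emb_mult[of f a b g D] fr tsubD(3)[OF G] by auto
  show "finv f \<in> {f \<in> Fc a b. emb D f \<in> G}" if "f \<in> {f \<in> Fc a b. emb D f \<in> G}" for f
    using that Fc_inv[of f a b] emb_inv[of f a b D] fr tsubD(4)[OF G] by auto
qed

lemma emb_mem_union:
  assumes G: "tsub G" and f: "f \<in> Fc a b" and fr: "free (A \<union> B) (b - a)" and dj: "A \<inter> B = {}"
    and m: "emb A f \<in> G" "emb B f \<in> G"
  shows "emb (A \<union> B) f \<in> G"
  using emb_union[OF f fr dj] tsubD(3)[OF G m] by simp

lemma emb_empty: "emb {} f = (\<lambda>x. id)" by (simp add: emb_def fun_eq_iff)

text \<open>\<open>emb_conj\<close> solved for the copy of \<open>f\<close>: it suffices to treat a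
  conjugate of \<open>f\<close> with a more convenient support, once the conjugator is available
  over a base containing \<open>D'\<close>.\<close>

lemma emb_conj_mem:
  assumes G: "tsub G" and f: "f \<in> Fc a b" and g: "g \<in> Fc a b" and fr: "free D (b - a)" and sub: "D' \<subseteq> D"
    and m: "emb D g \<in> G" "emb D' (g \<circ> f \<circ> finv g) \<in> G"
  shows "emb D' f \<in> G"
proof -
  have "mulF (invF (emb D g)) (mulF (emb D' (g \<circ> f \<circ> finv g)) (emb D g)) \<in> G"
    using tsubD(3,4)[OF G] m by simp
  moreover have "mulF (emb D' (g \<circ> f \<circ> finv g)) (emb D g) = mulF (emb D g) (emb D' f)"
    using emb_conj[OF g f fr sub] by simp
  moreover have "mulF (invF (emb D g)) (mulF (emb D g) (emb D' f)) = emb D' f"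
    unfolding mulF_assoc[symmetric] TL_inv_mult(1)[OF tsubD(1)[OF G m(1)]] by (simp add: mulF_def)
  ultimately show ?thesis by simp
qed

end



section \<open>Generation, simplicity and orderability\<close>

context minimal_shift
begin

section \<open>Columns between visits and generation by charts\<close>

text \<open>\<open>base C x t k\<close>: the last visit of the orbit of \<open>x\<close> to \<open>C\<close> up to time \<open>t\<close> is at time \<open>k\<close>. A lift
  \<open>H\<close> that fixes a neighbourhood of \<open>C \<times> {0}\<close> preserves the columns between consecutive visits, and
  \<open>tower C H D\<close> is the part of \<open>H\<close> in the columns over \<open>D\<close>.\<close>

definition base :: "(int \<Rightarrow> 'a) set \<Rightarrow> (int \<Rightarrow> 'a) \<Rightarrow> real \<Rightarrow> int \<Rightarrow> bool" where
  "base C x t k \<longleftrightarrow> sh k x \<in> C \<and> of_int k \<le> t \<and> (\<forall>j. k < j \<and> of_int j \<le> t \<longrightarrow> sh j x \<notin> C)"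

definition tower :: "(int \<Rightarrow> 'a) set \<Rightarrow> ((int \<Rightarrow> 'a) \<Rightarrow> real \<Rightarrow> real) \<Rightarrow> (int \<Rightarrow> 'a) set \<Rightarrow> (int \<Rightarrow> 'a) \<Rightarrow> real \<Rightarrow> real" where
  "tower C H D x t = (if \<exists>k. base C x t k \<and> sh k x \<in> D then H x t else t)"

lemma base_unique: "base C x t k \<Longrightarrow> base C x t k' \<Longrightarrow> k = k'"
  unfolding base_def by (meson linorder_less_linear)

lemma base_exists:
  assumes "clopen C" "C \<noteq> {}" "x \<in> S" shows "\<exists>k. base C x t k"
proof -
  obtain K :: nat where K: "\<And>x. x \<in> S \<Longrightarrow> \<exists>k. \<bar>k\<bar> \<le> int K \<and> sh k x \<in> C" using recurrence[OF assms(1,2)] by metis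
  \<comment> \<open>Starting \<open>K\<close> steps before the floor of \<open>t\<close> makes the
    visit happen no later than \<open>t\<close>.\<close>
  obtain k where k: "\<bar>k\<bar> \<le> int K" "sh k (sh (\<lfloor>t\<rfloor> - int K) x) \<in> C" using K[of "sh (\<lfloor>t\<rfloor> - int K) x"] assms(3) sh_iff by blast
  define k0 where "k0 = k + (\<lfloor>t\<rfloor> - int K)"
  define A where "A = {j. k0 \<le> j \<and> j \<le> \<lfloor>t\<rfloor> \<and> sh j x \<in> C}"
  have fin: "finite A" unfolding A_def by (rule finite_subset[of _ "{k0..\<lfloor>t\<rfloor>}"]) auto
  have k0: "k0 \<in> A" unfolding A_def k0_def using k by simp
  define m where "m = Max A"
  have mA: "m \<in> A" unfolding m_def using fin k0 by (intro Max_in) auto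
  have mx: "j \<le> m" if "j \<in> A" for j unfolding m_def using fin that by simp
  have "of_int m \<le> t" using mA unfolding A_def by (simp add: le_floor_iff)
  moreover have "sh j x \<notin> C" if j: "m < j \<and> of_int j \<le> t" for j
  proof
    assume "sh j x \<in> C"
    then have "j \<in> A" unfolding A_def using j mx[OF k0] by (simp add: le_floor_iff)
    then show False using mx j by fastforce
  qed
  ultimately have "base C x t m" unfolding base_def using mA unfolding A_def by blast
  then show ?thesis by blast
qed

text \<open>Visits to \<open>C\<close> happen at fixed points of the increasing map
  \<open>H x\<close>, so no time is moved across a visit.\<close>

lemma base_invariant:
  assumes H: "H \<in> TL" and fix0: "\<And>x. x \<in> C \<Longrightarrow> H x 0 = 0" and C: "C \<subseteq> S"
  shows "base C x (H x t) k \<longleftrightarrow> base C x t k"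
proof (cases "x \<in> S")
  case True
  have fixj: "H x (of_int j) = of_int j" if "sh j x \<in> C" for j
    using lifts_equivariant[OF H True, of "of_int j" j] fix0[OF that] by simp
  have P: "H x \<in> PL" by (rule TL_PL[OF H])
  have le: "of_int j \<le> H x t \<longleftrightarrow> of_int j \<le> t" if "sh j x \<in> C" for j
    using PL_le_iff[OF P, of "of_int j" t] fixj[OF that] by simp
  show ?thesis unfolding base_def using le by blast
next
  case False
  then show ?thesis using C sh_iff unfolding base_def by blast
qed

text \<open>The outer factor may be evaluated after \<open>H\<close> has moved the time; by
  \<open>base_invariant\<close> the point is then still in the same column.\<close>

lemma tower_union:
  assumes H: "H \<in> TL" and fix0: "\<And>x. x \<in> C \<Longrightarrow> H x 0 = 0" and C: "C \<subseteq> S" and dj: "D \<inter> D' = {}"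
  shows "tower C H (D \<union> D') = mulF (tower C H D) (tower C H D')"
proof (intro ext)
  fix x t
  have inv: "base C x (H x t) k \<longleftrightarrow> base C x t k" for k by (rule base_invariant[OF H fix0 C])
  show "tower C H (D \<union> D') x t = mulF (tower C H D) (tower C H D') x t"
  proof (cases "\<exists>k. base C x t k \<and> sh k x \<in> D'")
    case True
    then obtain k where k: "base C x t k" "sh k x \<in> D'" by blast
    have "\<not> (\<exists>k. base C x (H x t) k \<and> sh k x \<in> D)" using base_unique[OF k(1)] k(2) dj unfolding inv by blast
    moreover have "\<exists>k. base C x t k \<and> sh k x \<in> D \<union> D'" using k by blast
    ultimately show ?thesis using True unfolding mulF_apply tower_def by (simp only: if_True if_False)
  next
    case False
    then have "(\<exists>k. base C x t k \<and> sh k x \<in> D \<union> D') \<longleftrightarrow> (\<exists>k. base C x t k \<and> sh k x \<in> D)" by blast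
    then show ?thesis using False unfolding mulF_apply tower_def by (simp only: if_False)
  qed
qed

lemma tower_full:
  assumes H: "H \<in> TL" and C: "clopen C" "C \<noteq> {}" shows "tower C H C = H"
proof (intro ext)
  fix x t
  show "tower C H C x t = H x t"
  proof (cases "x \<in> S")
    case True
    then obtain k where k: "base C x t k" using base_exists[OF C] by blast
    then have "sh k x \<in> C" unfolding base_def by blast
    then show ?thesis using k unfolding tower_def by auto
  next
    case False
    then show ?thesis using liftsD(1)[OF H False] unfolding tower_def by simp
  qed
qed

text \<open>All points of \<open>D\<close> share the return time \<open>r\<close> to
  \<open>C\<close>, and \<open>H\<close> acts on all their columns by one map \<open>h\<close>. Cut
  off at both ends of the column, \<open>h\<close> is the required chart map; its support is compact
  because \<open>H\<close> is the identity within time 1 of each visit.\<close>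

lemma tower_emb:
  assumes H: "H \<in> TL" and C: "C \<subseteq> S" and D: "D \<subseteq> C"
    and fixC: "\<And>x t. x \<in> C \<Longrightarrow> \<bar>t\<bar> \<le> 1 \<Longrightarrow> H x t = t"
    and r: "2 \<le> r" and ret: "\<And>y. y \<in> D \<Longrightarrow> sh r y \<in> C" "\<And>y q. y \<in> D \<Longrightarrow> 1 \<le> q \<Longrightarrow> q < r \<Longrightarrow> sh q y \<notin> C"
    and h: "h \<in> PL" "\<And>y t. y \<in> D \<Longrightarrow> 0 \<le> t \<Longrightarrow> t \<le> of_int r \<Longrightarrow> H y t = h t" and ne: "D \<noteq> {}"
  obtains g where "g \<in> Fc 0 (of_int r)" "free D (of_int r - 0)" "tower C H D = emb D g"
proof -
  obtain y0 where y0: "y0 \<in> D" using ne by blast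
  have top: "H y t = t" if y: "y \<in> D" and t: "of_int r - 1 \<le> t" "t \<le> of_int r + 1" for y t
  proof -
    have "y \<in> S" using y C D by blast
    then have "H y t = of_int r + H (sh r y) (t - of_int r)" by (rule lifts_equivariant[OF H])
    moreover have "H (sh r y) (t - of_int r) = t - of_int r" by (rule fixC[OF ret(1)[OF y]]) (use t in auto)
    ultimately show ?thesis by simp
  qed
  have h0: "h t = t" if "0 \<le> t" "t \<le> 1" for t
    using fixC[of y0 t] h(2)[OF y0, of t] that y0 D r by auto
  have hr: "h t = t" if "of_int r - 1 \<le> t" "t \<le> of_int r" for t
    using top[OF y0, of t] h(2)[OF y0, of t] that r by auto
  define g1 where "g1 = (\<lambda>t. if t \<le> of_int r then h t else t)"
  have g1: "g1 \<in> PL" unfolding g1_def by (rule PL_glue) (use h hr in auto)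
  define g where "g = (\<lambda>t. if t \<le> 0 then t else g1 t)"
  have g: "g \<in> PL" unfolding g_def by (rule PL_glue) (use g1 h0[of 0] r in \<open>auto simp: g1_def\<close>)
  have "g t = t" if "t \<le> 1/2 \<or> of_int r - 1/2 \<le> t" for t
    using that h0[of t] hr[of t] unfolding g_def g1_def by auto
  then have "g \<in> Fsup (1/2) (of_int r - 1/2)" using g unfolding Fsup_def by blast
  then have gF: "g \<in> Fc 0 (of_int r)" by (rule Fsup_subset_Fc) (use r in auto)
  have gh: "g t = h t" if "0 < t" "t \<le> of_int r" for t using that unfolding g_def g1_def by simp
  have fr: "free D (of_int r - 0)" unfolding has_returns_before_def
  proof (intro notI, elim bexE exE conjE)
    fix y and q :: int assume "y \<in> D" "1 \<le> q" "of_int q < of_int r - (0::real)" "sh q y \<in> D"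
    then show False using ret(2)[of y q] D by auto
  qed
  have "tower C H D x t = emb D g x t" for x t
  proof (cases "\<exists>k. base C x t k \<and> sh k x \<in> D")
    case True
    then obtain k where k: "base C x t k" "sh k x \<in> D" by blast
    have xS: "x \<in> S" using k(2) C D sh_iff by blast
    have "sh (k + r) x \<in> C" using ret(1)[OF k(2)] by (simp add: add.commute)
    then have up: "t < of_int (k + r)" using k(1) r unfolding base_def
      by (metis add_strict_left_mono add_0_right less_le_trans not_le_imp_less zero_less_numeral)
    have lo: "of_int k \<le> t" using k(1) unfolding base_def by blast
    have tH: "tower C H D x t = H x t" using True unfolding tower_def by (simp only: if_True)
    \<comment> \<open>The bottom of a column belongs to the tower but not to the open chart; both
      maps fix it.\<close>
    show ?thesis
    proof (cases "t = of_int k")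
      case True
      have "H x t = of_int k + H (sh k x) (t - of_int k)" by (rule lifts_equivariant[OF H xS])
      also have "\<dots> = t" using fixC[of "sh k x" 0] k(2) D True by auto
      finally have "H x t = t" .
      moreover have "emb D g x t = t"
      proof (rule emb_out[OF gF])
        fix k' assume k': "sh k' x \<in> D" "0 < t - of_int k'" "t - of_int k' < of_int r"
        have "sh (k - k') (sh k' x) \<in> C" using k(2) D by auto
        moreover have "1 \<le> k - k'" "k - k' < r" using k' True by linarith+
        ultimately show False using ret(2)[OF k'(1)] by blast
      qed
      ultimately show ?thesis using tH by simp
    next
      case False
      have lo': "0 < t - of_int k" using lo False by simp
      have up': "t - of_int k < of_int r" using up by simp
      have "emb D g x t = of_int k + g (t - of_int k)" by (rule emb_in[OF gF fr k(2) lo' up'])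
      also have "g (t - of_int k) = H (sh k x) (t - of_int k)"
        using gh[OF lo'] h(2)[OF k(2), of "t - of_int k"] lo' up' by simp
      also have "of_int k + \<dots> = H x t" by (rule lifts_equivariant[OF H xS, symmetric])
      finally show ?thesis using tH by simp
    qed
  next
    case False
    have "emb D g x t = t"
    proof (rule emb_out[OF gF])
      fix k assume k: "sh k x \<in> D" "0 < t - of_int k" "t - of_int k < of_int r"
      have "sh j x \<notin> C" if j: "k < j" "of_int j \<le> t" for j
      proof -
        have "of_int j < of_int k + (of_int r :: real)" using j k by linarith
        then have "j - k < r" by linarith
        then have "sh (j - k) (sh k x) \<notin> C" using ret(2)[OF k(1), of "j - k"] j by simp
        then show ?thesis by simp
      qed
      then have "base C x t k" unfolding base_def using k D by auto
      then show False using False k(1) by blast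
    qed
    then show ?thesis using False unfolding tower_def by (simp only: if_False)
  qed
  then have "tower C H D = emb D g" by blast
  then show thesis using that gF fr by blast
qed

lemma first_return:
  assumes C: "clopen C" "C \<noteq> {}" and fr: "free C 2" and x: "x \<in> C"
  obtains r where "2 \<le> r" "sh r x \<in> C" "\<And>q. 1 \<le> q \<Longrightarrow> q < r \<Longrightarrow> sh q x \<notin> C"
proof -
  have xS: "x \<in> S" using x clopen_subset C by blast
  obtain K :: nat where K: "\<And>x. x \<in> S \<Longrightarrow> \<exists>k. \<bar>k\<bar> \<le> int K \<and> sh k x \<in> C" using recurrence[OF C] by metis
  obtain k where k: "\<bar>k\<bar> \<le> int K" "sh k (sh (int K + 1) x) \<in> C" using K[of "sh (int K + 1) x"] xS sh_iff by blast
  have ex: "\<exists>n::nat. 1 \<le> n \<and> sh (int n) x \<in> C"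
    using k by (intro exI[of _ "nat (k + (int K + 1))"]) auto
  define n where "n = (LEAST n::nat. 1 \<le> n \<and> sh (int n) x \<in> C)"
  have n: "1 \<le> n" "sh (int n) x \<in> C" using LeastI_ex[OF ex] unfolding n_def by auto
  have low: "sh q x \<notin> C" if q: "1 \<le> q" "q < int n" for q
  proof
    assume "sh q x \<in> C"
    then have "1 \<le> nat q \<and> sh (int (nat q)) x \<in> C" using q by simp
    then have "n \<le> nat q" unfolding n_def by (rule Least_le)
    then show False using q by simp
  qed
  have "n \<noteq> 1"
  proof
    assume "n = 1"
    then have "sh 1 x \<in> C" using n by simp
    then show False using freeD[OF fr, of 0 x 1] x by simp
  qed
  then have "2 \<le> int n" using n by simp
  then show thesis using that n(2) low by blast
qed

text \<open>Return times and lifts are locally constant, so over small sets around \<open>x\<close>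
  the uniformity required by \<open>tower_emb\<close> is automatic.\<close>

lemma tower_local_emb:
  assumes H: "H \<in> TL" and C: "clopen C" "C \<noteq> {}" and fr: "free C 2"
    and fixC: "\<And>x t. x \<in> C \<Longrightarrow> \<bar>t\<bar> \<le> 1 \<Longrightarrow> H x t = t" and x: "x \<in> C"
  shows "\<exists>n. \<forall>D. clopen D \<and> D \<subseteq> C \<and> D \<subseteq> cyl n x \<longrightarrow> tower C H D = (\<lambda>x. id) \<or>
     (\<exists>a b g. g \<in> Fc a b \<and> free D (b - a) \<and> tower C H D = emb D g)"
proof -
  have CS: "C \<subseteq> S" using clopen_subset C by blast
  obtain m where m: "\<And>x y. x \<in> S \<Longrightarrow> y \<in> S \<Longrightarrow> agree m x y \<Longrightarrow> x \<in> C \<longleftrightarrow> y \<in> C" using clopenE[OF C(1)] by metis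
  obtain r where r: "2 \<le> r" "sh r x \<in> C" "\<And>q. 1 \<le> q \<Longrightarrow> q < r \<Longrightarrow> sh q x \<notin> C" using first_return[OF C fr x] by metis
  obtain p where p: "\<forall>x\<in>S. \<forall>y\<in>S. agree p x y \<longrightarrow> (\<forall>t. \<bar>t\<bar> \<le> real (nat r) \<longrightarrow> H x t = H y t)"
    using liftsD(4)[OF H, of "nat r"] by (elim exE)
  \<comment> \<open>Wide enough to determine \<open>H\<close> at times up to \<open>r\<close> and
    membership in \<open>C\<close> for all shifts up to \<open>r\<close>.\<close>
  define n where "n = max p (m + nat r)"
  have "tower C H D = (\<lambda>x. id) \<or> (\<exists>a b g. g \<in> Fc a b \<and> free D (b - a) \<and> tower C H D = emb D g)"
    if D: "clopen D" "D \<subseteq> C" "D \<subseteq> cyl n x" for D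
  proof (cases "D = {}")
    case True
    then have "tower C H D = (\<lambda>x. id)" by (simp add: tower_def fun_eq_iff)
    then show ?thesis ..
  next
    case False
    have ag: "sh q x \<in> C \<longleftrightarrow> sh q y \<in> C" if "y \<in> D" "0 \<le> q" "q \<le> r" for y q
    proof -
      have xy: "agree n x y" "y \<in> S" using that(1) D(3) by (auto simp: cyl_def)
      have "m + nat \<bar>q\<bar> \<le> n" using that(2,3) unfolding n_def by linarith
      then have "agree (m + nat \<bar>q\<bar>) x y" by (rule agree_mono[OF xy(1)])
      then show ?thesis using m[OF _ _ agree_sh] x CS \<open>y \<in> S\<close> sh_iff by blast
    qed
    have 1: "sh r y \<in> C" if "y \<in> D" for y using ag[OF that, of r] r by simp
    have 2: "sh q y \<notin> C" if "y \<in> D" "1 \<le> q" "q < r" for y q using ag[OF that(1), of q] r(3)[OF that(2,3)] that by simp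
    have 3: "H y t = H x t" if y: "y \<in> D" and t: "0 \<le> t" "t \<le> of_int r" for y t
    proof -
      have "agree n x y" "y \<in> S" using y D(3) by (auto simp: cyl_def)
      then have "H x t = H y t" using x CS t r by (intro p[rule_format]) (auto simp: n_def intro: agree_mono)
      then show ?thesis by simp
    qed
    obtain g where "g \<in> Fc 0 (of_int r)" "free D (of_int r - 0)" "tower C H D = emb D g"
      by (rule tower_emb[OF H CS D(2) _ r(1) _ _ TL_PL[OF H, of x] _ False]) (use fixC 1 2 3 in blast)+
    then show ?thesis by blast
  qed
  then show ?thesis by blast
qed

theorem emb_generate_TL:
  assumes G: "tsub G" and gen: "\<And>D a b f. clopen D \<Longrightarrow> free D (b - a) \<Longrightarrow> f \<in> Fc a b \<Longrightarrow> emb D f \<in> G"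
  shows "TL \<subseteq> G"
proof
  fix F assume F: "F \<in> TL"
  obtain x0 where x0: "x0 \<in> S" using nonempty by blast
  obtain L :: nat where L: "\<forall>x\<in>S. \<forall>t. \<bar>F x t - t\<bar> \<le> L" using liftsD(5)[OF F] by blast
  \<comment> \<open>\<open>L\<close> bounds the displacement, so \<open>F x0\<close> maps
    \<open>[-1,1]\<close> into \<open>(-b,b)\<close>, and \<open>f\<close> can follow it
    there.\<close>
  define b where "b = real L + 3"
  have P: "F x0 \<in> PL" by (rule TL_PL[OF F])
  have "\<bar>F x0 (-1) - (-1)\<bar> \<le> L" "\<bar>F x0 1 - 1\<bar> \<le> L" using L x0 by blast+
  then have "- b < F x0 (-1)" "F x0 1 < b" "- b < -1" "1 < b" unfolding b_def by linarith+
  then obtain f where f: "f \<in> Fc (- b) b" "\<And>t. -1 \<le> t \<Longrightarrow> t \<le> 1 \<Longrightarrow> f t = F x0 t"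
    using Fc_extend[OF P, of "-1" 1 "- b" b] dyadic_uminus by auto
  obtain n1 where n1: "free (cyl n1 x0) (b - - b)" using free_small[OF x0] by blast
  obtain n2 where n2: "\<forall>x\<in>S. \<forall>y\<in>S. agree n2 x y \<longrightarrow> (\<forall>t. \<bar>t\<bar> \<le> real 1 \<longrightarrow> F x t = F y t)"
    using liftsD(4)[OF F, of 1] by (elim exE)
  define n where "n = max n1 n2"
  define C where "C = cyl n x0"
  have C: "clopen C" unfolding C_def by (rule clopen_cyl)
  have x0C: "x0 \<in> C" unfolding C_def by (rule cyl_self[OF x0])
  then have ne: "C \<noteq> {}" by blast
  have fr: "free C (b - - b)" unfolding C_def by (rule free_cyl_mono[OF n1]) (simp add: n_def)
  then have fr2: "free C 2" by (rule free_mono) (auto simp: b_def)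
  have E: "emb C f \<in> G" by (rule gen[OF C fr f(1)])
  then have ET: "emb C f \<in> TL" using tsubD(1)[OF G] by blast
  define H where "H = mulF (invF (emb C f)) F"
  have H: "H \<in> TL" unfolding H_def by (rule TL_mult[OF TL_inv[OF ET] F])
  have fixC: "H x t = t" if x: "x \<in> C" and t: "\<bar>t\<bar> \<le> 1" for x t
  proof -
    have xS: "x \<in> S" "agree n2 x0 x" using x agree_mono[of n x0 x n2] by (auto simp: C_def cyl_def n_def)
    have "F x0 t = F x t" using t by (intro n2[rule_format, OF x0 xS]) simp
    moreover have "f t = F x0 t" using t by (intro f(2)) auto
    moreover have "emb C f x t = of_int 0 + f (t - of_int 0)"
      by (rule emb_in[OF f(1) fr]) (use x t in \<open>auto simp: b_def\<close>)
    ultimately have "F x t = emb C f x t" by simp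
    then show ?thesis unfolding H_def mulF_apply invF_def using PL_inv_eq(1)[OF TL_PL[OF ET]] by simp
  qed
  have fix0: "\<And>x. x \<in> C \<Longrightarrow> H x 0 = 0" using fixC by simp
  have CS: "C \<subseteq> S" using clopen_subset[OF C] .
  have "tower C H C \<in> G"
  proof (rule clopen_induct[OF C, of "\<lambda>D. tower C H D \<in> G"])
    have "tower C H {} = (\<lambda>x. id)" by (simp add: tower_def fun_eq_iff)
    then show "tower C H {} \<in> G" using tsubD(2)[OF G] by (simp only:)
    show "\<exists>n. \<forall>D'. clopen D' \<and> D' \<subseteq> C \<and> D' \<subseteq> cyl n x \<longrightarrow> tower C H D' \<in> G" if x: "x \<in> C" for x
    proof -
      obtain n where n: "\<forall>D. clopen D \<and> D \<subseteq> C \<and> D \<subseteq> cyl n x \<longrightarrow> tower C H D = (\<lambda>x. id) \<or>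
         (\<exists>a b g. g \<in> Fc a b \<and> free D (b - a) \<and> tower C H D = emb D g)"
        using tower_local_emb[OF H C ne fr2 fixC x] by blast
      have "tower C H D \<in> G" if D: "clopen D" "D \<subseteq> C" "D \<subseteq> cyl n x" for D
        using n[rule_format, OF conjI[OF D(1) conjI[OF D(2,3)]]]
      proof (elim disjE exE conjE)
        assume "tower C H D = (\<lambda>x. id)" then show ?thesis using tsubD(2)[OF G] by (simp only:)
      next
        fix a b g assume g: "g \<in> Fc a b" "free D (b - a)" "tower C H D = emb D g"
        show ?thesis unfolding g(3) by (rule gen[OF D(1) g(2,1)])
      qed
      then show ?thesis by blast
    qed
    show "tower C H (A \<union> B) \<in> G" if "A \<inter> B = {}" "tower C H A \<in> G" "tower C H B \<in> G" for A B
      using tower_union[OF H fix0 CS that(1)] tsubD(3)[OF G that(2,3)] by simp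
  qed
  then have HG: "H \<in> G" unfolding tower_full[OF H C ne] .
  have "mulF (emb C f) H = F"
    unfolding H_def mulF_assoc[symmetric] TL_inv_mult(2)[OF ET] by (simp add: mulF_def)
  then show "F \<in> G" using tsubD(3)[OF G E HG] by simp
qed

section \<open>The group of lifts and its normal subgroups\<close>

definition TLG :: "((int \<Rightarrow> 'a) \<Rightarrow> real \<Rightarrow> real) monoid" where
  "TLG = \<lparr>carrier = TL, monoid.mult = mulF, one = (\<lambda>x. id)\<rparr>"

lemma TLG_simps [simp]: "carrier TLG = TL" "mult TLG = mulF" "one TLG = (\<lambda>x. id)"
  by (simp_all add: TLG_def)

lemma group_TLG: "group TLG"
proof (rule groupI)
  show "\<exists>y\<in>carrier TLG. y \<otimes>\<^bsub>TLG\<^esub> F = \<one>\<^bsub>TLG\<^esub>" if "F \<in> carrier TLG" for F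
    using that TL_inv[of F] TL_inv_mult(1)[of F] by (auto intro!: bexI[of _ "invF F"])
qed (auto simp: TL_mult TL_one mulF_assoc, simp add: mulF_def)

lemma TLG_inv: assumes "F \<in> TL" shows "m_inv TLG F = invF F"
proof -
  show ?thesis
    by (rule group.inv_equality[OF group_TLG]) (use assms TL_inv TL_inv_mult in auto)
qed

lemma subgroup_tsub: assumes "subgroup N TLG" shows "tsub N"
proof -
  have sub: "N \<subseteq> TL" using subgroup.subset[OF assms] by simp
  show ?thesis unfolding tsub_def
  proof (intro conjI ballI)
    show "N \<subseteq> TL" by (rule sub)
    show "(\<lambda>x. id) \<in> N" using subgroup.one_closed[OF assms] by simp
    show "mulF A B \<in> N" if "A \<in> N" "B \<in> N" for A B using subgroup.m_closed[OF assms that] by simp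
    show "invF A \<in> N" if "A \<in> N" for A
      using subgroup.m_inv_closed[OF assms that] TLG_inv[of A] that sub by auto
  qed
qed

lemma commuting_if_disjoint_support:
  fixes c d :: "real \<Rightarrow> real"
  assumes "\<And>t. t \<notin> P \<Longrightarrow> c t = t" "\<And>t. t \<notin> Q \<Longrightarrow> d t = t" "P \<inter> Q = {}" "\<And>t. t \<in> P \<Longrightarrow> c t \<in> P" "\<And>t. t \<in> Q \<Longrightarrow> d t \<in> Q"
  shows "c \<circ> d = d \<circ> c"
proof
  fix t show "(c \<circ> d) t = (d \<circ> c) t"
    using assms(1)[of t] assms(1)[of "d t"] assms(2)[of t] assms(2)[of "c t"] assms(3)[unfolded disjoint_iff] assms(4,5)[of t]
    by (cases "t \<in> P"; cases "t \<in> Q") auto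
qed

text \<open>If \<open>B\<close> commutes with \<open>C = F A^-1 F^-1\<close>, then \<open>[A, B] = [A C, B]\<close>, and \<open>A C = [A, F]\<close>.\<close>

lemma commutator_trick:
  assumes N: "tsub N" and norm: "\<And>A B. A \<in> TL \<Longrightarrow> B \<in> N \<Longrightarrow> mulF (mulF A B) (invF A) \<in> N"
    and F: "F \<in> N" and A: "A \<in> TL" and B: "B \<in> TL"
    and comm: "\<And>x. (F x \<circ> finv (A x) \<circ> finv (F x)) \<circ> B x = B x \<circ> (F x \<circ> finv (A x) \<circ> finv (F x))"
  shows "mulF (mulF (mulF A B) (invF A)) (invF B) \<in> N"
proof -
  have FT: "F \<in> TL" using tsubD(1)[OF N F] .
  define W where "W = mulF (mulF (mulF A F) (invF A)) (invF F)"
  have W: "W \<in> N" unfolding W_def by (rule tsubD(3)[OF N norm[OF A F] tsubD(4)[OF N F]])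
  then have W2: "mulF W (mulF (mulF B (invF W)) (invF B)) \<in> N"
    by (intro tsubD(3)[OF N W] norm[OF B] tsubD(4)[OF N])
  have "mulF W (mulF (mulF B (invF W)) (invF B)) x t = mulF (mulF (mulF A B) (invF A)) (invF B) x t" for x t
  proof -
    note P = TL_PL[OF FT, of x] TL_PL[OF A, of x] TL_PL[OF B, of x]
    define C where "C = F x \<circ> finv (A x) \<circ> finv (F x)"
    have CP: "C \<in> PL" unfolding C_def by (intro PL_comp PL_inv P)
    have Wx: "W x = A x \<circ> C" unfolding W_def mulF_def invF_def C_def by (simp add: o_assoc)
    have cm: "C (B x s) = B x (C s)" for s using fun_cong[OF comm[of x], of s] by (simp add: C_def)
    define s where "s = finv (A x) (finv (B x) t)"
    have "finv (W x) = finv C \<circ> finv (A x)" unfolding Wx by (rule finv_comp[OF P(2) CP])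
    then have "mulF W (mulF (mulF B (invF W)) (invF B)) x t = A x (C (B x (finv C s)))"
      unfolding mulF_apply invF_def s_def by (simp add: Wx)
    also have "\<dots> = A x (B x s)" unfolding cm using PL_inv_eq[OF CP] by simp
    finally show ?thesis unfolding mulF_apply invF_def s_def .
  qed
  then have "mulF W (mulF (mulF B (invF W)) (invF B)) = mulF (mulF (mulF A B) (invF A)) (invF B)" by blast
  then show ?thesis using W2 by simp
qed

text \<open>A point strictly between \<open>t\<close> and \<open>f t\<close> bounds the interval on
  one side; its preimage under \<open>f\<close> limits the choice on the other side.\<close>

lemma moved_interval:
  assumes "f \<in> PL" "f t \<noteq> t"
  obtains u v where "u < t" "t < v" "\<And>s. u < s \<Longrightarrow> s < v \<Longrightarrow> \<not> (u < f s \<and> f s < v)"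
proof -
  note less = PL_less_iff[OF assms(1)] and inv = PL_inv_eq[OF assms(1)]
  show thesis
  proof (cases "t < f t")
    case True
    obtain v where v: "t < v" "v < f t" using dense[OF True] by blast
    have "finv f v < t" using less[of "finv f v" t] v inv by simp
    then obtain u where u: "finv f v < u" "u < t" using dense by blast
    have "v < f u" using less[of "finv f v" u] u inv by simp
    then have "v < f s" if "u < s" for s using less[of u s] that by simp
    then show thesis using that[of u v] u v by force
  next
    case False
    then have "f t < t" using assms(2) by simp
    then obtain u where u: "f t < u" "u < t" using dense by blast
    have "t < finv f u" using less[of t "finv f u"] u inv by simp
    then obtain v where v: "t < v" "v < finv f u" using dense by blast
    have "f v < u" using less[of v "finv f u"] v inv by simp
    then have "f s < u" if "s < v" for s using less[of s v] that by simp
    then show thesis using that[of u v] u v by force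
  qed
qed

lemma normal_contains_chart:
  assumes N: "tsub N" and norm: "\<And>A B. A \<in> TL \<Longrightarrow> B \<in> N \<Longrightarrow> mulF (mulF A B) (invF A) \<in> N"
    and F: "F \<in> N" "F \<noteq> (\<lambda>x. id)"
  obtains C u v where "clopen C" "C \<noteq> {}" "u < v"
    "\<And>D f. clopen D \<Longrightarrow> D \<subseteq> C \<Longrightarrow> f \<in> Fc u v \<Longrightarrow> emb D f \<in> N"
proof -
  have FT: "F \<in> TL" using tsubD(1)[OF N F(1)] .
  obtain x t where xt: "F x t \<noteq> t" using F(2) by (auto simp: fun_eq_iff)
  have xS: "x \<in> S"
  proof (rule ccontr)
    assume "x \<notin> S"
    then show False using xt liftsD(1)[OF FT, of x] by simp
  qed
  obtain u v where uv: "u < t" "t < v" "\<And>s. u < s \<Longrightarrow> s < v \<Longrightarrow> \<not> (u < F x s \<and> F x s < v)"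
    using moved_interval[OF TL_PL[OF FT] xt] by metis
  obtain L :: nat where L: "\<forall>x\<in>S. \<forall>t. \<bar>F x t - t\<bar> \<le> L" using liftsD(5)[OF FT] by blast
  define M where "M = nat \<lceil>\<bar>u\<bar> + \<bar>v\<bar>\<rceil>"
  obtain n2 where n2: "\<forall>x\<in>S. \<forall>y\<in>S. agree n2 x y \<longrightarrow> (\<forall>t. \<bar>t\<bar> \<le> real M \<longrightarrow> F x t = F y t)"
    using liftsD(4)[OF FT, of M] by (elim exE)
  \<comment> \<open>The displacement of \<open>F\<close> plus the height of the chart. A visit to
    \<open>C\<close> within this range could catch the image of the chart under \<open>F\<close>,
    and freeness excludes it.\<close>
  define R where "R = real L + (v - u) + 1"
  obtain n1 where n1: "free (cyl n1 x) R" using free_small[OF xS] by blast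
  define n where "n = max n1 n2"
  define C where "C = cyl n x"
  have C: "clopen C" unfolding C_def by (rule clopen_cyl)
  have fr: "free C R" unfolding C_def by (rule free_cyl_mono[OF n1]) (simp add: n_def)
  have disj: "\<not> (u < F y s - of_int k \<and> F y s - of_int k < v)"
    if y: "y \<in> C" and s: "u < s" "s < v" and k: "sh k y \<in> C" for y s k
  proof
    assume a: "u < F y s - of_int k \<and> F y s - of_int k < v"
    have yS: "y \<in> S" "agree n2 x y" using y agree_mono[of n x y n2] by (auto simp: C_def cyl_def n_def)
    have "\<bar>F y s - s\<bar> \<le> L" using L yS by blast
    then have "\<bar>of_int k - of_int 0\<bar> < R" using a s unfolding R_def by linarith
    then have "k = 0" using freeD[OF fr, of k y 0] k y by simp
    moreover have "\<bar>s\<bar> \<le> real M" using s unfolding M_def by linarith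
    then have "F x s = F y s" by (rule n2[rule_format, OF xS yS])
    ultimately show False using uv(3)[OF s] a by simp
  qed
  have cmtN: "emb D (cmt p q) \<in> N" if D: "clopen D" "D \<subseteq> C" and p: "p \<in> Fc u v" and q: "q \<in> Fc u v" for D p q
  proof -
    have frD: "free D (v - u)" by (rule free_mono[OF fr D(2)]) (simp add: R_def)
    note Ap = emb_TL[OF D(1) p frD] and Bq = emb_TL[OF D(1) q frD]
    have "mulF (mulF (mulF (emb D p) (emb D q)) (invF (emb D p))) (invF (emb D q)) \<in> N"
    proof (rule commutator_trick[OF N norm F(1) Ap Bq])
      fix y
      \<comment> \<open>The trace of the chart over \<open>D\<close> on the orbit line of
        \<open>y\<close>. \<open>F\<close> moves it off itself, which supplies the commutation
        needed in \<open>commutator_trick\<close>.\<close>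
      define U where "U = {t. \<exists>k. sh k y \<in> D \<and> u < t - of_int k \<and> t - of_int k < v}"
      have out: "emb D r y t = t" if "r \<in> Fc u v" "t \<notin> U" for r t
        by (rule emb_out[OF that(1)]) (use that(2) U_def in blast)
      have ins: "emb D r y t \<in> U" if r: "r \<in> Fc u v" and t: "t \<in> U" for r t
      proof -
        obtain k where k: "sh k y \<in> D" "u < t - of_int k" "t - of_int k < v" using t U_def by blast
        have "emb D r y t = of_int k + r (t - of_int k)" by (rule emb_in[OF r frD k])
        then show ?thesis using k Fc_inside[OF r, of "t - of_int k"] unfolding U_def by (intro CollectI exI[of _ k]) simp
      qed
      note inv = PL_inv_eq[OF TL_PL[OF FT, of y]]
      have pi: "finv (emb D p y) = emb D (finv p) y" using emb_inv[OF p frD] by (simp add: invF_def)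
      have dj: "F y ` U \<inter> U = {}"
      proof -
        have False if t: "t \<in> U" and Ft: "F y t \<in> U" for t
        proof -
          obtain k where k: "sh k y \<in> D" "u < t - of_int k" "t - of_int k < v" using t U_def by blast
          obtain k' where k': "sh k' y \<in> D" "u < F y t - of_int k'" "F y t - of_int k' < v" using Ft U_def by blast
          have yS: "y \<in> S" using k(1) clopen_subset[OF D(1)] sh_iff by blast
          have eq: "F y t = of_int k + F (sh k y) (t - of_int k)" by (rule lifts_equivariant[OF FT yS])
          have "\<not> (u < F (sh k y) (t - of_int k) - of_int (k' - k) \<and> F (sh k y) (t - of_int k) - of_int (k' - k) < v)"
            by (rule disj) (use k k' D(2) in auto)
          then show False using k'(2,3) unfolding eq by simp
        qed
        then show ?thesis by blast
      qed
      show "F y \<circ> finv (emb D p y) \<circ> finv (F y) \<circ> emb D q y = emb D q y \<circ> (F y \<circ> finv (emb D p y) \<circ> finv (F y))"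
        unfolding pi
      proof (rule commuting_if_disjoint_support[where P = "F y ` U" and Q = U])
        fix t assume "t \<notin> F y ` U"
        then have "finv (F y) t \<notin> U" using inv(2)[of t] image_eqI[of t "F y" "finv (F y) t" U] by auto
        then show "(F y \<circ> emb D (finv p) y \<circ> finv (F y)) t = t" using out[OF Fc_inv[OF p]] inv by simp
      next
        fix t assume "t \<in> F y ` U"
        then obtain s where s: "s \<in> U" "t = F y s" by blast
        then show "(F y \<circ> emb D (finv p) y \<circ> finv (F y)) t \<in> F y ` U" using ins[OF Fc_inv[OF p] s(1)] inv by simp
      qed (use out[OF q] ins[OF q] dj in auto)
    qed
    moreover have "mulF (mulF (mulF (emb D p) (emb D q)) (invF (emb D p))) (invF (emb D q)) = emb D (cmt p q)"
      unfolding cmt_def emb_inv[OF p frD, symmetric] emb_inv[OF q frD, symmetric]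
      using emb_mult[OF Fc_comp[OF Fc_comp[OF p q] Fc_inv[OF p]] Fc_inv[OF q] frD]
        emb_mult[OF Fc_comp[OF p q] Fc_inv[OF p] frD] emb_mult[OF p q frD] by simp
    ultimately show ?thesis by simp
  qed
  have "emb D f \<in> N" if D: "clopen D" "D \<subseteq> C" and f: "f \<in> Fc u v" for D f
  proof -
    have frD: "free D (v - u)" by (rule free_mono[OF fr D(2)]) (simp add: R_def)
    have uv': "u < v" using uv by simp
    \<comment> \<open>Only commutators have been reached so far; perfectness gives the whole
      copy.\<close>
    have "Fc u v \<subseteq> {f \<in> Fc u v. emb D f \<in> N}"
    proof (rule Fc_perfect[OF tsub_subgrp[OF N frD uv']])
      show "cmt p q \<in> {f \<in> Fc u v. emb D f \<in> N}" if "p \<in> Fc u v" "q \<in> Fc u v" for p q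
        using cmtN[OF D that] Fc_comp[OF Fc_comp[OF Fc_comp[OF that] Fc_inv[OF that(1)]] Fc_inv[OF that(2)]]
        unfolding cmt_def by simp
    qed
    then show ?thesis using f by blast
  qed
  moreover have "C \<noteq> {}" unfolding C_def using cyl_self[OF xS] by blast
  moreover have "u < v" using uv by simp
  ultimately show thesis using that C by blast
qed

lemma normal_contains_all:
  assumes N: "tsub N" and norm: "\<And>A B. A \<in> TL \<Longrightarrow> B \<in> N \<Longrightarrow> mulF (mulF A B) (invF A) \<in> N"
    and F: "F \<in> N" "F \<noteq> (\<lambda>x. id)"
  shows "TL \<subseteq> N"
proof -
  obtain C u v where C: "clopen C" "C \<noteq> {}" "u < v"
    "\<And>D f. clopen D \<Longrightarrow> D \<subseteq> C \<Longrightarrow> f \<in> Fc u v \<Longrightarrow> emb D f \<in> N"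
    using normal_contains_chart[OF N norm F] by metis
  obtain m where m: "\<And>x y. x \<in> S \<Longrightarrow> y \<in> S \<Longrightarrow> agree m x y \<Longrightarrow> x \<in> C \<longleftrightarrow> y \<in> C" using clopenE[OF C(1)] by metis
  show ?thesis
  proof (rule emb_generate_TL[OF N])
    fix D a b f assume D: "clopen D" and fr: "free D (b - a)" and f: "f \<in> Fc a b"
    obtain p q where pq: "a < p" "p < q" "q < b" "p \<in> dyadic_rationals" "q \<in> dyadic_rationals" "f \<in> Fsup p q"
      using FcE[OF f] by metis
    show "emb D f \<in> N"
    proof (rule clopen_induct[OF D, of "\<lambda>D. emb D f \<in> N"])
      show "emb {} f \<in> N" using tsubD(2)[OF N] by (simp only: emb_empty)
      show "emb (A \<union> B) f \<in> N" if "A \<union> B \<subseteq> D" "A \<inter> B = {}" "emb A f \<in> N" "emb B f \<in> N" for A B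
        by (rule emb_mem_union[OF N f free_mono[OF fr that(1)] that(2-4)]) simp
      fix x assume x: "x \<in> D"
      have xS: "x \<in> S" using x clopen_subset[OF D] by blast
      obtain k where k: "sh k x \<in> C" using hits_clopen[OF C(1,2) xS] by metis
      \<comment> \<open>One interval with margin 1 around the support of \<open>f\<close> and around
        the target window, so that a single \<open>g\<close> can move the first into the
        second.\<close>
      define a' where "a' = min a (u + of_int k) - 1"
      define b' where "b' = max b (v + of_int k) + 1"
      obtain n1 where n1: "free (cyl n1 x) (b' - a')" using free_small[OF xS] by blast
      define n where "n = max n1 (m + nat \<bar>k\<bar>)"
      obtain p' where p': "p' \<in> dyadic_rationals" "u + of_int k < p'" "p' < v + of_int k"
        using dyadic_dense[of "u + of_int k" "v + of_int k"] C(3) by auto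
      obtain q' where q': "q' \<in> dyadic_rationals" "p' < q'" "q' < v + of_int k"
        using dyadic_dense[of p' "v + of_int k"] p' by auto
      obtain g where g: "g \<in> Fc a' b'" "g p = p'" "g q = q'"
        by (rule Fc_move[of p q p' q' a' b']) (use pq p' q' in \<open>auto simp: a'_def b'_def\<close>)
      have f': "f \<in> Fc a' b'" by (rule Fc_mono[OF f]) (auto simp: a'_def b'_def)
      have c: "g \<circ> f \<circ> finv g \<in> Fc (u + of_int k) (v + of_int k)"
        by (rule Fsup_subset_Fc[OF conj_Fsup[OF pq(6) Fc_PL[OF g(1)]]]) (use g p' q' C(3) in auto)
      \<comment> \<open>Shifting by \<open>k\<close> turns the chart over \<open>D'\<close> at times
        in \<open>(u + k, v + k)\<close> into one over a subset of \<open>C\<close> at times in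
        \<open>(u, v)\<close>, which \<open>N\<close> contains.\<close>
      have c': "shiftf k (g \<circ> f \<circ> finv g) \<in> Fc u v" using shiftf_Fc[OF c, of k] by simp
      have "emb D' f \<in> N" if D': "clopen D'" "D' \<subseteq> D" "D' \<subseteq> cyl n x" for D'
      proof -
        have frD: "free D' (b' - a')" by (rule free_mono[OF n1]) (use D'(3) cyl_mono[of n1 n x] in \<open>auto simp: n_def\<close>)
        have frc: "free D' (v + of_int k - (u + of_int k))" by (rule free_mono[OF frD]) (auto simp: a'_def b'_def)
        have "sh k ` D' \<subseteq> C"
        proof
          fix z assume "z \<in> sh k ` D'"
          then obtain y where y: "y \<in> D'" "z = sh k y" by blast
          then have "y \<in> S" "agree (m + nat \<bar>k\<bar>) x y" using D'(3) agree_mono[of n x y "m + nat \<bar>k\<bar>"] by (auto simp: cyl_def n_def)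
          then show "z \<in> C" unfolding y(2) using m[OF _ _ agree_sh] xS sh_iff k by blast
        qed
        then have "emb (sh k ` D') (shiftf k (g \<circ> f \<circ> finv g)) \<in> N" using C(4)[OF clopen_sh[OF D'(1)] _ c'] by blast
        then have w: "emb D' (g \<circ> f \<circ> finv g) \<in> N" unfolding emb_shift[OF c frc] .
        note gT = emb_TL[OF D'(1) g(1) frD]
        have "mulF (mulF (invF (emb D' g)) (emb D' (g \<circ> f \<circ> finv g))) (invF (invF (emb D' g))) \<in> N"
          by (rule norm[OF TL_inv[OF gT] w])
        moreover have "invF (invF (emb D' g)) = emb D' g"
          unfolding invF_def using finv_finv[OF TL_PL[OF gT]] by simp
        moreover have "mulF (mulF (invF (emb D' g)) (emb D' (g \<circ> f \<circ> finv g))) (emb D' g) = emb D' f"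
        proof -
          have "mulF (emb D' (g \<circ> f \<circ> finv g)) (emb D' g) = mulF (emb D' g) (emb D' f)"
            using emb_conj[OF g(1) f' frD order_refl] by simp
          then have "mulF (mulF (invF (emb D' g)) (emb D' (g \<circ> f \<circ> finv g))) (emb D' g)
              = mulF (mulF (invF (emb D' g)) (emb D' g)) (emb D' f)" by (simp add: mulF_assoc)
          then show ?thesis unfolding TL_inv_mult(1)[OF gT] by (simp add: mulF_def)
        qed
        ultimately show ?thesis by simp
      qed
      then show "\<exists>n. \<forall>D'. clopen D' \<and> D' \<subseteq> D \<and> D' \<subseteq> cyl n x \<longrightarrow> emb D' f \<in> N" by blast
    qed
  qed
qed

lemma TL_nontrivial: "\<exists>F\<in>TL. F \<noteq> (\<lambda>x. id)"
proof -
  obtain x where x: "x \<in> S" using nonempty by blast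
  obtain n where n: "free (cyl n x) (1 - (-2))" using free_small[OF x] by blast
  obtain h where h: "h \<in> Fc (-2) (1::real)" "h (-1) = -1" "h 0 = 1/2"
    using Fc_move[of "-1" 0 "-1" "1/2" "-2" 1] dyadic_uminus[OF dyadic_1] dyadic_divide_2[OF dyadic_1] by auto
  have "emb (cyl n x) h x 0 = of_int 0 + h (0 - of_int 0)"
    by (rule emb_in[OF h(1) n]) (use cyl_self[OF x] in auto)
  then have "emb (cyl n x) h x 0 \<noteq> 0" using h by simp
  then have "emb (cyl n x) h \<noteq> (\<lambda>x. id)" by (metis id_apply)
  then show ?thesis using emb_TL[OF clopen_cyl h(1) n] by blast
qed

theorem TLG_simple: "is_simple TLG"
  unfolding is_simple_def
proof (intro conjI allI impI)
  show "group TLG" by (rule group_TLG)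
  show "carrier TLG \<noteq> {\<one>\<^bsub>TLG\<^esub>}" using TL_nontrivial by auto
  fix N assume N: "N \<lhd> TLG"
  have sg: "subgroup N TLG" using N normal_imp_subgroup by blast
  have ts: "tsub N" by (rule subgroup_tsub[OF sg])
  show "N = carrier TLG \<or> N = {\<one>\<^bsub>TLG\<^esub>}"
  proof (cases "N = {\<one>\<^bsub>TLG\<^esub>}")
    case False
    then obtain F where F: "F \<in> N" "F \<noteq> (\<lambda>x. id)" using tsubD(2)[OF ts] by auto
    have "TL \<subseteq> N"
    proof (rule normal_contains_all[OF ts _ F])
      show "mulF (mulF A B) (invF A) \<in> N" if "A \<in> TL" "B \<in> N" for A B
        using normal.inv_op_closed2[OF N, of A B] that TLG_inv[of A] by simp
    qed
    then show ?thesis using tsubD(1)[OF ts] by auto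
  qed blast
qed

section \<open>Left orderability\<close>

lemma TL_determined_by_orbit:
  assumes F: "F \<in> TL" and G: "G \<in> TL" and x: "x \<in> S" and eq: "F x = G x"
  shows "F = G"
proof (intro ext)
  fix y t
  show "F y t = G y t"
  proof (cases "y \<in> S")
    case True
    define M where "M = nat \<lceil>\<bar>t\<bar>\<rceil>"
    have tM: "\<bar>t\<bar> \<le> real M" unfolding M_def by (rule real_nat_ceiling_ge)
    obtain n1 where n1: "\<forall>x\<in>S. \<forall>y\<in>S. agree n1 x y \<longrightarrow> (\<forall>t. \<bar>t\<bar> \<le> real M \<longrightarrow> F x t = F y t)"
      using liftsD(4)[OF F, of M] by (elim exE)
    obtain n2 where n2: "\<forall>x\<in>S. \<forall>y\<in>S. agree n2 x y \<longrightarrow> (\<forall>t. \<bar>t\<bar> \<le> real M \<longrightarrow> G x t = G y t)"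
      using liftsD(4)[OF G, of M] by (elim exE)
    \<comment> \<open>A shift of \<open>x\<close> agrees with \<open>y\<close> on a window that
      determines both lifts at time \<open>t\<close>; equivariance relates the values there to those
      at \<open>x\<close>.\<close>
    obtain k where k: "agree (max n1 n2) y (sh k x)" using dense_orbits[OF x True] by blast
    have kS: "sh k x \<in> S" using x sh_iff by blast
    have "F y t = F (sh k x) t" by (rule n1[rule_format, OF True kS agree_mono[OF k] tM]) simp
    also have "\<dots> = G (sh k x) t" using liftsD(3)[OF F x] liftsD(3)[OF G x] eq by simp
    also have "\<dots> = G y t" by (rule n2[rule_format, OF True kS agree_mono[OF k] tM, symmetric]) simp
    finally show ?thesis .
  next
    case False
    then show ?thesis using liftsD(1)[OF F] liftsD(1)[OF G] by simp
  qed
qed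

theorem TLG_left_orderable: "left_orderable TLG"
proof -
  obtain x where x: "x \<in> S" using nonempty by blast
  obtain W :: "real rel" where W: "well_order_on UNIV W" using well_order_on by blast
  have wf: "wf (W - Id)" and tot: "total W" and anti: "antisym W" and refl: "refl W"
    using W unfolding well_order_on_def linear_order_on_def partial_order_on_def preorder_on_def by auto
  \<comment> \<open>The first place of difference along \<open>W\<close>: it exists because
    \<open>W\<close> is a well-order and is unique because \<open>W\<close> is total.\<close>
  define d where "d F G t \<longleftrightarrow> F x t \<noteq> G x t \<and> (\<forall>s. (s, t) \<in> W - Id \<longrightarrow> F x s = G x s)" for F G :: "(int \<Rightarrow> 'a) \<Rightarrow> real \<Rightarrow> real" and t
  define r where "r = {(F, G). F \<in> TL \<and> G \<in> TL \<and> (F = G \<or> (\<exists>t. d F G t \<and> F x t < G x t))}"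
  have ex: "\<exists>t. d F G t" if "F \<in> TL" "G \<in> TL" "F \<noteq> G" for F G
  proof -
    have "F x \<noteq> G x" using TL_determined_by_orbit[OF that(1,2) x] that(3) by blast
    then obtain t where "F x t \<noteq> G x t" by blast
    then have "t \<in> {t. F x t \<noteq> G x t}" by blast
    from wfE_min[OF wf this] obtain z where z: "z \<in> {t. F x t \<noteq> G x t}"
      "\<And>y. (y, z) \<in> W - Id \<Longrightarrow> y \<notin> {t. F x t \<noteq> G x t}" by metis
    then show ?thesis unfolding d_def by blast
  qed
  have cmp: "s = t \<or> (s, t) \<in> W - Id \<or> (t, s) \<in> W - Id" for s t
    using tot unfolding total_on_def by auto
  have trW: "(s, t) \<in> W - Id \<Longrightarrow> (t, w) \<in> W - Id \<Longrightarrow> (s, w) \<in> W - Id" for s t w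
    using W unfolding well_order_on_def linear_order_on_def partial_order_on_def preorder_on_def trans_def antisym_def by blast
  have d_sym: "d F G t \<longleftrightarrow> d G F t" for F G t unfolding d_def by auto
  have d_unique: "s = t" if "d F G s" "d F G t" for F G s t
    using cmp[of s t] that unfolding d_def by blast
  have "linear_order_on (carrier TLG) r"
    unfolding linear_order_on_def partial_order_on_def preorder_on_def
  proof (intro conjI)
    show "r \<subseteq> carrier TLG \<times> carrier TLG" unfolding r_def by auto
    show "refl_on (carrier TLG) r" unfolding refl_on_def r_def by auto
    show "trans r"
    proof (rule transI)
      fix F G K assume FG: "(F, G) \<in> r" and GK: "(G, K) \<in> r"
      show "(F, K) \<in> r"
      proof (cases "F = G \<or> G = K")
        case True then show ?thesis using FG GK by blast
      next
        case False
        then obtain s t where s: "d F G s" "F x s < G x s" and t: "d G K t" "G x t < K x t"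
          using FG GK unfolding r_def by blast
        have "\<exists>w. d F K w \<and> F x w < K x w"
          using cmp[of s t]
        proof (elim disjE)
          assume "s = t" then show ?thesis using s t unfolding d_def by (intro exI[of _ t]) auto
        next
          assume st: "(s, t) \<in> W - Id"
          then have "G x s = K x s" using t unfolding d_def by blast
          then show ?thesis using s t trW[OF _ st] unfolding d_def by (intro exI[of _ s]) auto
        next
          assume ts: "(t, s) \<in> W - Id"
          then have "F x t = G x t" using s unfolding d_def by blast
          then show ?thesis using s t trW[OF _ ts] unfolding d_def by (intro exI[of _ t]) auto
        qed
        then show ?thesis using FG GK unfolding r_def by blast
      qed
    qed
    show "antisym r"
    proof (rule antisymI, rule ccontr)
      fix F G assume FG: "(F, G) \<in> r" "(G, F) \<in> r" "F \<noteq> G"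
      then obtain s t where "d F G s" "F x s < G x s" "d G F t" "G x t < F x t" unfolding r_def by blast
      then show False using d_unique[of F G s t] d_sym by auto
    qed
    show "total_on (carrier TLG) r" unfolding total_on_def
    proof (intro ballI impI)
      fix F G assume FG: "F \<in> carrier TLG" "G \<in> carrier TLG" "F \<noteq> G"
      then obtain t where t: "d F G t" using ex by auto
      then have "F x t < G x t \<or> G x t < F x t" unfolding d_def by auto
      then show "(F, G) \<in> r \<or> (G, F) \<in> r" using t d_sym FG unfolding r_def by auto
    qed
  qed
  moreover have "(c \<otimes>\<^bsub>TLG\<^esub> F, c \<otimes>\<^bsub>TLG\<^esub> G) \<in> r"
    if h: "F \<in> carrier TLG" "G \<in> carrier TLG" "c \<in> carrier TLG" "(F, G) \<in> r" for F G c
  proof (cases "F = G")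
    case True then show ?thesis using that TL_mult unfolding r_def by auto
  next
    case False
    then obtain t where t: "d F G t" "F x t < G x t" using h unfolding r_def by blast
    have P: "c x \<in> PL" using that TL_PL by simp
    \<comment> \<open>\<open>c x\<close> is injective and increasing, so it changes neither the
      place of the first difference nor its direction.\<close>
    have "d (mulF c F) (mulF c G) t" using t(1) unfolding d_def mulF_apply PL_eq_iff[OF P] .
    moreover have "mulF c F x t < mulF c G x t" using t(2) unfolding mulF_apply PL_less_iff[OF P] .
    ultimately show ?thesis using that TL_mult unfolding r_def by auto
  qed
  ultimately show ?thesis unfolding left_orderable_def using group_TLG by blast
qed

section \<open>Finite generation\<close>

definition chart_in :: "((int \<Rightarrow> 'a) \<Rightarrow> real \<Rightarrow> real) set \<Rightarrow> (int \<Rightarrow> 'a) set \<Rightarrow> bool" where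
  "chart_in G D \<longleftrightarrow> (\<forall>f\<in>Fc 0 2. emb D f \<in> G)"

text \<open>On one window of length 1 both bases are available, so commutators there give everything
  over the intersection. Conjugating by elements over \<open>D\<close> then recovers the full height
  2.\<close>

lemma chart_in_intersection:
  assumes G: "tsub G" and D: "clopen D" "free D 2" "chart_in G D" and D': "clopen D'" "free D' 2" "chart_in G D'"
    and j: "j = 1 \<or> j = -1"
  shows "chart_in G (D \<inter> sh j ` D')"
proof -
  \<comment> \<open>The half of \<open>(0,2)\<close> whose translate by \<open>j\<close> is the
    other half.\<close>
  define c :: real where "c = (if j = -1 then 1 else 0)"
  have cj: "0 \<le> c + of_int j" "c + 1 + of_int j \<le> 2" "0 \<le> c" "c + 1 \<le> 2" using j unfolding c_def by auto
  let ?D = "D \<inter> sh j ` D'"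
  have fr1: "free X (c + 1 - c)" for X :: "(int \<Rightarrow> 'a) set" by (rule free_1) simp
  have ED: "emb D p \<in> G" if "p \<in> Fc c (c + 1)" for p
    using D(3) Fc_mono[OF that, of 0 2] cj unfolding chart_in_def by blast
  have ED': "emb (sh j ` D') q \<in> G" if q: "q \<in> Fc c (c + 1)" for q
  proof -
    have s: "shiftf (- j) q \<in> Fc (c + of_int j) (c + 1 + of_int j)" using shiftf_Fc[OF q, of "- j"] by simp
    have fr: "free D' (c + 1 + of_int j - (c + of_int j))" by (rule free_1) simp
    have "emb D' (shiftf (- j) q) \<in> G" using D'(3) Fc_mono[OF s, of 0 2] cj unfolding chart_in_def by blast
    then show ?thesis using emb_shift[OF s fr, of j] by simp
  qed
  have "Fc c (c + 1) \<subseteq> {f \<in> Fc c (c + 1). emb ?D f \<in> G}"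
  proof (rule Fc_perfect[OF tsub_subgrp[OF G fr1]])
    show "cmt p q \<in> {f \<in> Fc c (c + 1). emb ?D f \<in> G}" if p: "p \<in> Fc c (c + 1)" and q: "q \<in> Fc c (c + 1)" for p q
    proof -
      have "mulF (mulF (mulF (emb D p) (emb (sh j ` D') q)) (emb D (finv p))) (emb (sh j ` D') (finv q)) \<in> G"
        by (intro tsubD(3)[OF G] ED ED' Fc_inv p q)
      then have "emb ?D (cmt p q) \<in> G" unfolding emb_commutator[OF p q] .
      then show ?thesis unfolding cmt_def using Fc_comp Fc_inv p q by blast
    qed
  qed simp
  then have small: "emb ?D f \<in> G" if "f \<in> Fc c (c + 1)" for f using that by blast
  show ?thesis unfolding chart_in_def
  proof
    fix f :: "real \<Rightarrow> real" assume f: "f \<in> Fc 0 2"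
    obtain u v where uv: "0 < u" "u < v" "v < 2" "u \<in> dyadic_rationals" "v \<in> dyadic_rationals" "f \<in> Fsup u v"
      using FcE[OF f] by metis
    obtain u' where u': "u' \<in> dyadic_rationals" "c < u'" "u' < c + 1" using dyadic_dense[of c "c + 1"] by auto
    obtain v' where v': "v' \<in> dyadic_rationals" "u' < v'" "v' < c + 1" using dyadic_dense[of u' "c + 1"] u' by auto
    obtain g where g: "g \<in> Fc 0 2" "g u = u'" "g v = v'"
      by (rule Fc_move[of u v u' v' 0 2]) (use uv u' v' cj in auto)
    have "g \<circ> f \<circ> finv g \<in> Fc c (c + 1)"
      by (rule Fsup_subset_Fc[OF conj_Fsup[OF uv(6) Fc_PL[OF g(1)]]]) (use g u' v' in auto)
    then have "emb ?D (g \<circ> f \<circ> finv g) \<in> G" by (rule small)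
    moreover have "emb D g \<in> G" using D(3) g(1) unfolding chart_in_def by blast
    moreover have "free D (2 - 0)" using D(2) by simp
    ultimately show "emb ?D f \<in> G" by (intro emb_conj_mem[OF G f g(1)]) auto
  qed
qed

text \<open>A window of radius \<open>n + 1\<close> is the union of the windows of radius
  \<open>n\<close> centred at -1, 0 and 1.\<close>

lemma cylinder_step:
  "cyl (Suc n) x = (cyl n x \<inter> sh (-1) ` cyl n (sh 1 x)) \<inter> sh 1 ` cyl n (sh (-1) x)"
proof -
  have "y \<in> cyl (Suc n) x \<longleftrightarrow> y \<in> (cyl n x \<inter> sh (-1) ` cyl n (sh 1 x)) \<inter> sh 1 ` cyl n (sh (-1) x)" for y
  proof
    assume y: "y \<in> cyl (Suc n) x"
    then show "y \<in> (cyl n x \<inter> sh (-1) ` cyl n (sh 1 x)) \<inter> sh 1 ` cyl n (sh (-1) x)"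
      unfolding Int_iff sh_image_iff cyl_def mem_Collect_eq using sh_iff[of 1 y] sh_iff[of "-1" y]
      by (auto simp: agree_def sh_def)
  next
    assume "y \<in> (cyl n x \<inter> sh (-1) ` cyl n (sh 1 x)) \<inter> sh 1 ` cyl n (sh (-1) x)"
    then have y: "y \<in> S" "agree n x y" "agree n (sh 1 x) (sh 1 y)" "agree n (sh (-1) x) (sh (-1) y)"
      unfolding Int_iff sh_image_iff by (auto simp: cyl_def)
    have "x i = y i" if i: "\<bar>i\<bar> \<le> int (Suc n)" for i
    proof -
      consider "\<bar>i\<bar> \<le> int n" | "i = int n + 1" | "i = - int n - 1" using i by linarith
      then show ?thesis
      proof cases
        case 1 then show ?thesis using y(2) by (simp add: agree_def)
      next
        case 2
        have "sh 1 x (int n) = sh 1 y (int n)" using y(3) by (simp add: agree_def)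
        then show ?thesis using 2 by (simp add: sh_def)
      next
        case 3
        have "sh (-1) x (- int n) = sh (-1) y (- int n)" using y(4) by (simp add: agree_def)
        then show ?thesis using 3 by (simp add: sh_def)
      qed
    qed
    then show "y \<in> cyl (Suc n) x" using y(1) by (simp add: cyl_def agree_def)
  qed
  then show ?thesis by blast
qed

lemma chart_in_cylinders:
  assumes G: "tsub G" and fr: "\<forall>x\<in>S. free (cyl n x) 2" and base: "\<And>x. x \<in> S \<Longrightarrow> chart_in G (cyl n x)" and x: "x \<in> S"
  shows "chart_in G (cyl (n + m) x)"
  using x
proof (induction m arbitrary: x)
  case 0 then show ?case using base by simp
next
  case (Suc m)
  let ?n = "n + m"
  have frm: "free (cyl ?n y) 2" if "y \<in> S" for y using free_cyl_mono[of n y 2 ?n] fr that by simp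
  have S1: "sh 1 x \<in> S" "sh (-1) x \<in> S" using Suc.prems sh_iff by blast+
  have 1: "chart_in G (cyl ?n x \<inter> sh (-1) ` cyl ?n (sh 1 x))"
    by (rule chart_in_intersection[OF G clopen_cyl frm Suc.IH clopen_cyl frm Suc.IH]) (use Suc.prems S1 in auto)
  have 2: "clopen (cyl ?n x \<inter> sh (-1) ` cyl ?n (sh 1 x))" by (intro clopen_Int clopen_cyl clopen_sh)
  have 3: "free (cyl ?n x \<inter> sh (-1) ` cyl ?n (sh 1 x)) 2" by (rule free_mono[OF frm[OF Suc.prems]]) auto
  have "chart_in G ((cyl ?n x \<inter> sh (-1) ` cyl ?n (sh 1 x)) \<inter> sh 1 ` cyl ?n (sh (-1) x))"
    by (rule chart_in_intersection[OF G 2 3 1 clopen_cyl frm Suc.IH]) (use S1 in auto)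
  then show ?case unfolding cylinder_step[symmetric] by simp
qed

text \<open>Long time intervals are covered by overlapping windows
  \<open>(p + i, p + i + 2)\<close>, each of which becomes \<open>(0,2)\<close> after a shift of the
  base; the shifted bases are cut into deep cylinders.\<close>

lemma cylinder_charts_generate:
  assumes G: "tsub G" and fr: "\<forall>x\<in>S. free (cyl n x) 2" and base: "\<And>x. x \<in> S \<Longrightarrow> chart_in G (cyl n x)"
  shows "TL \<subseteq> G"
proof (rule emb_generate_TL[OF G])
  have sub: "emb D f \<in> G" if D: "clopen D" "D \<subseteq> cyl n x" and x: "x \<in> S" and f: "f \<in> Fc 0 2" for D x f
  proof (rule clopen_cylinder_induct[OF D(1), of "\<lambda>D. emb D f \<in> G" n])
    show "emb {} f \<in> G" using tsubD(2)[OF G] by (simp only: emb_empty)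
    have frD: "free D 2" using free_mono[OF _ D(2), of 2 2] fr x by simp
    show "emb (A \<union> B) f \<in> G" if "A \<union> B \<subseteq> D" "A \<inter> B = {}" "emb A f \<in> G" "emb B f \<in> G" for A B
      by (rule emb_mem_union[OF G f _ that(2-4)]) (use free_mono[OF frD that(1), of 2] in simp)
    show "emb (cyl k y) f \<in> G" if k: "n \<le> k" and y: "y \<in> D" for k y
    proof -
      have "y \<in> S" using y clopen_subset[OF D(1)] by blast
      then have "chart_in G (cyl (n + (k - n)) y)" by (intro chart_in_cylinders[OF G fr]) (rule base)
      then show ?thesis using k f unfolding chart_in_def by simp
    qed
  qed
  fix D a b f assume D: "clopen D" and frD: "free D (b - a)" and f: "f \<in> Fc a b"
  define p where "p = \<lfloor>a\<rfloor>"
  define m where "m = nat (\<lceil>b\<rceil> - \<lfloor>a\<rfloor>)"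
  have ab: "a < b" using FcE[OF f] by (metis less_trans)
  have pb: "of_int p \<le> a" "b \<le> of_int p + 2 + real m" unfolding p_def m_def using ab by linarith+
  have f': "f \<in> Fc (of_int p) (of_int p + 2 + real m)" by (rule Fc_mono[OF f pb])
  show "emb D f \<in> G"
  proof (rule clopen_induct[OF D, of "\<lambda>D. emb D f \<in> G"])
    show "emb {} f \<in> G" using tsubD(2)[OF G] by (simp only: emb_empty)
    show "emb (A \<union> B) f \<in> G" if "A \<union> B \<subseteq> D" "A \<inter> B = {}" "emb A f \<in> G" "emb B f \<in> G" for A B
      by (rule emb_mem_union[OF G f free_mono[OF frD that(1)] that(2-4)]) simp
    fix x assume x: "x \<in> D"
    have xS: "x \<in> S" using x clopen_subset[OF D] by blast
    obtain n1 where n1: "free (cyl n1 x) (2 + real m)" using free_small[OF xS] by blast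
    \<comment> \<open>Deep enough for freeness over the whole time interval, and for every shift of
      \<open>D'\<close> by \<open>p + i\<close> to stay inside one cylinder of radius
      \<open>n\<close>.\<close>
    define k where "k = max n1 (n + nat \<bar>p\<bar> + m)"
    have "emb D' f \<in> G" if D': "clopen D'" "D' \<subseteq> D" "D' \<subseteq> cyl k x" for D'
    proof -
      have fr': "free D' (of_int p + 2 + real m - of_int p)"
        by (rule free_mono[OF n1]) (use D'(3) cyl_mono[of n1 k x] in \<open>auto simp: k_def\<close>)
      define K where "K = {g \<in> Fc (of_int p) (of_int p + 2 + real m). emb D' g \<in> G}"
      have K: "subgrp K" unfolding K_def by (rule tsub_subgrp[OF G fr']) simp
      have "Fc (of_int p) (of_int p + 2 + real m) \<subseteq> K"
      proof (rule Fc_generated_by_unit_steps[OF K])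
        fix i assume i: "i \<le> m"
        define q where "q = p + int i"
        show "Fc (of_int p + real i) (of_int p + real i + 2) \<subseteq> K"
        proof
          fix g assume g: "g \<in> Fc (of_int p + real i) (of_int p + real i + 2)"
          have gb: "g \<in> Fc (of_int p) (of_int p + 2 + real m)" by (rule Fc_mono[OF g]) (use i in auto)
          have g': "shiftf q g \<in> Fc 0 2" using shiftf_Fc[OF g, of q] by (simp add: q_def)
          have "sh q ` D' \<subseteq> cyl n (sh q x)"
          proof
            fix z assume "z \<in> sh q ` D'"
            then obtain y where y: "y \<in> D'" "z = sh q y" by blast
            have "y \<in> S" "agree k x y" using D'(3) y(1) by (auto simp: cyl_def)
            moreover have "n + nat \<bar>q\<bar> \<le> k" using i unfolding q_def k_def by linarith
            ultimately have "agree n (sh q x) (sh q y)" using agree_sh agree_mono by blast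
            then show "z \<in> cyl n (sh q x)" using y(2) \<open>y \<in> S\<close> sh_iff by (simp add: cyl_def)
          qed
          then have "emb (sh q ` D') (shiftf q g) \<in> G" using sub[OF clopen_sh[OF D'(1)] _ _ g'] xS sh_iff by blast
          moreover have "emb (sh q ` D') (shiftf q g) = emb D' g"
            by (rule emb_shift[OF g]) (rule free_mono[OF fr'], auto)
          ultimately show "g \<in> K" unfolding K_def using gb by simp
        qed
      qed
      then show ?thesis using f' unfolding K_def by blast
    qed
    then show "\<exists>n. \<forall>D'. clopen D' \<and> D' \<subseteq> D \<and> D' \<subseteq> cyl n x \<longrightarrow> emb D' f \<in> G" by blast
  qed
qed

theorem TLG_finitely_generated: "finitely_generated TLG"
proof -
  \<comment> \<open>The generators have supports in \<open>[0,2]\<close> and are treated as elements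
    of \<open>Fc (-1) 3\<close>, an interval of length 4.\<close>
  obtain n where n: "\<forall>x\<in>S. free (cyl n x) 4" using free_uniform by blast
  define E where "E = (\<lambda>(P, r). emb P r) ` ({cyl n x | x. x \<in> S} \<times> small_rots)"
  have fin: "finite E" unfolding E_def
    by (intro finite_imageI finite_cartesian_product finite_cylinders finite_small_rots)
  have rF: "r \<in> Fc (-1) 3" if "r \<in> small_rots" for r
    by (rule Fsup_subset_Fc[of r 0 2]) (use that small_rots_Fsup in auto)
  have sub: "E \<subseteq> carrier TLG"
  proof
    fix g assume "g \<in> E"
    then obtain x r where x: "x \<in> S" "r \<in> small_rots" "g = emb (cyl n x) r" unfolding E_def by auto
    have "free (cyl n x) (3 - (-1))" using n x by simp
    then show "g \<in> carrier TLG" using emb_TL[OF clopen_cyl rF[OF x(2)]] x(3) by simp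
  qed
  have sg: "subgroup (generate TLG E) TLG" by (rule group.generate_is_subgroup[OF group_TLG sub])
  have ts: "tsub (generate TLG E)" by (rule subgroup_tsub[OF sg])
  have "TL \<subseteq> generate TLG E"
  proof (rule cylinder_charts_generate[OF ts, of n])
    show "\<forall>x\<in>S. free (cyl n x) 2"
    proof
      fix x assume "x \<in> S"
      then have "free (cyl n x) 4" using n by blast
      then show "free (cyl n x) 2" by (rule free_mono) auto
    qed
    fix x assume x: "x \<in> S"
    have fr: "free (cyl n x) (3 - (-1))" using n x by simp
    let ?K = "{f \<in> Fc (-1) 3. emb (cyl n x) f \<in> generate TLG E}"
    have K: "subgrp ?K" by (rule tsub_subgrp[OF ts fr]) simp
    have "small_rots \<subseteq> ?K"
    proof
      fix r assume r: "r \<in> small_rots"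
      then have "emb (cyl n x) r \<in> E" unfolding E_def using x by (intro image_eqI[of _ _ "(cyl n x, r)"]) auto
      then show "r \<in> ?K" using rF[OF r] generate.incl[of _ E TLG] by simp
    qed
    then have "Fsup 0 2 \<subseteq> ?K" by (rule small_rots_generate_Fsup[OF K])
    then show "chart_in (generate TLG E) (cyl n x)" unfolding chart_in_def using Fc_Fsup by blast
  qed
  moreover have "generate TLG E \<subseteq> TL" using tsubD(1)[OF ts] by blast
  ultimately have "generate TLG E = carrier TLG" by auto
  then show ?thesis unfolding finitely_generated_def using group_TLG fin sub by blast
qed

end



section \<open>The suspension\<close>

lemma simple_transfer:
  assumes h: "h \<in> iso G H" and G: "group G" and H: "group H" and s: "is_simple G"
  shows "is_simple H"
  unfolding is_simple_def
proof (intro conjI allI impI)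
  interpret gh: group_hom G H h using h G H by (simp add: group_hom_def group_hom_axioms_def iso_imp_homomorphism)
  have bij: "bij_betw h (carrier G) (carrier H)" using h by (simp add: iso_def)
  have im: "h ` carrier G = carrier H" using bij by (simp add: bij_betw_def)
  have inj: "inj_on h (carrier G)" using bij by (simp add: bij_betw_def)
  show "group H" by (rule H)
  show "carrier H \<noteq> {\<one>\<^bsub>H\<^esub>}"
  proof
    assume a: "carrier H = {\<one>\<^bsub>H\<^esub>}"
    have "x = \<one>\<^bsub>G\<^esub>" if "x \<in> carrier G" for x
    proof -
      have "h x \<in> carrier H" using that im by blast
      then have "h x = h \<one>\<^bsub>G\<^esub>" using a by simp
      then show ?thesis using inj_onD[OF inj _ that gh.G.one_closed] by blast
    qed
    then have "carrier G = {\<one>\<^bsub>G\<^esub>}" by blast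
    then show False using s unfolding is_simple_def by blast
  qed
  fix N assume N: "N \<lhd> H"
  define K where "K = {x \<in> carrier G. h x \<in> N}"
  have NH: "subgroup N H" and Nc: "\<And>x n. x \<in> carrier H \<Longrightarrow> n \<in> N \<Longrightarrow> x \<otimes>\<^bsub>H\<^esub> n \<otimes>\<^bsub>H\<^esub> inv\<^bsub>H\<^esub> x \<in> N"
    using N gh.H.normal_inv_iff by blast+
  have "subgroup K G"
  proof (rule gh.G.subgroupI)
    show "K \<subseteq> carrier G" unfolding K_def by blast
    have "\<one>\<^bsub>G\<^esub> \<in> K" unfolding K_def using subgroup.one_closed[OF NH] by simp
    then show "K \<noteq> {}" by blast
    show "inv\<^bsub>G\<^esub> a \<in> K" if "a \<in> K" for a using that subgroup.m_inv_closed[OF NH] unfolding K_def by simp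
    show "a \<otimes>\<^bsub>G\<^esub> b \<in> K" if "a \<in> K" "b \<in> K" for a b
      using that subgroup.m_closed[OF NH] unfolding K_def by simp
  qed
  moreover have "x \<otimes>\<^bsub>G\<^esub> n \<otimes>\<^bsub>G\<^esub> inv\<^bsub>G\<^esub> x \<in> K" if "x \<in> carrier G" "n \<in> K" for x n
    using that Nc[of "h x" "h n"] unfolding K_def by simp
  ultimately have "K \<lhd> G" using gh.G.normal_inv_iff by blast
  then have K: "K = carrier G \<or> K = {\<one>\<^bsub>G\<^esub>}" using s unfolding is_simple_def by blast
  have NK: "N = h ` K"
  proof -
    have "n \<in> h ` K" if n: "n \<in> N" for n
    proof -
      have "n \<in> carrier H" using n subgroup.subset[OF NH] by blast
      then obtain x where "x \<in> carrier G" "n = h x" using im by blast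
      then show ?thesis using n unfolding K_def by blast
    qed
    then show ?thesis unfolding K_def by blast
  qed
  show "N = carrier H \<or> N = {\<one>\<^bsub>H\<^esub>}"
    using K
  proof
    assume "K = carrier G" then show ?thesis using NK im by simp
  next
    assume "K = {\<one>\<^bsub>G\<^esub>}" then show ?thesis using NK by simp
  qed
qed

lemma finitely_generated_transfer:
  assumes h: "h \<in> iso G H" and G: "group G" and H: "group H" and s: "finitely_generated G"
  shows "finitely_generated H"
proof -
  interpret gh: group_hom G H h using h G H by (simp add: group_hom_def group_hom_axioms_def iso_imp_homomorphism)
  have im: "h ` carrier G = carrier H" using h by (simp add: iso_def bij_betw_def)
  obtain E where E: "finite E" "E \<subseteq> carrier G" "generate G E = carrier G" using s unfolding finitely_generated_def by blast
  have "generate H (h ` E) = carrier H" using gh.generate_img[OF E(2)] E(3) im by simp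
  moreover have "h ` E \<subseteq> carrier H" using E(2) im by blast
  ultimately show ?thesis unfolding finitely_generated_def using H E(1) by blast
qed

lemma left_orderable_transfer:
  assumes h: "h \<in> iso G H" and G: "group G" and H: "group H" and s: "left_orderable G"
  shows "left_orderable H"
proof -
  interpret gh: group_hom G H h using h G H by (simp add: group_hom_def group_hom_axioms_def iso_imp_homomorphism)
  have im: "h ` carrier G = carrier H" and inj: "inj_on h (carrier G)" using h by (simp_all add: iso_def bij_betw_def)
  obtain r where r: "linear_order_on (carrier G) r"
    "\<forall>a\<in>carrier G. \<forall>b\<in>carrier G. \<forall>c\<in>carrier G. (a, b) \<in> r \<longrightarrow> (c \<otimes>\<^bsub>G\<^esub> a, c \<otimes>\<^bsub>G\<^esub> b) \<in> r"
    using s unfolding left_orderable_def by blast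
  have rsub: "r \<subseteq> carrier G \<times> carrier G" and rrefl: "refl_on (carrier G) r" and rtrans: "trans r"
    and ranti: "antisym r" and rtot: "total_on (carrier G) r"
    using r(1) unfolding linear_order_on_def partial_order_on_def preorder_on_def by auto
  define r' where "r' = map_prod h h ` r"
  have mem: "(h a, h b) \<in> r' \<longleftrightarrow> (a, b) \<in> r" if "a \<in> carrier G" "b \<in> carrier G" for a b
  proof
    assume "(h a, h b) \<in> r'"
    then obtain a' b' where ab: "(a', b') \<in> r" "h a = h a'" "h b = h b'" unfolding r'_def by auto
    then have "a = a'" "b = b'" using inj_onD[OF inj] that rsub by blast+
    then show "(a, b) \<in> r" using ab(1) by simp
  qed (force simp: r'_def)
  have sub: "r' \<subseteq> carrier H \<times> carrier H" unfolding r'_def using rsub im by auto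
  have pre: "\<exists>a\<in>carrier G. y = h a" if "y \<in> carrier H" for y using that im by blast
  have "linear_order_on (carrier H) r'"
    unfolding linear_order_on_def partial_order_on_def preorder_on_def
  proof (intro conjI)
    show "r' \<subseteq> carrier H \<times> carrier H" by (rule sub)
    show "refl_on (carrier H) r'" unfolding refl_on_def
    proof (intro ballI)
      fix y assume "y \<in> carrier H"
      then obtain a where "a \<in> carrier G" "y = h a" using pre by blast
      then show "(y, y) \<in> r'" using mem[of a a] rrefl unfolding refl_on_def by blast
    qed
    show "trans r'"
    proof (rule transI)
      fix x y z assume xyz: "(x, y) \<in> r'" "(y, z) \<in> r'"
      then have "x \<in> carrier H" "y \<in> carrier H" "z \<in> carrier H" using sub by blast+
      then obtain a b c where abc: "a \<in> carrier G" "x = h a" "b \<in> carrier G" "y = h b" "c \<in> carrier G" "z = h c"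
        using pre by metis
      then have "(a, b) \<in> r" "(b, c) \<in> r" using xyz mem by simp_all
      then have "(a, c) \<in> r" using rtrans by (meson transD)
      then show "(x, z) \<in> r'" using abc mem by simp
    qed
    show "antisym r'"
    proof (rule antisymI)
      fix x y assume xy: "(x, y) \<in> r'" "(y, x) \<in> r'"
      then have "x \<in> carrier H" "y \<in> carrier H" using sub by blast+
      then obtain a b where ab: "a \<in> carrier G" "x = h a" "b \<in> carrier G" "y = h b" using pre by metis
      then have "(a, b) \<in> r" "(b, a) \<in> r" using xy mem by simp_all
      then show "x = y" using antisymD[OF ranti] ab by blast
    qed
    show "total_on (carrier H) r'" unfolding total_on_def
    proof (intro ballI impI)
      fix x y assume xy: "x \<in> carrier H" "y \<in> carrier H" "x \<noteq> y"
      then obtain a b where ab: "a \<in> carrier G" "x = h a" "b \<in> carrier G" "y = h b" using pre by metis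
      then have "a \<noteq> b" using xy(3) by blast
      then have "(a, b) \<in> r \<or> (b, a) \<in> r" using rtot[unfolded total_on_def, rule_format, OF ab(1,3)] by blast
      then show "(x, y) \<in> r' \<or> (y, x) \<in> r'" using ab mem by simp
    qed
  qed
  moreover have "(z \<otimes>\<^bsub>H\<^esub> x, z \<otimes>\<^bsub>H\<^esub> y) \<in> r'" if h3: "x \<in> carrier H" "y \<in> carrier H" "z \<in> carrier H" "(x, y) \<in> r'" for x y z
  proof -
    obtain a b c where abc: "a \<in> carrier G" "x = h a" "b \<in> carrier G" "y = h b" "c \<in> carrier G" "z = h c"
      using pre h3 by metis
    then have "(a, b) \<in> r" using h3 mem by simp
    then have "(c \<otimes>\<^bsub>G\<^esub> a, c \<otimes>\<^bsub>G\<^esub> b) \<in> r" using r(2) abc by blast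
    moreover have "c \<otimes>\<^bsub>G\<^esub> a \<in> carrier G" "c \<otimes>\<^bsub>G\<^esub> b \<in> carrier G" using abc by simp_all
    ultimately have "(h (c \<otimes>\<^bsub>G\<^esub> a), h (c \<otimes>\<^bsub>G\<^esub> b)) \<in> r'" using mem by blast
    moreover have "h (c \<otimes>\<^bsub>G\<^esub> a) = z \<otimes>\<^bsub>H\<^esub> x" "h (c \<otimes>\<^bsub>G\<^esub> b) = z \<otimes>\<^bsub>H\<^esub> y" using abc by simp_all
    ultimately show ?thesis by (simp only:)
  qed
  ultimately show ?thesis unfolding left_orderable_def using H by blast
qed

section \<open>Chart maps and their germs\<close>

lemma aff_on_translate:
  assumes "aff_on f A" "\<And>t. t \<in> B \<Longrightarrow> t - of_int n \<in> A" "\<And>t. t \<in> B \<Longrightarrow> h t = f (t - of_int n) + of_int n"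
  shows "aff_on h B"
proof -
  obtain m b where m: "b \<in> dyadic_rationals" "\<forall>t\<in>A. f t = 2 powi m * t + b"
    using assms(1) unfolding aff_on_def by blast
  have "h t = 2 powi m * t + (b + of_int n - 2 powi m * of_int n)" if "t \<in> B" for t
    using assms(3)[OF that] m(2)[rule_format, OF assms(2)[OF that]] by (simp add: algebra_simps)
  moreover have "b + of_int n - 2 powi m * of_int n \<in> dyadic_rationals"
    by (intro dyadic_diff dyadic_add dyadic_mult m dyadic_of_int dyadic_powi)
  ultimately show ?thesis unfolding aff_on_def by blast
qed

text \<open>Intervals that avoid the breakpoints omit the breakpoint \<open>c\<close> itself;
  continuity extends the affine formula to it.\<close>

lemma aff_on_closure_left:
  assumes "aff_on f {c-d..<c}" "d > 0" "isCont f c" shows "aff_on f {c-d..c}"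
proof -
  obtain m b where m: "b \<in> dyadic_rationals" "\<forall>t\<in>{c-d..<c}. f t = 2 powi m * t + b"
    using assms(1) unfolding aff_on_def by blast
  have "(f \<longlongrightarrow> f c) (at_left c)" using assms(3) by (simp add: isCont_def filterlim_at_split)
  moreover have "eventually (\<lambda>t. f t = 2 powi m * t + b) (at_left c)"
    by (rule eventually_mono[OF eventually_at_left_real[of "c - d" c]]) (use assms(2) m(2) in auto)
  ultimately have "((\<lambda>t. 2 powi m * t + b) \<longlongrightarrow> f c) (at_left c)" by (rule Lim_transform_eventually)
  moreover have "((\<lambda>t. 2 powi m * t + b) \<longlongrightarrow> 2 powi m * c + b) (at_left c)" by (intro tendsto_intros)
  ultimately have "f c = 2 powi m * c + b" using tendsto_unique[OF trivial_limit_at_left_real] by blast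
  then have "\<forall>t\<in>{c-d..c}. f t = 2 powi m * t + b" using m(2) by (auto simp: order_le_less)
  then show ?thesis unfolding aff_on_def using m(1) by blast
qed

lemma aff_on_closure_right:
  assumes "aff_on f {c<..c+d}" "d > 0" "isCont f c" shows "aff_on f {c..c+d}"
proof -
  obtain m b where m: "b \<in> dyadic_rationals" "\<forall>t\<in>{c<..c+d}. f t = 2 powi m * t + b"
    using assms(1) unfolding aff_on_def by blast
  have "(f \<longlongrightarrow> f c) (at_right c)" using assms(3) by (simp add: isCont_def filterlim_at_split)
  moreover have "eventually (\<lambda>t. f t = 2 powi m * t + b) (at_right c)"
    by (rule eventually_mono[OF eventually_at_right_real[of c "c + d"]]) (use assms(2) m(2) in auto)
  ultimately have "((\<lambda>t. 2 powi m * t + b) \<longlongrightarrow> f c) (at_right c)" by (rule Lim_transform_eventually)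
  moreover have "((\<lambda>t. 2 powi m * t + b) \<longlongrightarrow> 2 powi m * c + b) (at_right c)" by (intro tendsto_intros)
  ultimately have "f c = 2 powi m * c + b" using tendsto_unique[OF trivial_limit_at_right_real] by blast
  then have "\<forall>t\<in>{c..c+d}. f t = 2 powi m * t + b" using m(2) by (auto simp: order_le_less)
  then show ?thesis unfolding aff_on_def using m(1) by blast
qed

lemma dyadic_PL_homeo_germ:
  assumes f: "dyadic_PL_homeo J K f" and J: "J = {a<..<b}" and t: "t \<in> J"
  obtains e where "e > 0" "{t-e..t+e} \<subseteq> J" "aff_on f {t-e..t}" "aff_on f {t..t+e}"
    "t \<in> dyadic_rationals \<or> aff_on f {t-e..t+e}"
proof -
  have "\<exists>B. finite B \<and> B \<subseteq> dyadic_rationals \<and> (\<forall>I. is_interval I \<and> I \<subseteq> J - B \<longrightarrow> aff_on f I)"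
    using f unfolding dyadic_PL_homeo_def aff_on_def by (elim conjE)
  then obtain B where B: "finite B" "B \<subseteq> dyadic_rationals" and aff: "\<And>I. is_interval I \<Longrightarrow> I \<subseteq> J - B \<Longrightarrow> aff_on f I"
    by blast
  have "homeomorphic_map (top_of_set J) (top_of_set K) f" using f unfolding dyadic_PL_homeo_def by blast
  then have "continuous_map (top_of_set J) (top_of_set K) f" by (rule homeomorphic_imp_continuous_map)
  then have "continuous_on J f" by auto
  moreover have "open J" unfolding J by simp
  ultimately have cont: "isCont f t" using t continuous_on_eq_continuous_at by blast
  \<comment> \<open>Discarding all breakpoints other than \<open>t\<close> leaves a neighbourhood in
    which \<open>f\<close> is affine on each side of \<open>t\<close>.\<close>
  have "open (J - (B - {t}))" using \<open>open J\<close> B(1) by (intro open_Diff finite_imp_closed) auto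
  moreover have "t \<in> J - (B - {t})" using t by blast
  ultimately obtain d where d: "d > 0" "cball t d \<subseteq> J - (B - {t})" using open_contains_cball by blast
  have cb: "cball t d = {t-d..t+d}" by (auto simp: cball_def dist_real_def abs_le_iff)
  have dJ: "x \<in> J \<and> (x \<in> B \<longrightarrow> x = t)" if "t - d \<le> x" "x \<le> t + d" for x
  proof -
    have "x \<in> cball t d" unfolding cb using that by simp
    then show ?thesis using d(2) by blast
  qed
  have s1: "x \<in> J - B" if "x \<in> {t-d..<t}" for x using dJ[of x] that d(1) by auto
  have s2: "x \<in> J - B" if "x \<in> {t<..t+d}" for x using dJ[of x] that d(1) by auto
  have 1: "aff_on f {t-d..<t}" by (rule aff[OF _ subsetI[OF s1]]) (auto simp: is_interval_1)
  have 2: "aff_on f {t<..t+d}" by (rule aff[OF _ subsetI[OF s2]]) (auto simp: is_interval_1)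
  have 3: "aff_on f {t-d..t+d}" if tB: "t \<notin> B"
  proof (rule aff)
    show "{t-d..t+d} \<subseteq> J - B"
    proof
      fix x assume "x \<in> {t-d..t+d}"
      then show "x \<in> J - B" using dJ[of x] tB by auto
    qed
  qed (auto simp: is_interval_1)
  show thesis
  proof (rule that[OF d(1)])
    show "{t-d..t+d} \<subseteq> J" using d(2) cb by blast
    show "aff_on f {t-d..t}" by (rule aff_on_closure_left[OF 1 d(1) cont])
    show "aff_on f {t..t+d}" by (rule aff_on_closure_right[OF 2 d(1) cont])
    show "t \<in> dyadic_rationals \<or> aff_on f {t-d..t+d}" using 3 B(2) by blast
  qed
qed

lemma PL_continuous: "f \<in> PL \<Longrightarrow> continuous_on A f"
  using PLloc_isCont PL_def continuous_at_imp_continuous_on by blast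

lemma PL_image_Ioo: assumes "f \<in> PL" shows "f ` {u<..<v} = {f u<..<f v}"
proof
  show "f ` {u<..<v} \<subseteq> {f u<..<f v}" using PL_less_iff[OF assms] by auto
  show "{f u<..<f v} \<subseteq> f ` {u<..<v}"
  proof
    fix y assume "y \<in> {f u<..<f v}"
    then have "finv f y \<in> {u<..<v}"
      using PL_less_iff[OF assms, of u "finv f y"] PL_less_iff[OF assms, of "finv f y" v] PL_inv_eq[OF assms] by simp
    then have "f (finv f y) \<in> f ` {u<..<v}" by (rule imageI)
    then show "y \<in> f ` {u<..<v}" using PL_inv_eq[OF assms] by simp
  qed
qed

lemma dyadic_interval_Ioo:
  assumes "u < v" "u \<in> dyadic_rationals" "v \<in> dyadic_rationals" shows "dyadic_interval {u<..<v}"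
  using assms unfolding dyadic_interval_def by (auto simp: is_interval_1)

lemma PL_local_dyadic_PL_homeo:
  assumes f: "f \<in> PL" and uv: "u < t" "t < v" "u \<in> dyadic_rationals" "v \<in> dyadic_rationals"
    and e: "t - e \<le> u" "v \<le> t + e" "aff_on f {t-e..t}" "aff_on f {t..t+e}" "t \<in> dyadic_rationals \<or> aff_on f {t-e..t+e}"
  shows "dyadic_PL_homeo {u<..<v} (f ` {u<..<v}) f"
  unfolding dyadic_PL_homeo_def
proof (intro conjI)
  show "dyadic_interval {u<..<v}" by (rule dyadic_interval_Ioo) (use uv in auto)
  show "dyadic_interval (f ` {u<..<v})" unfolding PL_image_Ioo[OF f]
    by (rule dyadic_interval_Ioo) (use uv PL_less_iff[OF f] PL_dyadic[OF f] in auto)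
  have "homeomorphic_maps (top_of_set {u<..<v}) (top_of_set (f ` {u<..<v})) f (finv f)"
    unfolding homeomorphic_maps_def
  proof (intro conjI ballI)
    show "continuous_map (top_of_set {u<..<v}) (top_of_set (f ` {u<..<v})) f"
      using PL_continuous[OF f] by auto
    show "continuous_map (top_of_set (f ` {u<..<v})) (top_of_set {u<..<v}) (finv f)"
      using PL_continuous[OF PL_inv[OF f]] PL_inv_eq(1)[OF f] by auto
  qed (use PL_inv_eq[OF f] in auto)
  then show "homeomorphic_map (top_of_set {u<..<v}) (top_of_set (f ` {u<..<v})) f"
    using homeomorphic_map_maps by blast
  \<comment> \<open>Within this neighbourhood \<open>t\<close> is the only possible breakpoint, and
    only if it is dyadic; otherwise \<open>f\<close> is affine across it.\<close>
  show "\<exists>B. finite B \<and> B \<subseteq> dyadic_rationals \<and> (\<forall>I. is_interval I \<and> I \<subseteq> {u<..<v} - B \<longrightarrow>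
          (\<exists>(m::int) b. b \<in> dyadic_rationals \<and> (\<forall>x\<in>I. f x = 2 powi m * x + b)))"
    unfolding aff_on_def[symmetric]
  proof (intro exI[of _ "{t} \<inter> dyadic_rationals"] conjI allI impI)
    fix I assume I: "is_interval I \<and> I \<subseteq> {u<..<v} - {t} \<inter> dyadic_rationals"
    show "aff_on f I"
    proof (cases "t \<in> dyadic_rationals")
      case False
      then have "aff_on f {t-e..t+e}" using e by blast
      then show ?thesis by (rule aff_on_subset) (use I e(1,2) in force)
    next
      case True
      then have tI: "t \<notin> I" using I by blast
      have "I \<subseteq> {t-e..t} \<or> I \<subseteq> {t..t+e}"
      proof (rule ccontr)
        assume "\<not> (I \<subseteq> {t-e..t} \<or> I \<subseteq> {t..t+e})"
        then obtain x y where xy: "x \<in> I" "x \<notin> {t-e..t}" "y \<in> I" "y \<notin> {t..t+e}" by blast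
        then have "u < x" "x < v" "u < y" "y < v" using I by auto
        then have "t < x" "y < t" using xy e(1,2) by auto
        then have "t \<in> I" using I xy unfolding is_interval_1 by (meson less_imp_le)
        then show False using tI by blast
      qed
      then show ?thesis using aff_on_subset e(3,4) by blast
    qed
  qed auto
qed

text \<open>Convex combinations with the identity stay in this class, while their slopes need not be
  powers of 2; it therefore serves for the isotopy.\<close>

definition HM :: "(real \<Rightarrow> real) set" where
  "HM = {f. strict_mono f \<and> surj f \<and> continuous_on UNIV f}"

lemma PL_subset_HM: "PL \<subseteq> HM"
  unfolding HM_def using PL_strict_mono PL_surj PL_continuous by blast

lemma HM_bij: "f \<in> HM \<Longrightarrow> bij f"
  unfolding HM_def bij_betw_def using strict_mono_imp_inj_on by blast

lemma HM_inv: assumes "f \<in> HM" shows "finv f \<in> HM"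
proof -
  have f: "strict_mono f" "surj f" "continuous_on UNIV f" using assms by (auto simp: HM_def)
  have b: "bij f" by (rule HM_bij[OF assms])
  have sm: "strict_mono (finv f)"
  proof (rule strict_monoI)
    fix x y :: real assume "x < y"
    then have "f (finv f x) < f (finv f y)" using surj_f_inv_f[OF f(2)] by simp
    then show "finv f x < finv f y" using strict_mono_less[OF f(1)] by blast
  qed
  have su: "surj (finv f)" by (rule inj_imp_surj_inv[OF bij_is_inj[OF b]])
  have "continuous_on UNIV (finv f)"
    by (rule continuous_onI_mono) (use su sm in \<open>auto simp: strict_mono_less_eq\<close>)
  then show ?thesis unfolding HM_def using sm su by blast
qed



section \<open>Topology of the subshift in terms of cylinders\<close>

lemma shift_sh: "shift = sh 1"
  by (simp add: fun_eq_iff shift_def sh_def)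

lemma funpow_shift: "(shift ^^ n) x = sh (int n) x"
  by (induction n) (simp_all add: shift_sh add.commute)

lemma sh_period: assumes "sh p x = x" shows "sh (k * p) x = x"
proof -
  have nat: "sh (int n * p) x = x" for n
  proof (induction n)
    case (Suc n)
    have "sh (int (Suc n) * p) x = sh (int n * p) (sh p x)" by (simp add: distrib_right add.commute)
    then show ?case using assms Suc by simp
  qed simp
  show ?thesis
  proof (cases "0 \<le> k")
    case True then show ?thesis using nat[of "nat k"] by simp
  next
    case False
    have "sh (k * p) x = sh (k * p) (sh (int (nat (- k)) * p) x)" by (simp only: nat)
    also have "\<dots> = x" using False by (simp add: algebra_simps)
    finally show ?thesis .
  qed
qed

locale minimal_subshift =
  fixes A :: "'a set" and X :: "(int \<Rightarrow> 'a) topology"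
  assumes finite_alphabet: "finite A" and subshift: "subshift A X"
    and minimal: "minimal_system X shift" and infinite: "infinite (topspace X)"
begin

abbreviation S :: "(int \<Rightarrow> 'a) set" where "S \<equiv> topspace X"

lemma stone: "compact_space X" "Hausdorff_space X" "S \<noteq> {}"
  using subshift_stone_system[OF finite_alphabet subshift] unfolding stone_system_def by blast+

lemma subshift_eq: "shift ` S = S" "X = subtopology (full_shift A) S" "x \<in> S \<Longrightarrow> x i \<in> A"
proof -
  obtain T where T: "closedin (full_shift A) T" "shift ` T = T" "X = subtopology (full_shift A) T"
    using subshift unfolding subshift_def by blast
  have TA: "T \<subseteq> topspace (full_shift A)" using closedin_subset[OF T(1)] .
  then have TS: "S = T" unfolding T(3) by auto
  show "shift ` S = S" "X = subtopology (full_shift A) S" using T unfolding TS by blast+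
  show "x \<in> S \<Longrightarrow> x i \<in> A" using TA unfolding TS full_shift_def by (auto simp: PiE_def Pi_def)
qed

lemma sh_S: assumes "x \<in> S" shows "sh k x \<in> S"
proof -
  have up: "sh 1 x \<in> S" if "x \<in> S" for x
    using imageI[OF that, of shift] subshift_eq(1) by (simp add: shift_sh)
  have down: "sh (-1) x \<in> S" if x: "x \<in> S" for x
  proof -
    obtain y where "y \<in> S" "x = shift y" using x subshift_eq(1) by blast
    then show ?thesis by (simp add: shift_sh)
  qed
  show ?thesis
  proof (induction k rule: int_induct[where k = 0])
    case base then show ?case using assms by simp
  next
    case (step1 i) then show ?case using up[of "sh i x"] by (simp add: add.commute)
  next
    case (step2 i) then show ?case using down[of "sh i x"] by simp
  qed
qed

lemma inv_shift: assumes "x \<in> S" shows "inv_into S shift x = sh (-1) x"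
proof (rule inv_into_f_eq)
  show "inj_on shift S"
  proof (rule inj_onI)
    fix x y assume "shift x = shift y"
    then have "sh (-1) (sh 1 x) = sh (-1) (sh 1 y)" by (simp only: shift_sh)
    then show "x = y" by simp
  qed
  show "sh (-1) x \<in> S" by (rule sh_S[OF assms])
  show "shift (sh (-1) x) = x" by (simp add: shift_sh)
qed

lemma int_iter_shift: assumes "x \<in> S" shows "int_iter S shift k x = sh k x"
proof (cases "0 \<le> k")
  case True then show ?thesis by (simp add: int_iter_def funpow_shift)
next
  case False
  have "(inv_into S shift ^^ n) x = sh (- int n) x" for n
  proof (induction n)
    case (Suc n)
    then have "(inv_into S shift ^^ Suc n) x = inv_into S shift (sh (- int n) x)" by simp
    also have "\<dots> = sh (-1) (sh (- int n) x)" by (rule inv_shift[OF sh_S[OF assms]])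
    also have "\<dots> = sh (- int (Suc n)) x" by simp
    finally show ?case .
  qed simp
  then show ?thesis using False by (simp add: int_iter_def)
qed

lemma openin_cylinder: "openin X {y \<in> S. agree n x y}"
proof (cases "\<exists>z\<in>S. agree n x z")
  case True
  \<comment> \<open>The centre \<open>x\<close> may use letters outside \<open>A\<close>, whose
    singletons are not open in the discrete topology on \<open>A\<close>; a centre in
    \<open>S\<close> does not.\<close>
  then obtain z where z: "z \<in> S" "agree n x z" by blast
  have coord: "continuous_map X (discrete_topology A) (\<lambda>x. x i)" for i
    by (subst subshift_eq(2)) (auto simp: full_shift_def intro!: continuous_map_from_subtopology continuous_map_product_projection)
  have "openin X {y \<in> S. y i \<in> {z i}}" for i
    by (rule openin_continuous_map_preimage[OF coord]) (use subshift_eq(3)[OF z(1)] in simp)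
  then have "openin X ((\<Inter>i\<in>{- int n..int n}. {y \<in> S. y i \<in> {z i}}) \<inter> S)" by (intro openin_INT) auto
  moreover have "(\<Inter>i\<in>{- int n..int n}. {y \<in> S. y i \<in> {z i}}) \<inter> S = {y \<in> S. agree n x y}"
    using z(2) by (auto simp: agree_def abs_le_iff)
  ultimately show ?thesis by simp
next
  case False
  then have "{y \<in> S. agree n x y} = {}" by blast
  then show ?thesis by (simp only: openin_empty)
qed

lemma closedin_cylinder: "closedin X {y \<in> S. agree n x y}"
proof -
  have "S - {y \<in> S. agree n x y} = \<Union>((\<lambda>z. {y \<in> S. agree n z y}) ` {z \<in> S. \<not> agree n x z})"
  proof (intro equalityI subsetI)
    fix z assume "z \<in> S - {y \<in> S. agree n x y}"
    then show "z \<in> \<Union>((\<lambda>z. {y \<in> S. agree n z y}) ` {z \<in> S. \<not> agree n x z})" by auto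
  next
    fix y assume "y \<in> \<Union>((\<lambda>z. {y \<in> S. agree n z y}) ` {z \<in> S. \<not> agree n x z})"
    then obtain z where "\<not> agree n x z" "agree n z y" "y \<in> S" by blast
    then show "y \<in> S - {y \<in> S. agree n x y}" using agree_trans[of n x y z] agree_sym[of n z y] by blast
  qed
  then show ?thesis using openin_cylinder by (auto simp: closedin_def)
qed

text \<open>A basic open set of the product restricts only finitely many coordinates, and one window
  contains them all.\<close>

lemma openin_contains_cylinder:
  assumes U: "openin X U" and x: "x \<in> U" shows "\<exists>n. {y \<in> S. agree n x y} \<subseteq> U"
proof -
  obtain T where T: "openin (full_shift A) T" "U = T \<inter> S"
    using U subshift_eq(2) openin_subtopology by metis
  have "x \<in> T" using x T by blast
  then obtain V where V: "finite {i \<in> UNIV. V i \<noteq> topspace (discrete_topology A)}" "x \<in> Pi\<^sub>E UNIV V" "Pi\<^sub>E UNIV V \<subseteq> T"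
    using T(1) unfolding full_shift_def openin_product_topology_alt by blast
  define n where "n = (\<Sum>i | V i \<noteq> A. nat \<bar>i\<bar>)"
  have fin: "finite {i. V i \<noteq> A}" using V(1) by simp
  have "y \<in> U" if y: "y \<in> S" "agree n x y" for y
  proof -
    have "y i \<in> V i" for i
    proof (cases "V i = A")
      case True then show ?thesis using subshift_eq(3)[OF y(1)] by simp
    next
      case False
      have "nat \<bar>i\<bar> \<le> n" unfolding n_def by (rule member_le_sum) (use fin False in auto)
      then have "x i = y i" using y(2) unfolding agree_def by auto
      moreover have "x i \<in> V i" using V(2) by (auto simp: PiE_iff)
      ultimately show ?thesis by simp
    qed
    then have "y \<in> T" using V(3) by (auto simp: PiE_iff)
    then show ?thesis using T(2) y(1) by blast
  qed
  then show ?thesis by blast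
qed

sublocale minimal_shift S
proof
  show "S \<noteq> {}" by (rule stone)
  show "sh k x \<in> S" if "x \<in> S" for x k by (rule sh_S[OF that])
  show compactness: "\<exists>F. finite F \<and> F \<subseteq> S \<and> (\<forall>y\<in>S. \<exists>x\<in>F. agree (nn x) x y)" for nn
  proof -
    define U where "U = (\<lambda>x. {y \<in> S. agree (nn x) x y}) ` S"
    have "\<Union>U = S" unfolding U_def by auto
    moreover have "\<forall>u\<in>U. openin X u" unfolding U_def using openin_cylinder by simp
    ultimately have "\<exists>V. finite V \<and> V \<subseteq> U \<and> \<Union>V = S"
      by (intro mp[OF spec[OF iffD1[OF compact_space stone(1)], of U]] conjI)
    then obtain V where V: "finite V" "V \<subseteq> U" "\<Union>V = S" by (elim exE conjE)
    obtain F where F: "F \<subseteq> S" "finite F" "V = (\<lambda>x. {y \<in> S. agree (nn x) x y}) ` F"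
      using finite_subset_image[OF V(1) V(2)[unfolded U_def]] by (elim exE conjE)
    have "\<forall>y\<in>S. \<exists>x\<in>F. agree (nn x) x y" using V(3) unfolding F(3) by auto
    then show ?thesis using F by blast
  qed
  show dense: "\<exists>k. agree n y (sh k x)" if x: "x \<in> S" and y: "y \<in> S" for x y n
  proof -
    have "y \<in> X closure_of range (\<lambda>k. int_iter S shift k x)"
      using minimal x y unfolding minimal_system_def by blast
    then have "\<forall>T. y \<in> T \<and> openin X T \<longrightarrow> (\<exists>z. z \<in> range (\<lambda>k. int_iter S shift k x) \<and> z \<in> T)"
      unfolding in_closure_of by (elim conjE)
    then have "y \<in> {z \<in> S. agree n y z} \<and> openin X {z \<in> S. agree n y z} \<longrightarrow>
        (\<exists>z. z \<in> range (\<lambda>k. int_iter S shift k x) \<and> z \<in> {z \<in> S. agree n y z})" by (rule spec)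
    then obtain z where "z \<in> range (\<lambda>k. int_iter S shift k x)" "z \<in> {z \<in> S. agree n y z}"
      using openin_cylinder[of n y] y by auto
    then show ?thesis using int_iter_shift[OF x] by auto
  qed
  \<comment> \<open>A periodic point has a finite orbit. A point off a finite set is separated from
    all of it by one window, so density would make \<open>S\<close> finite.\<close>
  show "p = 0" if x: "x \<in> S" and p: "sh p x = x" for x p
  proof (rule ccontr)
    assume p0: "p \<noteq> 0"
    define Orb where "Orb = (\<lambda>k. sh k x) ` {0..<\<bar>p\<bar>}"
    have orb: "sh k x \<in> Orb" for k
    proof -
      have "sh \<bar>p\<bar> x = x" using sh_period[OF p, of "sgn p"] by (simp add: mult.commute abs_sgn[symmetric])
      from sh_period[OF this, of "k div \<bar>p\<bar>"] have "sh (k mod \<bar>p\<bar>) (sh (k div \<bar>p\<bar> * \<bar>p\<bar>) x) = sh (k mod \<bar>p\<bar>) x" by simp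
      then have "sh k x = sh (k mod \<bar>p\<bar>) x" by simp
      moreover have "k mod \<bar>p\<bar> \<in> {0..<\<bar>p\<bar>}" using p0 by simp
      ultimately show ?thesis unfolding Orb_def by blast
    qed
    have fin: "finite Orb" unfolding Orb_def by simp
    have "S \<subseteq> Orb"
    proof
      fix y assume y: "y \<in> S"
      show "y \<in> Orb"
      proof (rule ccontr)
        assume "y \<notin> Orb"
        then have "\<forall>z\<in>Orb. \<exists>i. y i \<noteq> z i" by (metis ext)
        then obtain i where i: "\<forall>z\<in>Orb. y (i z) \<noteq> z (i z)" by metis
        define n where "n = (\<Sum>z\<in>Orb. nat \<bar>i z\<bar>)"
        obtain k where k: "agree n y (sh k x)" using dense[OF x y] by blast
        have "nat \<bar>i (sh k x)\<bar> \<le> n" unfolding n_def by (rule member_le_sum[OF orb]) (use fin in auto)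
        then have "\<bar>i (sh k x)\<bar> \<le> int n" by simp
        then have "y (i (sh k x)) = sh k x (i (sh k x))" using k unfolding agree_def by blast
        then show False using i orb by blast
      qed
    qed
    then show False using infinite fin finite_subset by blast
  qed
qed

section \<open>From lifts to homeomorphisms of the suspension\<close>

abbreviation "Y \<equiv> suspension X shift"
abbreviation "q \<equiv> susp_class X shift"
abbreviation "P \<equiv> prod_topology X euclideanreal"

lemma q_eq: "x \<in> S \<Longrightarrow> q (x, t) = range (\<lambda>n. (sh n x, t - of_int n))"
  unfolding susp_class_def susp_action_def using int_iter_shift by simp

lemma q_eq_iff: assumes "x \<in> S" "y \<in> S" shows "q (x, t) = q (y, s) \<longleftrightarrow> (\<exists>n. y = sh n x \<and> s = t - of_int n)"
proof
  assume "q (x, t) = q (y, s)"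
  moreover have "(sh 0 y, s - of_int 0) \<in> q (y, s)" unfolding q_eq[OF assms(2)] by (rule rangeI)
  ultimately have "(y, s) \<in> q (x, t)" by simp
  then show "\<exists>n. y = sh n x \<and> s = t - of_int n" unfolding q_eq[OF assms(1)] by auto
next
  assume "\<exists>n. y = sh n x \<and> s = t - of_int n"
  then obtain n where n: "y = sh n x" "s = t - of_int n" by blast
  define f where "f = (\<lambda>k. (sh k x, t - of_int k))"
  have "range (\<lambda>m. (sh m y, s - of_int m)) = range (\<lambda>m. f (m + n))"
    by (simp add: n f_def algebra_simps)
  also have "\<dots> = f ` range (\<lambda>m. m + n)" by (simp only: image_image)
  also have "range (\<lambda>m. m + n) = (UNIV :: int set)" by (rule surjI[where f = "\<lambda>m. m - n"]) simp
  finally show "q (x, t) = q (y, s)" unfolding q_eq[OF assms(1)] q_eq[OF assms(2)] by (simp add: f_def)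
qed

lemma q_sh: "x \<in> S \<Longrightarrow> q (sh n x, t) = q (x, t + of_int n)"
  using q_eq_iff[of x "sh n x" "t + of_int n" t] sh_S by auto

text \<open>Aperiodicity makes the orbit map of the flow injective on each line; uniqueness of lifts
  rests on this.\<close>

lemma q_inject: assumes "x \<in> S" "q (x, t) = q (x, s)" shows "t = s"
proof -
  obtain n where n: "x = sh n x" "s = t - of_int n" using assms q_eq_iff by blast
  then have "n = 0" using aperiodic[OF assms(1), of n] by simp
  then show ?thesis using n by simp
qed

lemma Y_cases: assumes "y \<in> topspace Y" obtains x t where "x \<in> S" "y = q (x, t)"
  using assms unfolding topspace_suspension by auto

lemma q_in_Y: "x \<in> S \<Longrightarrow> q (x, t) \<in> topspace Y"
  unfolding topspace_suspension by blast

lemma qmap: "quotient_map P Y q" by (rule quotient_map_susp_class)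

text \<open>Mapping a whole class pointwise avoids choosing a representative; equivariance makes the
  image a class again.\<close>

definition psi :: "((int \<Rightarrow> 'a) \<Rightarrow> real \<Rightarrow> real) \<Rightarrow> ((int \<Rightarrow> 'a) \<times> real) set \<Rightarrow> ((int \<Rightarrow> 'a) \<times> real) set" where
  "psi F = restrict (\<lambda>y. (\<lambda>(x, t). (x, F x t)) ` y) (topspace Y)"

lemma psi_q: assumes F: "F \<in> lifts Q" and x: "x \<in> S" shows "psi F (q (x, t)) = q (x, F x t)"
proof -
  have "psi F (q (x, t)) = (\<lambda>(x, t). (x, F x t)) ` q (x, t)" unfolding psi_def using q_in_Y[OF x] by simp
  also have "\<dots> = range (\<lambda>n. (sh n x, F (sh n x) (t - of_int n)))" unfolding q_eq[OF x] by (simp add: image_image)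
  also have "\<dots> = range (\<lambda>n. (sh n x, F x t - of_int n))" using liftsD(3)[OF F x] by simp
  finally show ?thesis unfolding q_eq[OF x] .
qed

lemma psi_mult:
  assumes F: "F \<in> lifts Q" and G: "G \<in> lifts Q" and FG: "mulF F G \<in> lifts Q" and y: "y \<in> topspace Y"
  shows "psi (mulF F G) y = psi F (psi G y)"
proof -
  obtain x t where xt: "x \<in> S" "y = q (x, t)" using Y_cases[OF y] .
  show ?thesis unfolding xt(2) psi_q[OF FG xt(1)] psi_q[OF G xt(1)] psi_q[OF F xt(1)] mulF_apply ..
qed

text \<open>On a cylinder times a bounded interval a lift depends on time alone, so continuity of
  the single map \<open>F x\<close> suffices.\<close>

lemma continuous_lift:
  assumes F: "F \<in> lifts HM" shows "continuous_map P euclideanreal (\<lambda>p. F (fst p) (snd p))"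
  unfolding continuous_map_def
proof (intro conjI allI impI)
  show "(\<lambda>p. F (fst p) (snd p)) \<in> topspace P \<rightarrow> topspace euclideanreal" by simp
  fix U :: "real set" assume U: "openin euclideanreal U"
  show "openin P {p \<in> topspace P. F (fst p) (snd p) \<in> U}"
    unfolding openin_prod_topology_alt
  proof (intro allI impI)
    fix x t assume xt: "(x, t) \<in> {p \<in> topspace P. F (fst p) (snd p) \<in> U}"
    then have x: "x \<in> S" "F x t \<in> U" by auto
    define M where "M = nat \<lceil>\<bar>t\<bar> + 1\<rceil>"
    have M: "\<bar>t\<bar> < real M" unfolding M_def by linarith
    obtain n where n: "\<forall>x\<in>S. \<forall>y\<in>S. agree n x y \<longrightarrow> (\<forall>t. \<bar>t\<bar> \<le> real M \<longrightarrow> F x t = F y t)"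
      using liftsD(4)[OF F, of M] by (elim exE)
    have "continuous_on UNIV (F x)" using liftsD(2)[OF F x(1)] unfolding HM_def by blast
    then have o1: "open (F x -` U)" using U by (simp add: continuous_on_open_vimage)
    have "open ({- real M<..<real M} \<inter> F x -` U)" by (intro open_Int o1) simp
    moreover have "t \<in> {- real M<..<real M} \<inter> F x -` U" using M x(2) by auto
    moreover have "cyl n x \<times> ({- real M<..<real M} \<inter> F x -` U) \<subseteq> {p \<in> topspace P. F (fst p) (snd p) \<in> U}"
    proof clarify
      fix y s assume y: "y \<in> cyl n x" and s: "s \<in> {- real M<..<real M}" "F x s \<in> U"
      have yS: "y \<in> S" "agree n x y" using y by (auto simp: cyl_def)
      have "\<bar>s\<bar> \<le> real M" using s(1) by auto
      then have "F x s = F y s" by (rule n[rule_format, OF x(1) yS])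
      then show "(y, s) \<in> topspace P \<and> F (fst (y, s)) (snd (y, s)) \<in> U" using s(2) yS by simp
    qed
    moreover have "openin X (cyl n x)" unfolding cyl_def by (rule openin_cylinder)
    ultimately show "\<exists>V W. openin X V \<and> openin euclideanreal W \<and> x \<in> V \<and> t \<in> W \<and>
        V \<times> W \<subseteq> {p \<in> topspace P. F (fst p) (snd p) \<in> U}"
      using cyl_self[OF x(1), of n] by (intro exI[of _ "cyl n x"] exI[of _ "{- real M<..<real M} \<inter> F x -` U"]) auto
  qed
qed

lemma psi_continuous: assumes F: "F \<in> lifts HM" shows "continuous_map Y Y (psi F)"
proof (rule continuous_compose_quotient_map[OF qmap])
  have "continuous_map P P (\<lambda>p. (fst p, F (fst p) (snd p)))"
    by (intro continuous_map_pairedI continuous_lift[OF F] continuous_map_fst)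
  then have "continuous_map P Y (q \<circ> (\<lambda>p. (fst p, F (fst p) (snd p))))"
    by (rule continuous_map_compose) (rule quotient_imp_continuous_map[OF qmap])
  then show "continuous_map P Y (psi F \<circ> q)"
    by (rule continuous_map_eq) (auto simp: psi_q[OF F])
qed

lemma lifts_HM_inv: "F \<in> lifts HM \<Longrightarrow> invF F \<in> lifts HM"
  by (rule lifts_inv[OF HM_inv HM_bij])

lemma invF_cancel:
  assumes "F \<in> lifts HM" "x \<in> S" shows "F x (invF F x t) = t" "invF F x (F x t) = t"
  using HM_bij[OF liftsD(2)[OF assms]] by (auto simp: invF_def bij_is_inj bij_is_surj surj_f_inv_f)

lemma psi_homeomorphic: assumes F: "F \<in> lifts HM" shows "homeomorphic_map Y Y (psi F)"
proof -
  have "homeomorphic_maps Y Y (psi F) (psi (invF F))"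
    unfolding homeomorphic_maps_def
  proof (intro conjI ballI)
    show "continuous_map Y Y (psi F)" "continuous_map Y Y (psi (invF F))"
      using psi_continuous F lifts_HM_inv by blast+
    fix y assume y: "y \<in> topspace Y"
    then obtain x t where xt: "x \<in> S" "y = q (x, t)" using Y_cases by metis
    show "psi (invF F) (psi F y) = y" "psi F (psi (invF F) y) = y"
      unfolding xt(2) psi_q[OF F xt(1)] psi_q[OF lifts_HM_inv[OF F] xt(1)] invF_cancel[OF F xt(1)] by (rule refl)+
  qed
  then show ?thesis using homeomorphic_map_maps by blast
qed

text \<open>Convex combinations of a lift with the identity are again lifts, which yields the isotopy.\<close>

definition blend :: "real \<Rightarrow> ((int \<Rightarrow> 'a) \<Rightarrow> real \<Rightarrow> real) \<Rightarrow> (int \<Rightarrow> 'a) \<Rightarrow> real \<Rightarrow> real" where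
  "blend s F x = (if x \<in> S then (\<lambda>t. (1 - s) * t + s * F x t) else id)"

lemma blend_lifts:
  assumes F: "F \<in> lifts HM" and s: "0 \<le> s" "s \<le> 1" shows "blend s F \<in> lifts HM"
proof -
  obtain L :: nat where L: "\<forall>x\<in>S. \<forall>t. \<bar>F x t - t\<bar> \<le> L" using liftsD(5)[OF F] by blast
  have disp: "\<bar>blend s F x t - t\<bar> \<le> L" if x: "x \<in> S" for x t
  proof -
    have "blend s F x t - t = s * (F x t - t)" using x by (simp add: blend_def algebra_simps)
    then have "\<bar>blend s F x t - t\<bar> = s * \<bar>F x t - t\<bar>" using s by (simp add: abs_mult)
    also have "\<dots> \<le> 1 * \<bar>F x t - t\<bar>" using s by (intro mult_right_mono) auto
    also have "\<dots> \<le> L" using L x by simp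
    finally show ?thesis .
  qed
  show ?thesis unfolding lifts_def
  proof (intro CollectI conjI allI ballI impI)
    show "blend s F x = id" if "x \<notin> S" for x using that by (simp add: blend_def)
    show "blend s F (sh k x) t = blend s F x (t + of_int k) - of_int k" if x: "x \<in> S" for x k t
      using x sh_S[OF x, of k] by (simp add: blend_def liftsD(3)[OF F x, of k t] algebra_simps)
    show "\<exists>L::nat. \<forall>x\<in>S. \<forall>t. \<bar>blend s F x t - t\<bar> \<le> real L" using disp by blast
    show "\<exists>n. \<forall>x\<in>S. \<forall>y\<in>S. agree n x y \<longrightarrow> (\<forall>t. \<bar>t\<bar> \<le> real M \<longrightarrow> blend s F x t = blend s F y t)" for M
    proof -
      obtain n where n: "\<forall>x\<in>S. \<forall>y\<in>S. agree n x y \<longrightarrow> (\<forall>t. \<bar>t\<bar> \<le> real M \<longrightarrow> F x t = F y t)"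
        using liftsD(4)[OF F, of M] by (elim exE)
      have "blend s F x t = blend s F y t" if "x \<in> S" "y \<in> S" "agree n x y" "\<bar>t\<bar> \<le> real M" for x y t
        using n[rule_format, OF that] that by (simp add: blend_def)
      then show ?thesis by blast
    qed
    fix x assume x: "x \<in> S"
    have Fx: "strict_mono (F x)" "continuous_on UNIV (F x)" using liftsD(2)[OF F x] by (auto simp: HM_def)
    have cont: "continuous_on UNIV (blend s F x)"
      using x by (auto simp: blend_def intro!: continuous_intros Fx)
    have "strict_mono (blend s F x)"
    proof (rule strict_monoI)
      fix a b :: real assume ab: "a < b"
      have "F x a < F x b" using strict_mono_less[OF Fx(1)] ab by blast
      then have "s * F x a \<le> s * F x b" using s by (intro mult_left_mono) auto
      moreover have "(1 - s) * a \<le> (1 - s) * b" using s ab by (intro mult_left_mono) auto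
      \<comment> \<open>For \<open>s = 1\<close> the second term increases strictly, otherwise the
        first one does.\<close>
      moreover have "(1 - s) * a < (1 - s) * b \<or> s * F x a < s * F x b"
        using s ab \<open>F x a < F x b\<close> by (cases "s = 1") auto
      ultimately show "blend s F x a < blend s F x b" using x by (auto simp: blend_def)
    qed
    moreover have "surj (blend s F x)"
    proof -
      have "\<exists>t. blend s F x t = y" for y
      proof -
        \<comment> \<open>Bounded displacement brackets \<open>y\<close> between two values, as the
          intermediate value theorem requires.\<close>
        have 1: "blend s F x (y - L) \<le> y" "y \<le> blend s F x (y + L)"
          using disp[OF x, of "y - L"] disp[OF x, of "y + L"] by linarith+
        obtain t where "blend s F x t = y"
          using IVT'[OF 1 _ continuous_on_subset[OF cont subset_UNIV]] by auto
        then show ?thesis by blast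
      qed
      then show ?thesis unfolding surj_def by metis
    qed
    ultimately show "blend s F x \<in> HM" using cont unfolding HM_def by blast
  qed
qed

lemma psi_isotopic:
  assumes F: "F \<in> lifts HM" shows "homotopic_with (homeomorphic_map Y Y) Y Y (\<lambda>y. y) (psi F)"
proof -
  let ?I = "subtopology euclideanreal {0..1}"
  define h where "h = (\<lambda>(s, y). psi (blend s F) y)"
  have eqv: "homeomorphic_map Y Y a \<longleftrightarrow> homeomorphic_map Y Y b" if "\<And>y. y \<in> topspace Y \<Longrightarrow> a y = b y" for a b
    using that homeomorphic_map_eq[of Y Y a b] homeomorphic_map_eq[of Y Y b a] by metis
  have bl: "blend s F \<in> lifts HM" if "s \<in> {0..1}" for s using blend_lifts[OF F] that by simp
  have "continuous_map (prod_topology ?I Y) Y h"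
  proof (rule continuous_compose_quotient_map)
    \<comment> \<open>The homotopy is defined on classes. Its continuity can be checked before
      passing to the quotient, because the product of a quotient map with the identity of a locally
      compact Hausdorff space is again a quotient map.\<close>
    show "quotient_map (prod_topology ?I P) (prod_topology ?I Y) (\<lambda>(s, p). (s, q p))"
    proof (rule quotient_map_prod_right[OF _ _ qmap])
      show "locally_compact_space ?I"
        by (intro compact_imp_locally_compact_space) (simp add: compact_space_subtopology)
      show "Hausdorff_space ?I \<or> regular_space ?I" by (simp add: Hausdorff_space_subtopology)
    qed
    have c: "continuous_map (prod_topology ?I P) euclideanreal (\<lambda>z. F (fst (snd z)) (snd (snd z)))"
      using continuous_map_compose[OF continuous_map_snd continuous_lift[OF F]] by (simp add: o_def)
    have f1: "continuous_map (prod_topology ?I P) euclideanreal fst"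
      using continuous_map_into_fulltopology[OF continuous_map_fst] .
    have f2: "continuous_map (prod_topology ?I P) X (\<lambda>z. fst (snd z))"
      using continuous_map_compose[OF continuous_map_snd continuous_map_fst] by (simp add: o_def)
    have f3: "continuous_map (prod_topology ?I P) euclideanreal (\<lambda>z. snd (snd z))"
      using continuous_map_compose[OF continuous_map_snd continuous_map_snd] by (simp add: o_def)
    have "continuous_map (prod_topology ?I P) P
        (\<lambda>z. (fst (snd z), (1 - fst z) * snd (snd z) + fst z * F (fst (snd z)) (snd (snd z))))"
      by (intro continuous_map_pairedI f2 continuous_map_add continuous_map_real_mult continuous_map_diff
          continuous_map_const[THEN iffD2] f1 f3 c) simp
    then have "continuous_map (prod_topology ?I P) Y
        (q \<circ> (\<lambda>z. (fst (snd z), (1 - fst z) * snd (snd z) + fst z * F (fst (snd z)) (snd (snd z)))))"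
      by (rule continuous_map_compose) (rule quotient_imp_continuous_map[OF qmap])
    then show "continuous_map (prod_topology ?I P) Y (h \<circ> (\<lambda>(s, p). (s, q p)))"
    proof (rule continuous_map_eq)
      fix z assume "z \<in> topspace (prod_topology ?I P)"
      then obtain s x t where z: "z = (s, (x, t))" "s \<in> {0..1}" "x \<in> S" by (cases z) auto
      show "(q \<circ> (\<lambda>z. (fst (snd z), (1 - fst z) * snd (snd z) + fst z * F (fst (snd z)) (snd (snd z))))) z
          = (h \<circ> (\<lambda>(s, p). (s, q p))) z"
        using psi_q[OF bl[OF z(2)] z(3)] z(3) unfolding z(1) h_def by (simp add: blend_def)
    qed
  qed
  moreover have "h (0, y) = y" if yY: "y \<in> topspace Y" for y
  proof -
    obtain x t where xt: "x \<in> S" "y = q (x, t)" using Y_cases[OF yY] .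
    show ?thesis unfolding h_def xt(2) using psi_q[OF bl xt(1), of 0 t] xt(1) by (simp add: blend_def)
  qed
  moreover have "h (1, y) = psi F y" if yY: "y \<in> topspace Y" for y
  proof -
    obtain x t where xt: "x \<in> S" "y = q (x, t)" using Y_cases[OF yY] .
    show ?thesis unfolding h_def xt(2) using psi_q[OF bl xt(1), of 1 t] psi_q[OF F xt(1)] xt(1) by (simp add: blend_def)
  qed
  moreover have "homeomorphic_map Y Y (\<lambda>y. h (s, y))" if "s \<in> {0..1}" for s
    using psi_homeomorphic[OF bl[OF that]] unfolding h_def by (simp add: eta_contract_eq)
  ultimately have ex: "\<exists>h. continuous_map (prod_topology ?I Y) Y h \<and> (\<forall>y\<in>topspace Y. h (0, y) = y) \<and>
      (\<forall>y\<in>topspace Y. h (1, y) = psi F y) \<and> (\<forall>s\<in>{0..1}. homeomorphic_map Y Y (\<lambda>y. h (s, y)))"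
    by (intro exI[of _ h] conjI ballI)
  show ?thesis by (rule iffD2[OF homotopic_with ex]) (rule eqv)
qed

lemma psi_H0: assumes F: "F \<in> lifts HM" shows "psi F \<in> H0 X shift"
  unfolding H0_def using psi_isotopic[OF F] psi_homeomorphic[OF F] by (simp add: psi_def)

lemma TL_HM: "F \<in> TL \<Longrightarrow> F \<in> lifts HM"
  unfolding lifts_def using PL_subset_HM by blast

text \<open>A chart demands a return time strictly larger than its height; the additional 1 in the
  freeness assumption pays for the strictness.\<close>

lemma is_chart_cyl:
  assumes fr: "free (cyl n x) (b - a + 1)" and ab: "a < b"
  shows "is_chart X shift (cyl n x) {a<..<b}"
  unfolding is_chart_def
proof (intro conjI exI)
  show "openin X (cyl n x)" "closedin X (cyl n x)" unfolding cyl_def by (rule openin_cylinder closedin_cylinder)+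
  show "a < b" by (rule ab)
  \<comment> \<open>Return times are extended naturals, so the strict comparison goes through the
    least integer above \<open>b - a\<close>.\<close>
  define N where "N = Suc (nat \<lfloor>b - a\<rfloor>)"
  have N: "b - a < real N" unfolding N_def by linarith
  have "enat N \<le> return_time shift (cyl n x)"
    unfolding return_time_def
  proof (rule INF_greatest)
    fix m assume "m \<in> {m. 1 \<le> m \<and> (\<exists>y\<in>cyl n x. (shift ^^ m) y \<in> cyl n x)}"
    then obtain y where y: "1 \<le> m" "y \<in> cyl n x" "sh (int m) y \<in> cyl n x" by (auto simp: funpow_shift)
    have "\<not> real m < b - a + 1"
    proof
      assume a: "real m < b - a + 1"
      then have "int m = 0" using freeD[OF fr, of "int m" y 0] y ab by simp
      then show False using y(1) by simp
    qed
    then have "real_of_int \<lfloor>b - a\<rfloor> \<le> real_of_int (int m - 1)" using of_int_floor_le[of "b - a"] by simp linarith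
    then have "\<lfloor>b - a\<rfloor> \<le> int m - 1" by (simp only: of_int_le_iff)
    then have "N \<le> m" unfolding N_def using y(1) by linarith
    then show "enat N \<le> enat m" by simp
  qed
  then have "ereal_of_enat (enat N) \<le> ereal_of_enat (return_time shift (cyl n x))"
    by (simp only: ereal_of_enat_le_iff)
  moreover have "ereal (b - a) < ereal_of_enat (enat N)" using N by simp
  ultimately show "ereal (b - a) < ereal_of_enat (return_time shift (cyl n x))" by (rule less_le_trans[rotated])
qed simp

lemma inj_chart:
  assumes fr: "free (cyl n x) (b - a + 1)" shows "inj_on q (cyl n x \<times> {a<..<b})"
proof (rule inj_onI, clarify)
  fix y s z r assume a: "y \<in> cyl n x" "s \<in> {a<..<b}" "z \<in> cyl n x" "r \<in> {a<..<b}" "q (y, s) = q (z, r)"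
  then obtain k where k: "z = sh k y" "r = s - of_int k" using q_eq_iff[of y z s r] cyl_subset by blast
  have "k = 0" by (rule freeD[OF fr, of k y 0]) (use a k in auto)
  then show "y = z \<and> s = r" using k by simp
qed

lemma psi_T_set: assumes F: "F \<in> TL" shows "psi F \<in> T_set X shift"
  unfolding T_set_def
proof (intro CollectI conjI ballI)
  show "psi F \<in> H0 X shift" by (rule psi_H0[OF TL_HM[OF F]])
  fix y assume "y \<in> topspace (suspension X shift)"
  then obtain x t where xt: "x \<in> S" "y = q (x, t)" using Y_cases by metis
  define f where "f = F x"
  have f: "f \<in> PL" unfolding f_def by (rule TL_PL[OF F])
  then have "PLloc f" using PL_def by blast
  then obtain e where e: "e > 0" "aff_on f {t-e..t}" "aff_on f {t..t+e}" "t \<in> dyadic_rationals \<or> aff_on f {t-e..t+e}"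
    using PLlocE by metis
  obtain u where u: "u \<in> dyadic_rationals" "t - e < u" "u < t" using dyadic_dense[of "t - e" t] e(1) by auto
  obtain v where v: "v \<in> dyadic_rationals" "t < v" "v < t + e" using dyadic_dense[of t "t + e"] e(1) by auto
  define M where "M = nat \<lceil>\<bar>u\<bar> + \<bar>v\<bar>\<rceil>"
  obtain n2 where n2: "\<forall>x\<in>S. \<forall>y\<in>S. agree n2 x y \<longrightarrow> (\<forall>t. \<bar>t\<bar> \<le> real M \<longrightarrow> F x t = F y t)"
    using liftsD(4)[OF F, of M] by (elim exE)
  \<comment> \<open>The source box and its image both have to be charts, so the larger of the two
    heights counts.\<close>
  obtain n1 where n1: "free (cyl n1 x) (max (v - u) (f v - f u) + 1)" using free_small[OF xt(1)] by blast
  define n where "n = max n1 n2"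
  have fr: "free (cyl n x) (max (v - u) (f v - f u) + 1)" by (rule free_cyl_mono[OF n1]) (simp add: n_def)
  have fr1: "free (cyl n x) (v - u + 1)" by (rule free_mono[OF fr]) auto
  have fr2: "free (cyl n x) (f v - f u + 1)" by (rule free_mono[OF fr]) auto
  have uv: "u < v" using u v by simp
  have fuv: "f u < f v" using PL_less_iff[OF f] uv by simp
  have im: "f ` {u<..<v} = {f u<..<f v}" by (rule PL_image_Ioo[OF f])
  have loc: "F z s = f s" if z: "z \<in> cyl n x" and s: "s \<in> {u<..<v}" for z s
  proof -
    have zS: "z \<in> S" "agree n2 x z" using z agree_mono[of n x z n2] by (auto simp: cyl_def n_def)
    have "\<bar>s\<bar> \<le> real M" using s unfolding M_def greaterThanLessThan_iff by linarith
    then show ?thesis using n2[rule_format, OF xt(1) zS] by (simp add: f_def)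
  qed
  have val: "psi F (q (z, s)) = q (z, f s)" if "z \<in> cyl n x" "s \<in> {u<..<v}" for z s
    using psi_q[OF F, of z s] loc[OF that] that(1) cyl_subset by auto
  show "\<exists>C J f. is_chart X shift C J \<and> dyadic_interval J \<and> y \<in> chart_domain X shift C J \<and>
     dyadic_PL_homeo J (f ` J) f \<and> is_chart X shift C (f ` J) \<and>
     psi F ` chart_domain X shift C J = chart_domain X shift C (f ` J) \<and>
     (\<forall>x\<in>C. \<forall>t\<in>J. inv_into (C \<times> f ` J) q (psi F (q (x, t))) = (x, f t))"
  proof (intro exI[of _ "cyl n x"] exI[of _ "{u<..<v}"] exI[of _ f] conjI ballI)
    show "is_chart X shift (cyl n x) {u<..<v}" by (rule is_chart_cyl[OF fr1 uv])
    show "dyadic_interval {u<..<v}" by (rule dyadic_interval_Ioo[OF uv u(1) v(1)])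
    show "y \<in> chart_domain X shift (cyl n x) {u<..<v}"
      unfolding chart_domain_def xt(2) using cyl_self[OF xt(1)] u v by auto
    show "dyadic_PL_homeo {u<..<v} (f ` {u<..<v}) f"
      by (rule PL_local_dyadic_PL_homeo[OF f u(3) v(2) u(1) v(1) _ _ e(2-4)]) (use u v in auto)
    show "is_chart X shift (cyl n x) (f ` {u<..<v})" unfolding im by (rule is_chart_cyl[OF fr2 fuv])
    show "psi F ` chart_domain X shift (cyl n x) {u<..<v} = chart_domain X shift (cyl n x) (f ` {u<..<v})"
    proof -
      have "psi F ` q ` (cyl n x \<times> {u<..<v}) = (\<lambda>(z, s). q (z, f s)) ` (cyl n x \<times> {u<..<v})"
        unfolding image_image by (rule image_cong) (auto simp: val)
      also have "\<dots> = q ` (\<lambda>(z, s). (z, f s)) ` (cyl n x \<times> {u<..<v})" by (simp add: image_image split_beta)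
      also have "(\<lambda>(z, s). (z, f s)) ` (cyl n x \<times> {u<..<v}) = cyl n x \<times> f ` {u<..<v}" by auto
      finally show ?thesis unfolding chart_domain_def .
    qed
    fix z s assume zs: "z \<in> cyl n x" "s \<in> {u<..<v}"
    show "inv_into (cyl n x \<times> f ` {u<..<v}) q (psi F (q (z, s))) = (z, f s)"
      unfolding val[OF zs] by (rule inv_into_f_f) (use inj_chart[OF fr2] zs im in auto)
  qed
qed

end



section \<open>From chart maps back to lifts\<close>

context minimal_subshift
begin

text \<open>The chart sees the point through a shifted representative
  \<open>(sh n x, t - n)\<close>; translating back by \<open>n\<close> gives a formula at
  \<open>(x, t)\<close> itself. Only the germ of \<open>h\<close> at \<open>t\<close> is controlled,
  since \<open>f\<close> is prescribed on \<open>J\<close> alone.\<close>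

lemma T_set_local:
  assumes g: "g \<in> T_set X shift" and x: "x \<in> S"
  obtains m d h e where "d > 0" "\<And>x' t'. x' \<in> cyl m x \<Longrightarrow> \<bar>t' - t\<bar> < d \<Longrightarrow> g (q (x', t')) = q (x', h t')"
    "e > 0" "aff_on h {t-e..t}" "aff_on h {t..t+e}" "t \<in> dyadic_rationals \<or> aff_on h {t-e..t+e}"
proof -
  have "\<exists>C J f. is_chart X shift C J \<and> dyadic_interval J \<and> q (x, t) \<in> chart_domain X shift C J \<and>
     dyadic_PL_homeo J (f ` J) f \<and> is_chart X shift C (f ` J) \<and>
     g ` chart_domain X shift C J = chart_domain X shift C (f ` J) \<and>
     (\<forall>x\<in>C. \<forall>t\<in>J. inv_into (C \<times> f ` J) q (g (q (x, t))) = (x, f t))"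
    using g q_in_Y[OF x] unfolding T_set_def by simp
  then obtain C J f where ch: "is_chart X shift C J" and y: "q (x, t) \<in> chart_domain X shift C J"
    and f: "dyadic_PL_homeo J (f ` J) f" and im: "g ` chart_domain X shift C J = chart_domain X shift C (f ` J)"
    and iv: "\<forall>x\<in>C. \<forall>t\<in>J. inv_into (C \<times> f ` J) q (g (q (x, t))) = (x, f t)"
    by (elim exE conjE)
  obtain a b where ab: "a < b" "J = {a<..<b}" using ch unfolding is_chart_def by (elim exE conjE)
  have C: "openin X C" using ch unfolding is_chart_def by (elim conjE)
  have CS: "C \<subseteq> S" by (rule openin_subset[OF C])
  \<comment> \<open>\<open>inv_into\<close> is meaningful only on the image of the chart; the
    condition on the chart domains places \<open>g (q (z, s))\<close> there.\<close>
  have val: "g (q (z, s)) = q (z, f s)" if zs: "z \<in> C" "s \<in> J" for z s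
  proof -
    have "q (z, s) \<in> chart_domain X shift C J" unfolding chart_domain_def using zs by blast
    then have "g (q (z, s)) \<in> q ` (C \<times> f ` J)" using im unfolding chart_domain_def by blast
    then have "q (inv_into (C \<times> f ` J) q (g (q (z, s)))) = g (q (z, s))" by (rule f_inv_into_f)
    then show ?thesis using iv zs by simp
  qed
  obtain x0 t0 where x0: "x0 \<in> C" "t0 \<in> J" "q (x, t) = q (x0, t0)" using y unfolding chart_domain_def by auto
  then obtain n where n: "x0 = sh n x" "t0 = t - of_int n" using q_eq_iff[of x x0 t t0] x CS by blast
  obtain r where r: "{y \<in> S. agree r x0 y} \<subseteq> C" using openin_contains_cylinder[OF C x0(1)] by blast
  obtain e where e: "e > 0" "{t0-e..t0+e} \<subseteq> J" "aff_on f {t0-e..t0}" "aff_on f {t0..t0+e}"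
    "t0 \<in> dyadic_rationals \<or> aff_on f {t0-e..t0+e}"
    using dyadic_PL_homeo_germ[OF f ab(2) x0(2)] by metis
  define h where "h = (\<lambda>t. f (t - of_int n) + of_int n)"
  have main: "g (q (x', t')) = q (x', h t')" if x': "x' \<in> cyl (r + nat \<bar>n\<bar>) x" and t': "\<bar>t' - t\<bar> < e" for x' t'
  proof -
    have xS: "x' \<in> S" "agree r x0 (sh n x')" using x' agree_sh unfolding n(1) by (auto simp: cyl_def)
    then have C': "sh n x' \<in> C" using r sh_S by blast
    have "t' - of_int n \<in> {t0-e..t0+e}" using t' unfolding n(2) by (auto simp: abs_less_iff)
    then have J': "t' - of_int n \<in> J" using e(2) by blast
    have "q (x', t') = q (sh n x', t' - of_int n)" using q_sh[OF xS(1)] by simp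
    also have "g \<dots> = q (sh n x', f (t' - of_int n))" by (rule val[OF C' J'])
    also have "\<dots> = q (x', h t')" unfolding q_sh[OF xS(1)] h_def ..
    finally show ?thesis .
  qed
  have tr: "aff_on f {c-of_int n..d-of_int n} \<Longrightarrow> aff_on h {c..d}" for c d
    by (rule aff_on_translate[of f "{c-of_int n..d-of_int n}" _ n]) (auto simp: h_def)
  have dy: "t \<in> dyadic_rationals" if "t0 \<in> dyadic_rationals"
    using dyadic_add[OF that dyadic_of_int[of n]] unfolding n(2) by simp
  show thesis
  proof (rule that[OF e(1) main e(1)])
    show "aff_on h {t-e..t}" using e(3) unfolding n(2) by (intro tr) (simp add: algebra_simps)
    show "aff_on h {t..t+e}" using e(4) unfolding n(2) by (intro tr) (simp add: algebra_simps)
    show "t \<in> dyadic_rationals \<or> aff_on h {t-e..t+e}"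
    proof (cases "t0 \<in> dyadic_rationals")
      case True then show ?thesis using dy by blast
    next
      case False
      then have "aff_on f {t0-e..t0+e}" using e(5) by blast
      then have "aff_on h {t-e..t+e}" unfolding n(2) by (intro tr) (simp add: algebra_simps)
      then show ?thesis ..
    qed
  qed auto
qed

text \<open>Compactness is used twice: along \<open>[-M,M]\<close> for a fixed point, by interval
  induction, and then over the points of \<open>S\<close>.\<close>

lemma lifts_locality_criterion:
  assumes loc: "\<And>x t. x \<in> S \<Longrightarrow> \<exists>m. \<exists>d>0. \<forall>y\<in>cyl m x. \<forall>s. \<bar>s - t\<bar> < d \<longrightarrow> F y s = F x s"
  shows "\<exists>n. \<forall>x\<in>S. \<forall>y\<in>S. agree n x y \<longrightarrow> (\<forall>t. \<bar>t\<bar> \<le> real M \<longrightarrow> F x t = F y t)"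
proof -
  have "\<exists>n. \<forall>y\<in>cyl n x. \<forall>t\<in>{- real M..real M}. F y t = F x t" if x: "x \<in> S" for x
  proof -
    have "- real M \<le> real M" by simp
    then show ?thesis
    proof (induction rule: Bolzano)
      case (trans a b c)
      then obtain n1 n2 where n: "\<forall>y\<in>cyl n1 x. \<forall>t\<in>{a..b}. F y t = F x t" "\<forall>y\<in>cyl n2 x. \<forall>t\<in>{b..c}. F y t = F x t" by blast
      have "\<forall>y\<in>cyl (max n1 n2) x. \<forall>t\<in>{a..c}. F y t = F x t"
      proof (intro ballI)
        fix y t assume y: "y \<in> cyl (max n1 n2) x" and t: "t \<in> {a..c}"
        have "y \<in> cyl n1 x" "y \<in> cyl n2 x" using y cyl_mono[of n1 "max n1 n2" x] cyl_mono[of n2 "max n1 n2" x] by auto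
        moreover have "t \<in> {a..b} \<or> t \<in> {b..c}" using t by auto
        ultimately show "F y t = F x t" using n by blast
      qed
      then show ?case by blast
    next
      case (local t)
      obtain m d where md: "d > 0" "\<forall>y\<in>cyl m x. \<forall>s. \<bar>s - t\<bar> < d \<longrightarrow> F y s = F x s" using loc[OF x] by blast
      have "\<forall>y\<in>cyl m x. \<forall>s\<in>{a..b}. F y s = F x s" if ab: "a \<le> t" "t \<le> b" "b - a < d" for a b
      proof (intro ballI)
        fix y s assume y: "y \<in> cyl m x" and s: "s \<in> {a..b}"
        have "\<bar>s - t\<bar> < d" using s ab by (auto simp: abs_less_iff)
        then show "F y s = F x s" using md(2) y by blast
      qed
      then show ?case using md(1) by blast
    qed
  qed
  then obtain nn where nn: "\<forall>x\<in>S. \<forall>y\<in>cyl (nn x) x. \<forall>t\<in>{- real M..real M}. F y t = F x t" by metis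
  obtain U where U: "finite U" "U \<subseteq> S" "\<forall>y\<in>S. \<exists>x\<in>U. agree (nn x) x y" using compactness[of nn] by blast
  obtain n where n: "\<forall>x\<in>U. nn x \<le> n" using U(1) by (meson Max_ge finite_imageI image_eqI)
  have "F x t = F y t" if xy: "x \<in> S" "y \<in> S" "agree n x y" and t: "\<bar>t\<bar> \<le> real M" for x y t
  proof -
    obtain z where z: "z \<in> U" "agree (nn z) z x" using U(3) xy(1) by blast
    have "nn z \<le> n" using n z(1) by blast
    then have "agree (nn z) x y" by (rule agree_mono[OF xy(3)])
    then have "agree (nn z) z y" by (rule agree_trans[OF z(2)])
    then have "x \<in> cyl (nn z) z" "y \<in> cyl (nn z) z" using xy z by (simp_all add: cyl_def)
    moreover have "t \<in> {- real M..real M}" using t by auto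
    moreover have "z \<in> S" using z(1) U(2) by blast
    ultimately have "F x t = F z t" "F y t = F z t" using nn by blast+
    then show ?thesis by simp
  qed
  then show ?thesis by blast
qed

text \<open>Equivariance reduces to times in \<open>[0,1]\<close>. There monotonicity bounds
  \<open>F x\<close> by its values at 0 and 1, and locality leaves only finitely many such
  values.\<close>

lemma bounded_displacement_criterion:
  assumes eqv: "\<And>x k t. x \<in> S \<Longrightarrow> F (sh k x) t = F x (t + of_int k) - of_int k"
    and mono: "\<And>x. x \<in> S \<Longrightarrow> strict_mono (F x)"
    and loc: "\<exists>n. \<forall>x\<in>S. \<forall>y\<in>S. agree n x y \<longrightarrow> (\<forall>t. \<bar>t\<bar> \<le> real 1 \<longrightarrow> F x t = F y t)"
  shows "\<exists>L::nat. \<forall>x\<in>S. \<forall>t. \<bar>F x t - t\<bar> \<le> L"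
proof -
  obtain n where n: "\<forall>x\<in>S. \<forall>y\<in>S. agree n x y \<longrightarrow> (\<forall>t. \<bar>t\<bar> \<le> real 1 \<longrightarrow> F x t = F y t)" using loc by blast
  obtain U where U: "finite U" "U \<subseteq> S" "\<forall>y\<in>S. \<exists>x\<in>U. agree n x y" using compactness[of "\<lambda>_. n"] by blast
  define B where "B = (\<Sum>x\<in>U. \<bar>F x 0\<bar> + \<bar>F x 1\<bar>)"
  have small: "\<bar>F y s - s\<bar> \<le> B + 1" if y: "y \<in> S" and s: "0 \<le> s" "s \<le> 1" for y s
  proof -
    obtain x where x: "x \<in> U" "agree n x y" using U(3) y by blast
    have xS: "x \<in> S" using x U by blast
    have eq: "F y 0 = F x 0" "F y 1 = F x 1"
      using n[rule_format, OF xS y x(2), of 0] n[rule_format, OF xS y x(2), of 1] by simp_all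
    have "\<bar>F x 0\<bar> + \<bar>F x 1\<bar> \<le> B" unfolding B_def by (rule member_le_sum[OF x(1)]) (use U(1) in auto)
    moreover have "F y 0 \<le> F y s" "F y s \<le> F y 1" using strict_mono_less_eq[OF mono[OF y]] s by simp_all
    ultimately show ?thesis using s unfolding eq by linarith
  qed
  define L where "L = nat \<lceil>B + 1\<rceil>"
  have "\<bar>F x t - t\<bar> \<le> real L" if x: "x \<in> S" for x t
  proof -
    have "F (sh \<lfloor>t\<rfloor> x) (t - of_int \<lfloor>t\<rfloor>) = F x t - of_int \<lfloor>t\<rfloor>" using eqv[OF x, of "\<lfloor>t\<rfloor>" "t - of_int \<lfloor>t\<rfloor>"] by simp
    moreover have "\<bar>F (sh \<lfloor>t\<rfloor> x) (t - of_int \<lfloor>t\<rfloor>) - (t - of_int \<lfloor>t\<rfloor>)\<bar> \<le> B + 1"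
      by (rule small[OF sh_S[OF x]]) linarith+
    ultimately have "\<bar>F x t - t\<bar> \<le> B + 1" by simp
    then show ?thesis unfolding L_def using real_nat_ceiling_ge[of "B + 1"] by linarith
  qed
  then show ?thesis by blast
qed

lemma T_set_homeomorphism:
  assumes "g \<in> T_set X shift" shows "g \<in> extensional (topspace Y)" "homeomorphic_map Y Y g"
  using assms unfolding T_set_def H0_def by blast+

lemma psi_surjective:
  assumes g: "g \<in> T_set X shift" shows "\<exists>F\<in>TL. psi F = g"
proof -
  \<comment> \<open>Uniqueness of \<open>s\<close> comes from \<open>q_inject\<close>, existence
    from the local formula of \<open>T_set_local\<close>.\<close>
  define F where "F = (\<lambda>x. if x \<in> S then (\<lambda>t. THE s. g (q (x, t)) = q (x, s)) else id)"
  have FI: "F x t = s" if x: "x \<in> S" and s: "g (q (x, t)) = q (x, s)" for x t s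
  proof -
    have "(THE s. g (q (x, t)) = q (x, s)) = s"
    proof (rule the_equality)
      show "g (q (x, t)) = q (x, s)" by (rule s)
      fix r assume "g (q (x, t)) = q (x, r)"
      then have "q (x, r) = q (x, s)" using s by simp
      then show "r = s" by (rule q_inject[OF x])
    qed
    then show ?thesis using x by (simp add: F_def)
  qed
  have gF: "g (q (x, t)) = q (x, F x t)" if x: "x \<in> S" for x t
  proof -
    obtain m d h e where md: "d > 0" "\<And>x' t'. x' \<in> cyl m x \<Longrightarrow> \<bar>t' - t\<bar> < d \<Longrightarrow> g (q (x', t')) = q (x', h t')"
      and e: "e > 0" "aff_on h {t-e..t}" "aff_on h {t..t+e}" "t \<in> dyadic_rationals \<or> aff_on h {t-e..t+e}"
      by (rule T_set_local[OF g x, of t]) (rule that)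
    have "g (q (x, t)) = q (x, h t)" using md cyl_self[OF x] by simp
    then show ?thesis using FI[OF x] by simp
  qed
  have eqv: "F (sh k x) t = F x (t + of_int k) - of_int k" if x: "x \<in> S" for x k t
  proof (rule FI[OF sh_S[OF x]])
    show "g (q (sh k x, t)) = q (sh k x, F x (t + of_int k) - of_int k)"
      using gF[OF x] by (simp add: q_sh[OF x])
  qed
  have loc: "\<exists>m. \<exists>d>0. \<forall>y\<in>cyl m x. \<forall>s. \<bar>s - t\<bar> < d \<longrightarrow> F y s = F x s" if x: "x \<in> S" for x t
  proof -
    obtain m d h e where md: "d > 0" "\<And>x' t'. x' \<in> cyl m x \<Longrightarrow> \<bar>t' - t\<bar> < d \<Longrightarrow> g (q (x', t')) = q (x', h t')"
      and e: "e > 0" "aff_on h {t-e..t}" "aff_on h {t..t+e}" "t \<in> dyadic_rationals \<or> aff_on h {t-e..t+e}"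
      by (rule T_set_local[OF g x, of t]) (rule that)
    have "F y s = h s" if "y \<in> cyl m x" "\<bar>s - t\<bar> < d" for y s
      using FI[OF _ md(2)[OF that]] that(1) cyl_subset by blast
    then have "\<forall>y\<in>cyl m x. \<forall>s. \<bar>s - t\<bar> < d \<longrightarrow> F y s = F x s" using cyl_self[OF x, of m] by simp
    then show ?thesis using md(1) by blast
  qed
  have pl: "PLloc (F x)" if x: "x \<in> S" for x unfolding PLloc_def
  proof
    fix t
    obtain m d h e where md: "d > 0" "\<And>x' t'. x' \<in> cyl m x \<Longrightarrow> \<bar>t' - t\<bar> < d \<Longrightarrow> g (q (x', t')) = q (x', h t')"
      and e: "e > 0" "aff_on h {t-e..t}" "aff_on h {t..t+e}" "t \<in> dyadic_rationals \<or> aff_on h {t-e..t+e}"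
      by (rule T_set_local[OF g x, of t]) (rule that)
    have Fh: "F x s = h s" if "\<bar>s - t\<bar> < d" for s by (rule FI[OF x md(2)[OF cyl_self[OF x] that]])
    define r where "r = min e (d/2)"
    have r: "r > 0" "r \<le> e" "r < d" using e(1) md(1) by (auto simp: r_def min_def)
    have *: "aff_on (F x) B" if "aff_on h A" "B \<subseteq> A" "B \<subseteq> {t-r..t+r}" for A B
    proof (rule aff_on_cong[OF aff_on_subset[OF that(1,2)]])
      fix s assume "s \<in> B"
      then have "t - r \<le> s" "s \<le> t + r" using that(3) by auto
      then show "F x s = h s" using r(3) by (intro Fh) (simp add: abs_less_iff)
    qed
    have "aff_on (F x) {t-r..t}" by (rule *[OF e(2)]) (use r in auto)
    moreover have "aff_on (F x) {t..t+r}" by (rule *[OF e(3)]) (use r in auto)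
    moreover have "aff_on (F x) {t-r..t+r}" if "aff_on h {t-e..t+e}" by (rule *[OF that]) (use r in auto)
    ultimately show "\<exists>e>0. aff_on (F x) {t-e..t} \<and> aff_on (F x) {t..t+e} \<and> (t \<in> dyadic_rationals \<or> aff_on (F x) {t-e..t+e})"
      using e(4) r(1) by blast
  qed
  have su: "surj (F x)" if x: "x \<in> S" for x
  proof -
    \<comment> \<open>\<open>g\<close> maps every orbit line into itself, so a preimage of
      \<open>q (x, s)\<close> lies on the line of \<open>x\<close>.\<close>
    have "\<exists>t. F x t = s" for s
    proof -
      have "g ` topspace Y = topspace Y" using T_set_homeomorphism(2)[OF g] homeomorphic_imp_surjective_map by blast
      then obtain y where y: "y \<in> topspace Y" "g y = q (x, s)" using q_in_Y[OF x, of s] by (metis imageE)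
      obtain x' t' where x': "x' \<in> S" "y = q (x', t')" using Y_cases[OF y(1)] .
      have "q (x', F x' t') = q (x, s)" using gF[OF x'(1)] y(2) x'(2) by simp
      then obtain n where n: "x = sh n x'" using q_eq_iff x x' by blast
      have "y = q (x, t' - of_int n)" unfolding n q_sh[OF x'(1)] x'(2) by simp
      then have "F x (t' - of_int n) = s" using FI[OF x] y(2) by simp
      then show ?thesis by blast
    qed
    then show ?thesis unfolding surj_def by metis
  qed
  have local: "\<exists>n. \<forall>x\<in>S. \<forall>y\<in>S. agree n x y \<longrightarrow> (\<forall>t. \<bar>t\<bar> \<le> real M \<longrightarrow> F x t = F y t)" for M
    by (rule lifts_locality_criterion) (rule loc)
  have "\<exists>L::nat. \<forall>x\<in>S. \<forall>t. \<bar>F x t - t\<bar> \<le> L"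
    by (rule bounded_displacement_criterion) (use eqv PLloc_strict_mono[OF pl] local in blast)+
  then have F: "F \<in> TL" unfolding lifts_def PL_def using eqv pl su local by (simp add: F_def)
  have "psi F = g"
  proof (rule extensionalityI[of _ "topspace Y"])
    show "psi F \<in> extensional (topspace Y)" by (simp add: psi_def)
    show "g \<in> extensional (topspace Y)" by (rule T_set_homeomorphism(1)[OF g])
    fix y assume "y \<in> topspace Y"
    then obtain x t where xt: "x \<in> S" "y = q (x, t)" using Y_cases by metis
    show "psi F y = g y" unfolding xt(2) psi_q[OF F xt(1)] gF[OF xt(1)] ..
  qed
  then show ?thesis using F by blast
qed

lemma psi_injective: assumes F: "F \<in> TL" and G: "G \<in> TL" and eq: "psi F = psi G" shows "F = G"
proof (intro ext)
  fix x t
  show "F x t = G x t"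
  proof (cases "x \<in> S")
    case True
    have "q (x, F x t) = q (x, G x t)" using psi_q[OF F True, of t] psi_q[OF G True, of t] eq by simp
    then show ?thesis by (rule q_inject[OF True])
  next
    case False then show ?thesis using liftsD(1)[OF F] liftsD(1)[OF G] by simp
  qed
qed

lemma psi_Bij: assumes "F \<in> TL" shows "psi F \<in> Bij (topspace Y)"
proof -
  have h: "homeomorphic_map Y Y (psi F)" by (rule psi_homeomorphic[OF TL_HM[OF assms]])
  then have "bij_betw (psi F) (topspace Y) (topspace Y)"
    unfolding bij_betw_def using homeomorphic_imp_injective_map homeomorphic_imp_surjective_map by blast
  then show ?thesis unfolding Bij_def by (simp add: psi_def)
qed

lemma psi_iso: "psi \<in> iso TLG (T_group X shift)"
proof (rule isoI)
  show "psi \<in> hom TLG (T_group X shift)"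
  proof (rule homI)
    show "psi F \<in> carrier (T_group X shift)" if "F \<in> carrier TLG" for F
      using psi_T_set that by (simp add: T_group_def)
    show "psi (F \<otimes>\<^bsub>TLG\<^esub> G) = psi F \<otimes>\<^bsub>T_group X shift\<^esub> psi G" if "F \<in> carrier TLG" "G \<in> carrier TLG" for F G
    proof -
      have FG: "F \<in> TL" "G \<in> TL" using that by simp_all
      have "psi (mulF F G) = compose (topspace Y) (psi F) (psi G)"
      proof (rule extensionalityI[of _ "topspace Y"])
        show "psi (mulF F G) \<in> extensional (topspace Y)" by (simp add: psi_def)
        show "psi (mulF F G) y = compose (topspace Y) (psi F) (psi G) y" if "y \<in> topspace Y" for y
          using psi_mult[OF FG(1,2) TL_mult[OF FG] that] that by (simp add: compose_eq)
      qed simp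
      then show ?thesis using psi_Bij FG by (simp add: T_group_def BijGroup_def)
    qed
  qed
  have "inj_on psi TL" using psi_injective by (intro inj_onI)
  moreover have "psi ` TL = T_set X shift" using psi_T_set psi_surjective by blast
  ultimately show "bij_betw psi (carrier TLG) (carrier (T_group X shift))"
    by (simp add: bij_betw_def T_group_def)
qed

text \<open>The isomorphism transports the group laws with \<open>psi\<close> of the identity as
  unit, so this unit has to be identified with the one inherited from
  \<open>BijGroup\<close>.\<close>

lemma group_T_group: "group (T_group X shift)"
proof -
  have "psi (\<lambda>x. id) = (\<lambda>y\<in>topspace Y. y)"
  proof (rule extensionalityI[of _ "topspace Y"])
    fix y assume y: "y \<in> topspace Y"
    then obtain x t where xt: "x \<in> S" "y = q (x, t)" using Y_cases by metis
    show "psi (\<lambda>x. id) y = (\<lambda>y\<in>topspace Y. y) y" using y unfolding xt(2) psi_q[OF TL_one xt(1)] by simp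
  qed (simp_all add: psi_def)
  then have "T_group X shift\<lparr>one := psi \<one>\<^bsub>TLG\<^esub>\<rparr> = T_group X shift"
    by (simp add: T_group_def BijGroup_def)
  then show ?thesis using group.iso_imp_img_group[OF group_TLG psi_iso] by simp
qed

end

theorem corollary3:
  fixes A :: "'a set" and X :: "(int \<Rightarrow> 'a) topology"
  assumes "finite A"
    and "subshift A X"
    and "minimal_system X shift"
    and "infinite (topspace X)"
  shows "is_simple (T_group X shift) \<and> finitely_generated (T_group X shift) \<and>
    left_orderable (T_group X shift)"
proof -
  interpret minimal_subshift A X using assms by unfold_locales
  note iso = psi_iso group_TLG group_T_group
  show ?thesis
    using simple_transfer[OF iso TLG_simple] finitely_generated_transfer[OF iso TLG_finitely_generated]
      left_orderable_transfer[OF iso TLG_left_orderable] by blast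
qed

end
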